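(* Let $F$, $B$, $W$ be as in the context. Assume that for every $t\in[0,T]$, $F(t,\cdot):\mathcal D(M)\to\mathcal D(M)$ is a $C^2$ function with bounded derivatives up to order $2$; that $B(t)\in HS(U_0,\mathcal D(M))$ for every $t\in[0,T]$; and that $u_0=(\mathbf E_0^T,\mathbf H_0^T)^T$ is an $\mathcal F_0$-measurable $\mathbb H$-valued random variable with $\|u_0\|_{L^p(\Omega;\mathcal D(M))}<\infty$ for some $p\ge2$. Let $u=(\mathbf E^T,\mathbf H^T)^T$ be the mild solution of $du(t)=[Mu(t)+F(t,u(t))]dt+B(t)dW(t)$, $t\in(0,T]$, $u(0)=u_0$. Then the averaged divergence satisfies, for $t\in[0,T]$, $$\mathbb E\big(\mathrm{div}(\varepsilon\mathbf E(t))\big)=\mathbb E\big(\mathrm{div}(\varepsilon\mathbf E_0)\big)-\mathbb E\Big(\int_0^t\mathrm{div}\,\mathbf J_e\,ds\Big),$$ $$\mathbb E\big(\mathrm{div}(\mu\mathbf H(t))\big)=\mathbb E\big(\mathrm{div}(\mu\mathbf H_0)\big)-\mathbb E\Big(\int_0^t\mathrm{div}\,\mathbf J_m\,ds\Big),$$ where $\mathbf J_e=\mathbf J_e(s,\mathbf x,\mathbf E(s,\mathbf x),\mathbf H(s,\mathbf x))$ and $\mathbf J_m=\mathbf J_m(s,\mathbf x,\mathbf E(s,\mathbf x),\mathbf H(s,\mathbf x))$.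
   Context: $D\subset\mathbb R^3$ is a bounded domain with unit outward normal $\mathbf n$ on $\partial D$; $T\in(0,\infty)$; $\varepsilon,\mu\in L^\infty(D)$ with $\varepsilon,\mu\ge\delta>0$. The functions $\mathbf J_e,\mathbf J_m:[0,T]\times D\times\mathbb R^3\times\mathbb R^3\to\mathbb R^3$ are continuous and, for $\mathbf J\in\{\mathbf J_e,\mathbf J_m\}$ and a constant $L>0$, satisfy $|\mathbf J(t,\mathbf x,u,v)|\le L(1+|u|+|v|)$ and $|\mathbf J(t,\mathbf x,u_1,v_1)-\mathbf J(s,\mathbf x,u_2,v_2)|\le L(|t-s|+|u_1-u_2|+|v_1-v_2|)$. The functions $\mathbf J_e^r,\mathbf J_m^r:[0,T]\times D\to\mathbb R^3$ are continuous and bounded. $U=L^2(D)$; $Q$ is a symmetric positive definite operator on $U$ with finite trace; $W$ is a $Q$-Wiener process on a filtered probability space $(\Omega,\mathcal F,\{\mathcal F_t\}_{0\le t\le T},\mathbb P)$; $U_0:=Q^{1/2}U$. $HS(U_0,H)$ denotes the Hilbert-Schmidt operators from $U_0$ to $H$. $\mathbb H=L^2(D)^3\times L^2(D)^3$ has inner product $\langle(\mathbf E_1,\mathbf H_1),(\mathbf E_2,\mathbf H_2)\rangle_{\mathbb H}=\int_D(\varepsilon\mathbf E_1\cdot\mathbf E_2+\mu\mathbf H_1\cdot\mathbf H_2)\,d\mathbf x$. The Maxwell operator is $M(\mathbf E,\mathbf H)=(\varepsilon^{-1}\nabla\times\mathbf H,\,-\mu^{-1}\nabla\times\mathbf E)$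 with domain $\mathcal D(M)=H_0(\mathrm{curl},D)\times H(\mathrm{curl},D)$, where $H(\mathrm{curl},D)=\{v\in L^2(D)^3:\nabla\times v\in L^2(D)^3\}$ and $H_0(\mathrm{curl},D)=\{v\in H(\mathrm{curl},D):\mathbf n\times v|_{\partial D}=0\}$, with graph norm $\|u\|_{\mathcal D(M)}=(\|u\|_{\mathbb H}^2+\|Mu\|_{\mathbb H}^2)^{1/2}$. $M$ is skew-adjoint on $\mathbb H$ and generates a unitary group $S(t)=e^{tM}$. For $u=(\mathbf E,\mathbf H)\in\mathbb H$, $F(t,u)(\mathbf x)=(-\varepsilon^{-1}\mathbf J_e(t,\mathbf x,\mathbf E(\mathbf x),\mathbf H(\mathbf x)),\,-\mu^{-1}\mathbf J_m(t,\mathbf x,\mathbf E(\mathbf x),\mathbf H(\mathbf x)))$; for $v\in U_0$, $(B(t)v)(\mathbf x)=(-\varepsilon^{-1}\mathbf J_e^r(t,\mathbf x)v(\mathbf x),\,-\mu^{-1}\mathbf J_m^r(t,\mathbf x)v(\mathbf x))$. The equation for $u$ is the abstract form of the stochastic Maxwell system $\varepsilon\,d\mathbf E-\nabla\times\mathbf H\,dt=-\mathbf J_e\,dt-\mathbf J_e^r\circ dW$, $\mu\,d\mathbf H+\nabla\times\mathbf E\,dt=-\mathbf J_m\,dt-\mathbf J_m^r\circ dW$ on $(0,T]\times D$ with $\mathbf n\times\mathbf E=\mathbf 0$ on $\partial D$ and initial data $\mathbf E_0,\mathbf H_0$. The mild solution is the unique process with $u(t)=S(t)u_0+\int_0^tS(t-s)F(s,u(s))ds+\int_0^tS(t-s)B(s)dW(s)$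 $\mathbb P$-a.s. for each $t\in[0,T]$. $\mathrm{div}$ denotes the divergence with respect to $\mathbf x$. *)

theory Defs
  imports "HOL-Probability.Probability"
begin

section \<open>The Hilbert space of square integrable functions\<close>

text \<open>The elements of \<open>('a, 'b) L2\<close> are the Lebesgue-a.e. classes of square integrable
  functions on the whole space \<open>'a\<close>.  The space \<open>L\<^sup>2(D)\<close> is the closed subspace
  \<open>L2_on D\<close> of classes vanishing a.e. outside \<open>D\<close>.\<close>

definition square_integrable :: "('a::euclidean_space \<Rightarrow> 'b::euclidean_space) \<Rightarrow> bool"
  where "square_integrable f \<longleftrightarrow>
    f \<in> borel_measurable lebesgue \<and> integrable lebesgue (\<lambda>x. (norm (f x))\<^sup>2)"

lemma square_integrable_zero [simp]: "square_integrable (\<lambda>_. 0)"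
  by (simp add: square_integrable_def)

lemma square_integrable_scaleR: "square_integrable f \<Longrightarrow> square_integrable (\<lambda>x. c *\<^sub>R f x)"
  unfolding square_integrable_def by (auto simp: power_mult_distrib intro!: borel_measurable_scaleR)

lemma square_integrable_add:
  assumes f: "square_integrable f" and g: "square_integrable g"
  shows "square_integrable (\<lambda>x. f x + g x)"
  unfolding square_integrable_def
proof
  show m: "(\<lambda>x. f x + g x) \<in> borel_measurable lebesgue"
    using f g unfolding square_integrable_def by (intro borel_measurable_add) auto
  have "integrable lebesgue (\<lambda>x. 2 * (norm (f x))\<^sup>2 + 2 * (norm (g x))\<^sup>2)"
    using f g by (simp add: square_integrable_def)
  then show "integrable lebesgue (\<lambda>x. (norm (f x + g x))\<^sup>2)"
  proof (rule Bochner_Integration.integrable_bound)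
    show "(\<lambda>x. (norm (f x + g x))\<^sup>2) \<in> borel_measurable lebesgue"
      using m by measurable
    show "AE x in lebesgue. norm ((norm (f x + g x))\<^sup>2) \<le> norm (2 * (norm (f x))\<^sup>2 + 2 * (norm (g x))\<^sup>2)"
    proof (rule AE_I2)
      fix x
      have "(norm (f x + g x))\<^sup>2 \<le> (norm (f x) + norm (g x))\<^sup>2"
        by (intro power_mono norm_triangle_ineq) auto
      also have "\<dots> \<le> 2 * (norm (f x))\<^sup>2 + 2 * (norm (g x))\<^sup>2"
        using sum_squares_ge_zero[of "norm (f x) - norm (g x)" 0] 
        by (simp add: power2_eq_square algebra_simps)
      finally show "norm ((norm (f x + g x))\<^sup>2) \<le> norm (2 * (norm (f x))\<^sup>2 + 2 * (norm (g x))\<^sup>2)"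
        by simp
    qed
  qed
qed

lemma square_integrable_uminus: "square_integrable f \<Longrightarrow> square_integrable (\<lambda>x. - f x)"
  by (simp add: square_integrable_def)

lemma square_integrable_diff:
  "square_integrable f \<Longrightarrow> square_integrable g \<Longrightarrow> square_integrable (\<lambda>x. f x - g x)"
  using square_integrable_add[of f "\<lambda>x. - g x"] square_integrable_uminus[of g] by simp

lemma square_integrable_inner:
  assumes f: "square_integrable f" and g: "square_integrable g"
  shows "integrable lebesgue (\<lambda>x. f x \<bullet> g x)"
proof (rule Bochner_Integration.integrable_bound)
  show "integrable lebesgue (\<lambda>x. (norm (f x))\<^sup>2 + (norm (g x))\<^sup>2)"
    using f g by (simp add: square_integrable_def)
  show "(\<lambda>x. f x \<bullet> g x) \<in> borel_measurable lebesgue"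
    using f g by (auto simp: square_integrable_def)
  show "AE x in lebesgue. norm (f x \<bullet> g x) \<le> norm ((norm (f x))\<^sup>2 + (norm (g x))\<^sup>2)"
  proof (rule AE_I2)
    fix x
    have "\<bar>f x \<bullet> g x\<bar> \<le> norm (f x) * norm (g x)" by (rule Cauchy_Schwarz_ineq2)
    also have "\<dots> \<le> (norm (f x))\<^sup>2 + (norm (g x))\<^sup>2"
      using zero_le_power2[of "norm (f x) - norm (g x)"]
        mult_nonneg_nonneg[OF norm_ge_zero[of "f x"] norm_ge_zero[of "g x"]]
      unfolding power2_diff by linarith
    finally show "norm (f x \<bullet> g x) \<le> norm ((norm (f x))\<^sup>2 + (norm (g x))\<^sup>2)" by simp
  qed
qed

text \<open>\<open>fn_L2 u\<close> is some representative of the class \<open>u\<close>.  \<open>to_L2 f\<close> is the class of \<open>f\<close>; it is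
  meaningful only for square integrable \<open>f\<close>.\<close>

quotient_type (overloaded) ('a, 'b) L2 = "'a::euclidean_space \<Rightarrow> 'b::euclidean_space" / partial:
  "\<lambda>f g. square_integrable f \<and> square_integrable g \<and> (AE x in lebesgue. f x = g x)"
  morphisms fn_L2 to_L2
proof (rule part_equivpI)
  show "\<exists>f::'a \<Rightarrow> 'b. square_integrable f \<and> square_integrable f \<and> (AE x in lebesgue. f x = f x)"
    by (rule exI[of _ "\<lambda>_. 0"]) simp
  show "symp (\<lambda>f g :: 'a \<Rightarrow> 'b. square_integrable f \<and> square_integrable g \<and> (AE x in lebesgue. f x = g x))"
    by (auto simp: symp_def)
  show "transp (\<lambda>f g :: 'a \<Rightarrow> 'b. square_integrable f \<and> square_integrable g \<and> (AE x in lebesgue. f x = g x))"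
    by (auto simp: transp_def elim!: eventually_elim2)
qed


lemma square_integrable_fn_L2 [simp, intro]: "square_integrable (fn_L2 u)"
  using Quotient_rep_reflp[OF Quotient_L2, of u] by simp

lemma to_L2_fn_L2 [simp]: "to_L2 (fn_L2 u) = u"
  using Quotient_abs_rep[OF Quotient_L2] .

lemma fn_L2_to_L2: "square_integrable f \<Longrightarrow> AE x in lebesgue. fn_L2 (to_L2 f) x = f x"
  using Quotient_rep_abs[OF Quotient_L2, of f] by simp

lemma to_L2_eq_iff:
  "square_integrable f \<Longrightarrow> square_integrable g \<Longrightarrow> to_L2 f = to_L2 g \<longleftrightarrow> (AE x in lebesgue. f x = g x)"
  using Quotient_rel[OF Quotient_L2, of f g] by auto

lemma L2_eq_iff: "u = v \<longleftrightarrow> (AE x in lebesgue. fn_L2 u x = fn_L2 v x)"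
  using to_L2_eq_iff[of "fn_L2 u" "fn_L2 v"] by simp

lemma to_L2_cases: obtains f where "square_integrable f" "u = to_L2 f"
  by (metis square_integrable_fn_L2 to_L2_fn_L2)

instantiation L2 :: (euclidean_space, euclidean_space) real_vector
begin

definition zero_L2 :: "('a, 'b) L2" where "zero_L2 = to_L2 (\<lambda>_. 0)"
definition plus_L2 :: "('a, 'b) L2 \<Rightarrow> ('a, 'b) L2 \<Rightarrow> ('a, 'b) L2"
  where "plus_L2 u v = to_L2 (\<lambda>x. fn_L2 u x + fn_L2 v x)"
definition scaleR_L2 :: "real \<Rightarrow> ('a, 'b) L2 \<Rightarrow> ('a, 'b) L2"
  where "scaleR_L2 c u = to_L2 (\<lambda>x. c *\<^sub>R fn_L2 u x)"
definition uminus_L2 :: "('a, 'b) L2 \<Rightarrow> ('a, 'b) L2"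
  where "uminus_L2 u = to_L2 (\<lambda>x. - fn_L2 u x)"
definition minus_L2 :: "('a, 'b) L2 \<Rightarrow> ('a, 'b) L2 \<Rightarrow> ('a, 'b) L2"
  where "minus_L2 u v = to_L2 (\<lambda>x. fn_L2 u x - fn_L2 v x)"
lemma fn_L2_zero: "AE x in lebesgue. fn_L2 (0 :: ('a, 'b) L2) x = 0"
  unfolding zero_L2_def by (rule fn_L2_to_L2) simp

lemma fn_L2_add: "AE x in lebesgue. fn_L2 (u + v :: ('a, 'b) L2) x = fn_L2 u x + fn_L2 v x"
  unfolding plus_L2_def by (intro fn_L2_to_L2 square_integrable_add) auto

lemma fn_L2_scaleR: "AE x in lebesgue. fn_L2 (c *\<^sub>R u :: ('a, 'b) L2) x = c *\<^sub>R fn_L2 u x"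
  unfolding scaleR_L2_def by (intro fn_L2_to_L2 square_integrable_scaleR) auto

lemma fn_L2_uminus: "AE x in lebesgue. fn_L2 (- u :: ('a, 'b) L2) x = - fn_L2 u x"
  unfolding uminus_L2_def by (intro fn_L2_to_L2 square_integrable_uminus) auto

lemma fn_L2_diff: "AE x in lebesgue. fn_L2 (u - v :: ('a, 'b) L2) x = fn_L2 u x - fn_L2 v x"
  unfolding minus_L2_def by (intro fn_L2_to_L2 square_integrable_diff) auto

instance
proof
  fix u v w :: "('a, 'b) L2" and r s :: real
  show "u + v + w = u + (v + w)"
    unfolding L2_eq_iff
    using fn_L2_add[of u v] fn_L2_add[of "u + v" w] fn_L2_add[of v w] fn_L2_add[of u "v + w"]
    by eventually_elim simp
  show "u + v = v + u"
    unfolding L2_eq_iff using fn_L2_add[of u v] fn_L2_add[of v u] by eventually_elim simp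
  show "0 + u = u"
    unfolding L2_eq_iff using fn_L2_add[of 0 u] fn_L2_zero by eventually_elim simp
  show "- u + u = 0"
    unfolding L2_eq_iff using fn_L2_add[of "- u" u] fn_L2_uminus[of u] fn_L2_zero by eventually_elim simp
  show "u - v = u + - v"
    unfolding L2_eq_iff using fn_L2_add[of u "- v"] fn_L2_uminus[of v] fn_L2_diff[of u v]
    by eventually_elim simp
  show "r *\<^sub>R (u + v) = r *\<^sub>R u + r *\<^sub>R v"
    unfolding L2_eq_iff
    using fn_L2_add[of u v] fn_L2_scaleR[of r "u + v"] fn_L2_scaleR[of r u] fn_L2_scaleR[of r v]
      fn_L2_add[of "r *\<^sub>R u" "r *\<^sub>R v"]
    by eventually_elim (simp add: scaleR_add_right)
  show "(r + s) *\<^sub>R u = r *\<^sub>R u + s *\<^sub>R u"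
    unfolding L2_eq_iff
    using fn_L2_scaleR[of "r + s" u] fn_L2_scaleR[of r u] fn_L2_scaleR[of s u]
      fn_L2_add[of "r *\<^sub>R u" "s *\<^sub>R u"]
    by eventually_elim (simp add: scaleR_add_left)
  show "r *\<^sub>R s *\<^sub>R u = (r * s) *\<^sub>R u"
    unfolding L2_eq_iff
    using fn_L2_scaleR[of s u] fn_L2_scaleR[of r "s *\<^sub>R u"] fn_L2_scaleR[of "r * s" u]
    by eventually_elim simp
  show "1 *\<^sub>R u = u"
    unfolding L2_eq_iff using fn_L2_scaleR[of 1 u] by eventually_elim simp
qed

end

lemma fn_L2_inner_integrable:
  "integrable lebesgue (\<lambda>x. fn_L2 (u :: ('a::euclidean_space, 'b::euclidean_space) L2) x \<bullet> fn_L2 v x)"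
  by (intro square_integrable_inner) auto

lemma fn_L2_measurable [measurable]: "fn_L2 (u :: ('a::euclidean_space, 'b::euclidean_space) L2) \<in> borel_measurable lebesgue"
  using square_integrable_fn_L2[of u] unfolding square_integrable_def by blast

instantiation L2 :: (euclidean_space, euclidean_space) real_inner
begin

definition inner_L2 :: "('a, 'b) L2 \<Rightarrow> ('a, 'b) L2 \<Rightarrow> real"
  where "inner_L2 u v = (LINT x|lebesgue. fn_L2 u x \<bullet> fn_L2 v x)"
definition norm_L2 :: "('a, 'b) L2 \<Rightarrow> real" where "norm_L2 u = sqrt (u \<bullet> u)"
definition dist_L2 :: "('a, 'b) L2 \<Rightarrow> ('a, 'b) L2 \<Rightarrow> real" where "dist_L2 u v = norm (u - v)"
definition sgn_L2 :: "('a, 'b) L2 \<Rightarrow> ('a, 'b) L2" where "sgn_L2 u = inverse (norm u) *\<^sub>R u"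
definition uniformity_L2 :: "(('a, 'b) L2 \<times> ('a, 'b) L2) filter"
  where "uniformity_L2 = (INF e\<in>{0<..}. principal {(u, v). dist u v < e})"
definition open_L2 :: "('a, 'b) L2 set \<Rightarrow> bool"
  where "open_L2 U \<longleftrightarrow> (\<forall>u\<in>U. \<forall>\<^sub>F (u', v) in uniformity. u' = u \<longrightarrow> v \<in> U)"

instance
proof
  fix u v w :: "('a, 'b) L2" and r s :: real
  show "dist u v = norm (u - v)" by (rule dist_L2_def)
  show "sgn u = u /\<^sub>R norm u" by (rule sgn_L2_def)
  show "(uniformity :: (('a, 'b) L2 \<times> ('a, 'b) L2) filter) = (INF e\<in>{0<..}. principal {(x, y). dist x y < e})"
    by (rule uniformity_L2_def)
  show "open U \<longleftrightarrow> (\<forall>x\<in>U. \<forall>\<^sub>F (x', y) in uniformity. x' = x \<longrightarrow> y \<in> U)" for U :: "('a, 'b) L2 set"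
    by (rule open_L2_def)
  show "u \<bullet> v = v \<bullet> u"
    by (simp add: inner_L2_def inner_commute)
  have "(u + v) \<bullet> w = (LINT x|lebesgue. fn_L2 u x \<bullet> fn_L2 w x + fn_L2 v x \<bullet> fn_L2 w x)"
    unfolding inner_L2_def
    by (intro integral_cong_AE, measurable)
       (use fn_L2_add[of u v] in eventually_elim, simp add: inner_add_left)
  then show "(u + v) \<bullet> w = u \<bullet> w + v \<bullet> w"
    by (simp add: inner_L2_def fn_L2_inner_integrable)
  have "(r *\<^sub>R u) \<bullet> v = (LINT x|lebesgue. r * (fn_L2 u x \<bullet> fn_L2 v x))"
    unfolding inner_L2_def
    by (intro integral_cong_AE, measurable)
       (use fn_L2_scaleR[of r u] in eventually_elim, simp)
  then show "(r *\<^sub>R u) \<bullet> v = r * (u \<bullet> v)"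
    by (simp add: inner_L2_def)
  show "0 \<le> u \<bullet> u" by (simp add: inner_L2_def)
  have "u \<bullet> u = 0 \<longleftrightarrow> (AE x in lebesgue. fn_L2 u x \<bullet> fn_L2 u x = 0)"
    unfolding inner_L2_def by (intro integral_nonneg_eq_0_iff_AE fn_L2_inner_integrable) simp
  also have "\<dots> \<longleftrightarrow> u = 0"
    unfolding L2_eq_iff
  proof
    assume "AE x in lebesgue. fn_L2 u x \<bullet> fn_L2 u x = 0"
    then show "AE x in lebesgue. fn_L2 u x = fn_L2 0 x"
      using fn_L2_zero by eventually_elim simp
  next
    assume "AE x in lebesgue. fn_L2 u x = fn_L2 0 x"
    then show "AE x in lebesgue. fn_L2 u x \<bullet> fn_L2 u x = 0"
      using fn_L2_zero by eventually_elim simp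
  qed
  finally show "u \<bullet> u = 0 \<longleftrightarrow> u = 0" .
  show "norm u = sqrt (u \<bullet> u)" by (rule norm_L2_def)
qed

end

lemma norm_L2_square: "(norm u)\<^sup>2 = (LINT x|lebesgue. (norm (fn_L2 u x))\<^sup>2)"
  by (simp add: power2_norm_eq_inner inner_L2_def)

lemma norm_L2_square_nn:
  "ennreal ((norm u)\<^sup>2) = (\<integral>\<^sup>+x. ennreal ((norm (fn_L2 u x))\<^sup>2) \<partial>lebesgue)"
  unfolding norm_L2_square
  by (subst nn_integral_eq_integral) 
     (use square_integrable_fn_L2[of u] in \<open>auto simp: square_integrable_def\<close>)

lemma norm_to_L2_diff_nn:
  assumes "square_integrable f"
  shows "ennreal ((norm (u - to_L2 f))\<^sup>2) = (\<integral>\<^sup>+x. ennreal ((norm (fn_L2 u x - f x))\<^sup>2) \<partial>lebesgue)"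
  unfolding norm_L2_square_nn
  by (intro nn_integral_cong_AE)
     (use fn_L2_diff[of u "to_L2 f"] fn_L2_to_L2[OF assms] in eventually_elim, simp)

instance L2 :: (euclidean_space, euclidean_space) complete_space
proof
  fix X :: "nat \<Rightarrow> ('a, 'b) L2"
  assume X: "Cauchy X"
  have "\<exists>N. \<forall>m\<ge>N. \<forall>n\<ge>N. dist (X m) (X n) < (1/4)^k" for k
    using X by (simp add: Cauchy_def)
  then obtain N where N: "\<And>k m n. m \<ge> N k \<Longrightarrow> n \<ge> N k \<Longrightarrow> dist (X m) (X n) < (1/4)^k"
    by metis
  define r where "r k = (\<Sum>i\<le>k. N i)" for k
  have r_ge: "N k \<le> r k" "r k \<le> r (Suc k)" for k
    by (auto simp: r_def intro: member_le_sum)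
  have step: "norm (X (r (Suc k)) - X (r k)) < (1/4)^k" for k
    using N[of k "r (Suc k)" "r k"] r_ge[of k] by (simp add: dist_norm)
  define g where "g k x = fn_L2 (X (r k)) x" for k x
  have [measurable]: "g k \<in> borel_measurable lebesgue" for k
    unfolding g_def by measurable
  have int_step: "(\<integral>\<^sup>+x. ennreal (4^k * (norm (g (Suc k) x - g k x))\<^sup>2) \<partial>lebesgue) \<le> ennreal ((1/4)^k)" for k
  proof -
    have "(\<integral>\<^sup>+x. ennreal (4^k * (norm (g (Suc k) x - g k x))\<^sup>2) \<partial>lebesgue)
        = ennreal (4^k) * (\<integral>\<^sup>+x. ennreal ((norm (g (Suc k) x - g k x))\<^sup>2) \<partial>lebesgue)"
      by (subst nn_integral_cmult[symmetric]) (auto simp: ennreal_mult)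
    also have "(\<integral>\<^sup>+x. ennreal ((norm (g (Suc k) x - g k x))\<^sup>2) \<partial>lebesgue)
        = ennreal ((norm (X (r (Suc k)) - X (r k)))\<^sup>2)"
      using norm_to_L2_diff_nn[of "fn_L2 (X (r k))" "X (r (Suc k))"] by (simp add: g_def)
    also have "ennreal (4^k) * \<dots> \<le> ennreal (4^k) * ennreal (((1/4)^k)\<^sup>2)"
      by (intro mult_left_mono ennreal_leI power_mono less_imp_le[OF step]) auto
    also have "\<dots> = ennreal ((1/4)^k)"
      by (subst ennreal_mult[symmetric]) (auto simp: power2_eq_square power_mult_distrib[symmetric] field_simps simp flip: power_mult_distrib)
    finally show ?thesis .
  qed
  have "(\<integral>\<^sup>+x. (\<Sum>k. ennreal (4^k * (norm (g (Suc k) x - g k x))\<^sup>2)) \<partial>lebesgue)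
      = (\<Sum>k. \<integral>\<^sup>+x. ennreal (4^k * (norm (g (Suc k) x - g k x))\<^sup>2) \<partial>lebesgue)"
    by (intro nn_integral_suminf) measurable
  also have "\<dots> \<le> (\<Sum>k. ennreal ((1/4)^k))"
    by (intro suminf_le int_step) auto
  also have "\<dots> < \<infinity>"
    by (subst suminf_ennreal2) (auto intro: summable_geometric)
  finally have "AE x in lebesgue. (\<Sum>k. ennreal (4^k * (norm (g (Suc k) x - g k x))\<^sup>2)) \<noteq> \<infinity>"
    by (intro nn_integral_PInf_AE) (auto simp: top_unique less_top)
  then have conv: "AE x in lebesgue. convergent (\<lambda>k. g k x)"
  proof eventually_elim
    case (elim x)
    let ?a = "\<lambda>k. norm (g (Suc k) x - g k x)"
    have "summable (\<lambda>k. 4^k * (?a k)\<^sup>2)"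
      by (rule summable_suminf_not_top) (use elim in auto)
    then have "(\<lambda>k. 4^k * (?a k)\<^sup>2) \<longlonglongrightarrow> 0" by (rule summable_LIMSEQ_zero)
    then have "\<forall>\<^sub>F k in sequentially. 4^k * (?a k)\<^sup>2 < 1"
      by (rule order_tendstoD(2)) simp
    then have "\<forall>\<^sub>F k in sequentially. norm (?a k) \<le> (1/2)^k"
    proof eventually_elim
      case (elim k)
      have "(2^k)\<^sup>2 = (4::real)^k"
        by (simp add: power2_eq_square flip: power_mult_distrib)
      then have "(2^k * ?a k)\<^sup>2 \<le> 1\<^sup>2"
        using elim by (simp add: power_mult_distrib)
      then have "2^k * ?a k \<le> 1" by (rule power2_le_imp_le) simp
      then show ?case by (simp add: field_simps)
    qed
    then have "summable ?a"
      by (rule summable_comparison_test_ev) (auto intro: summable_geometric)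
    then have "summable (\<lambda>k. g (Suc k) x - g k x)"
      by (rule summable_norm_cancel)
    then have "(\<lambda>n. \<Sum>k<n. g (Suc k) x - g k x) \<longlonglongrightarrow> (\<Sum>k. g (Suc k) x - g k x)"
      by (rule summable_LIMSEQ)
    then have "(\<lambda>n. g n x - g 0 x) \<longlonglongrightarrow> (\<Sum>k. g (Suc k) x - g k x)"
      by (simp add: sum_lessThan_telescope[of "\<lambda>k. g k x"])
    then have "(\<lambda>n. (g n x - g 0 x) + g 0 x) \<longlonglongrightarrow> (\<Sum>k. g (Suc k) x - g k x) + g 0 x"
      by (intro tendsto_intros)
    then show ?case by (auto simp: convergent_def)
  qed
  define f where "f x = lim (\<lambda>k. g k x)" for x
  have [measurable]: "f \<in> borel_measurable lebesgue"
    unfolding f_def by measurable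
  have lim: "AE x in lebesgue. (\<lambda>k. g k x) \<longlonglongrightarrow> f x"
    using conv by eventually_elim (simp add: f_def convergent_LIMSEQ_iff)
  have fatou: "(\<integral>\<^sup>+x. ennreal ((norm (fn_L2 (X n) x - f x))\<^sup>2) \<partial>lebesgue) \<le> ennreal (((1/4)^k)\<^sup>2)"
    if n: "n \<ge> N k" for n k
  proof -
    have "(\<integral>\<^sup>+x. ennreal ((norm (fn_L2 (X n) x - f x))\<^sup>2) \<partial>lebesgue)
        = (\<integral>\<^sup>+x. liminf (\<lambda>j. ennreal ((norm (fn_L2 (X n) x - g j x))\<^sup>2)) \<partial>lebesgue)"
    proof (intro nn_integral_cong_AE, use lim in eventually_elim)
      case (elim x)
      have "(\<lambda>j. ennreal ((norm (fn_L2 (X n) x - g j x))\<^sup>2)) \<longlonglongrightarrow> ennreal ((norm (fn_L2 (X n) x - f x))\<^sup>2)"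
        by (intro tendsto_intros tendsto_ennrealI elim)
      then show ?case by (intro lim_imp_Liminf[symmetric]) auto
    qed
    also have "\<dots> \<le> liminf (\<lambda>j. \<integral>\<^sup>+x. ennreal ((norm (fn_L2 (X n) x - g j x))\<^sup>2) \<partial>lebesgue)"
      by (intro nn_integral_liminf) measurable
    also have "\<dots> \<le> liminf (\<lambda>j. ennreal (((1/4)^k)\<^sup>2))"
    proof (rule Liminf_mono)
      have "(\<integral>\<^sup>+x. ennreal ((norm (fn_L2 (X n) x - g j x))\<^sup>2) \<partial>lebesgue) \<le> ennreal (((1/4)^k)\<^sup>2)"
        if j: "j \<ge> k" for j
      proof -
        have "r k \<le> r j" by (rule lift_Suc_mono_le[of r]) (use r_ge j in auto)
        then have "norm (X n - X (r j)) \<le> (1/4)^k"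
          using N[of k n "r j"] n r_ge(1)[of k] by (simp add: dist_norm)
        then have le: "ennreal ((norm (X n - X (r j)))\<^sup>2) \<le> ennreal (((1/4)^k)\<^sup>2)"
          by (intro ennreal_leI power_mono) auto
        have "ennreal ((norm (X n - X (r j)))\<^sup>2) = (\<integral>\<^sup>+x. ennreal ((norm (fn_L2 (X n) x - g j x))\<^sup>2) \<partial>lebesgue)"
          using norm_to_L2_diff_nn[of "fn_L2 (X (r j))" "X n"] by (simp add: g_def)
        with le show ?thesis by simp
      qed
      then show "\<forall>\<^sub>F j in sequentially. (\<integral>\<^sup>+x. ennreal ((norm (fn_L2 (X n) x - g j x))\<^sup>2) \<partial>lebesgue) \<le> ennreal (((1/4)^k)\<^sup>2)"
        unfolding eventually_sequentially by blast
    qed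
    also have "\<dots> = ennreal (((1/4)^k)\<^sup>2)" by (simp add: Liminf_const)
    finally show ?thesis .
  qed
  have sq: "square_integrable f"
  proof -
    let ?h = "\<lambda>x. fn_L2 (X (N 0)) x - f x"
    have "square_integrable ?h"
      unfolding square_integrable_def
    proof
      show "integrable lebesgue (\<lambda>x. (norm (?h x))\<^sup>2)"
        by (rule integrableI_nonneg)
           (use fatou[of 0 "N 0"] in \<open>auto intro: le_less_trans\<close>)
    qed measurable
    then have "square_integrable (\<lambda>x. fn_L2 (X (N 0)) x - ?h x)"
      by (rule square_integrable_diff[OF square_integrable_fn_L2])
    moreover have "(\<lambda>x. fn_L2 (X (N 0)) x - ?h x) = f" by (simp add: fun_eq_iff)
    ultimately show ?thesis by (simp only:)
  qed
  have "X \<longlonglongrightarrow> to_L2 f"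
  proof (rule metric_LIMSEQ_I)
    fix e :: real assume "e > 0"
    then obtain k where k: "(1/4)^k < e" using real_arch_pow_inv[of e "1/4"] by auto
    have "dist (X n) (to_L2 f) < e" if "n \<ge> N k" for n
    proof -
      have "ennreal ((norm (X n - to_L2 f))\<^sup>2) \<le> ennreal (((1/4)^k)\<^sup>2)"
        unfolding norm_to_L2_diff_nn[OF sq] by (rule fatou[OF that])
      then have "(norm (X n - to_L2 f))\<^sup>2 \<le> ((1/4)^k)\<^sup>2" by simp
      then have "norm (X n - to_L2 f) \<le> (1/4)^k" by (rule power2_le_imp_le) simp
      then show ?thesis using k by (simp add: dist_norm)
    qed
    then show "\<exists>no. \<forall>n\<ge>no. dist (X n) (to_L2 f) < e" by blast
  qed
  then show "convergent X" by (auto simp: convergent_def)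
qed

instance L2 :: (euclidean_space, euclidean_space) banach ..

lemma square_integrable_indicator:
  "A \<in> lmeasurable \<Longrightarrow> square_integrable (\<lambda>x. indicator A x *\<^sub>R v)"
proof -
  assume A: "A \<in> lmeasurable"
  then have m: "A \<in> sets lebesgue" by (rule fmeasurableD)
  have "(\<lambda>x. (norm (indicator A x *\<^sub>R v))\<^sup>2) = (\<lambda>x. indicator A x * (norm v)\<^sup>2)"
    by (auto simp: fun_eq_iff indicator_def)
  moreover have "integrable lebesgue (\<lambda>x. indicator A x * (norm v)\<^sup>2)"
    using A m by (auto simp: fmeasurable_def)
  ultimately show ?thesis
    unfolding square_integrable_def using m by (auto intro!: borel_measurable_scaleR)
qed

definition ind_L2 :: "'a::euclidean_space set \<Rightarrow> 'b::euclidean_space \<Rightarrow> ('a, 'b) L2"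
  where "ind_L2 A v = to_L2 (\<lambda>x. indicator A x *\<^sub>R v)"

lemma fn_ind_L2: "A \<in> lmeasurable \<Longrightarrow> AE x in lebesgue. fn_L2 (ind_L2 A v) x = indicator A x *\<^sub>R v"
  unfolding ind_L2_def by (intro fn_L2_to_L2 square_integrable_indicator)

lemma norm_ind_L2_diff:
  assumes A: "A \<in> lmeasurable" and B: "B \<in> lmeasurable" and "B \<subseteq> A"
  shows "(norm (ind_L2 A v - ind_L2 B v))\<^sup>2 = (norm v)\<^sup>2 * measure lebesgue (A - B)"
proof -
  have [measurable]: "A \<in> sets lebesgue" "B \<in> sets lebesgue" using A B by auto
  have "(norm (ind_L2 A v - ind_L2 B v))\<^sup>2 = (LINT x|lebesgue. (norm v)\<^sup>2 * indicator (A - B) x)"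
    unfolding norm_L2_square
  proof (intro integral_cong_AE, measurable)
    show "AE x in lebesgue. (norm (fn_L2 (ind_L2 A v - ind_L2 B v) x))\<^sup>2 = (norm v)\<^sup>2 * indicator (A - B) x"
      using fn_L2_diff[of "ind_L2 A v" "ind_L2 B v"] fn_ind_L2[OF A, of v] fn_ind_L2[OF B, of v]
    proof eventually_elim
      case (elim x)
      then show ?case using \<open>B \<subseteq> A\<close> by (auto simp: indicator_def)
    qed
  qed
  then show ?thesis by simp
qed

lemma second_countable_of_dense:
  fixes C :: "'a::metric_space set"
  assumes "countable C" and C: "closure C = UNIV"
  shows "\<exists>B::'a set set. countable B \<and> open = generate_topology B"
proof -
  let ?B = "(\<lambda>(c, n::nat). ball c (inverse (Suc n))) ` (C \<times> UNIV)"
  have "topological_basis ?B"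
  proof (rule topological_basisI)
    fix U and x :: 'a assume "open U" "x \<in> U"
    then obtain e where e: "e > 0" "ball x e \<subseteq> U" by (auto simp: open_contains_ball)
    then obtain n :: nat where n: "inverse (Suc n) < e / 2"
      using reals_Archimedean[of "e / 2"] by auto
    have "x \<in> closure C" using C by simp
    then obtain c where c: "c \<in> C" "dist c x < inverse (Suc n)"
      unfolding closure_approachable by (metis inverse_positive_iff_positive of_nat_0_less_iff zero_less_Suc)
    have "ball c (inverse (Suc n)) \<subseteq> ball x e"
    proof
      fix y assume "y \<in> ball c (inverse (Suc n))"
      then have "dist c y < inverse (Suc n)" by simp
      then have "dist x y < e" using c(2) n dist_triangle[of x y c] by (simp add: dist_commute)
      then show "y \<in> ball x e" by simp
    qed
    then show "\<exists>B'\<in>?B. x \<in> B' \<and> B' \<subseteq> U"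
      using c e by (intro bexI[of _ "ball c (inverse (Suc n))"]) (auto simp: dist_commute)
  qed auto
  then show ?thesis
    using topological_basis_imp_subbasis \<open>countable C\<close> by (intro exI[of _ ?B]) auto
qed

lemma countable_dense_of_span:
  fixes G :: "'a::real_normed_vector set"
  assumes "countable G"
  shows "\<exists>C. countable C \<and> closure (span G) \<subseteq> closure C"
proof -
  let ?f = "\<lambda>xs :: (rat \<times> 'a) list. \<Sum>(q, g)\<leftarrow>xs. real_of_rat q *\<^sub>R g"
  let ?C = "?f ` lists (UNIV \<times> G)"
  have "x \<in> closure ?C" if "x \<in> span G" for x
    using that
  proof (induction rule: span_induct_alt)
    case base
    have "0 \<in> ?C" by (rule image_eqI[of _ _ "[]"]) auto
    then show ?case by (rule subsetD[OF closure_subset])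
  next
    case (step c g y)
    show ?case unfolding closure_approachable
    proof (intro allI impI)
      fix e :: real assume "e > 0"
      then obtain z where z: "z \<in> ?C" "dist z y < e / 2"
        using step.IH unfolding closure_approachable by (meson half_gt_zero)
      then obtain xs where xs: "xs \<in> lists (UNIV \<times> G)" "z = ?f xs" by auto
      let ?d = "e / (2 * (norm g + 1))"
      have d: "?d > 0" using \<open>e > 0\<close> by (intro divide_pos_pos) (auto intro: add_nonneg_pos)
      obtain q where q: "c < real_of_rat q" "real_of_rat q < c + ?d"
        using of_rat_dense[of c "c + ?d"] d by auto
      have "\<bar>real_of_rat q - c\<bar> * norm g \<le> ?d * norm g"
        using q by (intro mult_right_mono) auto
      then have "norm (real_of_rat q *\<^sub>R g - c *\<^sub>R g) \<le> ?d * norm g"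
        by (simp flip: scaleR_diff_left)
      also have "\<dots> \<le> e / 2"
      proof -
        have "norm g / (norm g + 1) \<le> 1" by (simp add: divide_le_eq_1 add_nonneg_pos)
        then have "(e / 2) * (norm g / (norm g + 1)) \<le> e / 2 * 1"
          using \<open>e > 0\<close> by (intro mult_left_mono) auto
        then show ?thesis by simp
      qed
      finally have 1: "norm (real_of_rat q *\<^sub>R g - c *\<^sub>R g) \<le> e / 2" .
      have "dist (?f ((q, g) # xs)) (c *\<^sub>R g + y) = norm ((real_of_rat q *\<^sub>R g - c *\<^sub>R g) + (z - y))"
        using xs(2) by (simp add: dist_norm algebra_simps)
      also have "\<dots> \<le> norm (real_of_rat q *\<^sub>R g - c *\<^sub>R g) + norm (z - y)"
        by (rule norm_triangle_ineq)
      also have "\<dots> < e" using 1 z(2) by (simp add: dist_norm)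
      finally have "dist (?f ((q, g) # xs)) (c *\<^sub>R g + y) < e" .
      moreover have "?f ((q, g) # xs) \<in> ?C"
        using xs(1) step.hyps by (intro imageI) auto
      ultimately show "\<exists>z\<in>?C. dist z (c *\<^sub>R g + y) < e" by blast
    qed
  qed
  then have "closure (span G) \<subseteq> closure ?C" by (intro closure_minimal) auto
  moreover have "countable ?C" using assms by (intro countable_image countable_lists) auto
  ultimately show ?thesis by blast
qed

lemma subspace_closure_span:
  fixes G :: "'a::real_normed_vector set"
  shows "subspace (closure (span G))"
proof (rule subspaceI)
  show "0 \<in> closure (span G)" using closure_subset span_zero by blast
  have seq: "\<exists>f. (\<forall>n. f n \<in> span G) \<and> f \<longlonglongrightarrow> x" if "x \<in> closure (span G)" for x
    using that by (simp add: closure_sequential)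
  show "x + y \<in> closure (span G)" if x: "x \<in> closure (span G)" and y: "y \<in> closure (span G)" for x y
  proof -
    obtain f where f: "\<forall>n. f n \<in> span G" "f \<longlonglongrightarrow> x" using seq[OF x] by auto
    obtain g where g: "\<forall>n. g n \<in> span G" "g \<longlonglongrightarrow> y" using seq[OF y] by auto
    have "\<forall>n. f n + g n \<in> span G" using f g by (auto intro: span_add)
    then show ?thesis unfolding closure_sequential using tendsto_add[OF f(2) g(2)] by auto
  qed
  show "c *\<^sub>R x \<in> closure (span G)" if x: "x \<in> closure (span G)" for c x
  proof -
    obtain f where f: "\<forall>n. f n \<in> span G" "f \<longlonglongrightarrow> x" using seq[OF x] by auto
    have "\<forall>n. c *\<^sub>R f n \<in> span G" using f by (auto intro: span_scale)
    then show ?thesis unfolding closure_sequential using tendsto_scaleR[OF tendsto_const f(2), of c] by auto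
  qed
qed

lemma ind_L2_closure:
  fixes K :: "('a::euclidean_space, 'b::euclidean_space) L2 set"
  assumes B: "countable B" "topological_basis B" and K: "closed K"
    and sub: "\<And>F. finite F \<Longrightarrow> F \<subseteq> B \<Longrightarrow> \<Union>F \<in> lmeasurable \<Longrightarrow> ind_L2 (\<Union>F) v \<in> K"
    and A: "A \<in> lmeasurable"
  shows "ind_L2 A v \<in> K"
proof -
  have op: "ind_L2 U v \<in> K" if U: "open U" "U \<in> lmeasurable" for U :: "'a set"
  proof (cases "U = {}")
    case True
    then show ?thesis using sub[of "{}"] by simp
  next
    case False
    obtain B' where B': "B' \<subseteq> B" "U = \<Union>B'"
      using B(2) U(1) by (auto simp: topological_basis_def)
    have "B' \<noteq> {}" "countable B'" using False B' B(1) countable_subset by auto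
    define V where "V n = (\<Union>i\<le>n. from_nat_into B' i)" for n
    have in_B': "from_nat_into B' i \<in> B'" for i using \<open>B' \<noteq> {}\<close> by (rule from_nat_into)
    have V_sub: "V n \<subseteq> U" for n using in_B' B'(2) by (auto simp: V_def)
    have V_open: "open (V n)" for n
      using in_B' B' B(2) by (auto simp: V_def intro!: open_UN dest: topological_basis_open)
    have V_lm: "V n \<in> lmeasurable" for n
      by (rule fmeasurableI2[OF U(2) V_sub]) (use V_open in auto)
    have V_U: "(\<Union>n. V n) = U"
    proof
      show "(\<Union>n. V n) \<subseteq> U" using V_sub by auto
      show "U \<subseteq> (\<Union>n. V n)"
      proof
        fix x assume "x \<in> U"
        then obtain b where b: "b \<in> B'" "x \<in> b" using B'(2) by auto
        then obtain i where "from_nat_into B' i = b"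
          using from_nat_into_surj[OF \<open>countable B'\<close>] by blast
        then have "x \<in> V i" using b by (auto simp: V_def)
        then show "x \<in> (\<Union>n. V n)" by auto
      qed
    qed
    have "(\<lambda>n. measure lebesgue (V n)) \<longlonglongrightarrow> measure lebesgue (\<Union>n. V n)"
    proof (rule Lim_measure_incseq)
      show "range V \<subseteq> sets lebesgue" using V_lm by auto
      show "incseq V" unfolding V_def incseq_def by (auto intro: order_trans)
      show "emeasure lebesgue (\<Union>n. V n) \<noteq> \<infinity>" using U(2) V_U by (auto simp: fmeasurable_def)
    qed
    then have "(\<lambda>n. measure lebesgue U - measure lebesgue (V n)) \<longlonglongrightarrow> measure lebesgue U - measure lebesgue U"
      unfolding V_U by (intro tendsto_intros)
    then have "(\<lambda>n. (norm v)\<^sup>2 * measure lebesgue (U - V n)) \<longlonglongrightarrow> (norm v)\<^sup>2 * 0"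
      by (intro tendsto_intros) (simp add: measurable_measure_Diff[OF U(2) fmeasurableD[OF V_lm] V_sub])
    then have "(\<lambda>n. (norm (ind_L2 U v - ind_L2 (V n) v))\<^sup>2) \<longlonglongrightarrow> 0"
      by (simp add: norm_ind_L2_diff[OF U(2) V_lm V_sub])
    then have "(\<lambda>n. sqrt ((norm (ind_L2 U v - ind_L2 (V n) v))\<^sup>2)) \<longlonglongrightarrow> sqrt 0"
      by (rule tendsto_real_sqrt)
    then have "(\<lambda>n. ind_L2 (V n) v) \<longlonglongrightarrow> ind_L2 U v"
      by (subst tendsto_dist_iff) (simp add: dist_norm norm_minus_commute)
    moreover have "ind_L2 (V n) v \<in> K" for n
    proof -
      have "V n = \<Union>(from_nat_into B' ` {..n})" by (simp add: V_def)
      then show ?thesis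
        using sub[of "from_nat_into B' ` {..n}"] in_B' B'(1) V_lm[of n] by auto
    qed
    ultimately show ?thesis by (rule closed_sequentially[OF K, rotated])
  qed
  have "ind_L2 A v \<in> closure K"
    unfolding closure_approachable
  proof (intro allI impI)
    fix e :: real assume "e > 0"
    let ?d = "(e / (norm v + 1))\<^sup>2"
    have d: "?d > 0" using \<open>e > 0\<close> by (auto simp: add_nonneg_eq_0_iff)
    obtain T where T: "open T" "A \<subseteq> T" "T - A \<in> lmeasurable" "emeasure lebesgue (T - A) < ennreal ?d"
      using sets_lebesgue_outer_open[OF fmeasurableD[OF A] d] .
    have TA: "T = A \<union> (T - A)" using T(2) by auto
    have T_lm: "T \<in> lmeasurable" using fmeasurable.Un[OF A T(3)] unfolding TA[symmetric] .
    have "measure lebesgue (T - A) < ?d"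
      using T(4) unfolding emeasure_eq_measure2[OF T(3)] ennreal_less_iff[OF measure_nonneg] .
    then have "(norm v)\<^sup>2 * measure lebesgue (T - A) \<le> (norm v)\<^sup>2 * ?d"
      by (intro mult_left_mono) auto
    also have "\<dots> = (e * (norm v / (norm v + 1)))\<^sup>2" by (simp add: power_mult_distrib power_divide)
    also have "\<dots> < e\<^sup>2"
    proof (rule power_strict_mono)
      have "norm v / (norm v + 1) < 1" by (simp add: divide_less_eq_1 add_nonneg_pos)
      from mult_strict_left_mono[OF this \<open>e > 0\<close>]
      show "e * (norm v / (norm v + 1)) < e" by simp
    qed (use \<open>e > 0\<close> in auto)
    finally have "(norm (ind_L2 T v - ind_L2 A v))\<^sup>2 < e\<^sup>2"
      by (simp add: norm_ind_L2_diff[OF T_lm A T(2)])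
    then have "dist (ind_L2 T v) (ind_L2 A v) < e"
      using \<open>e > 0\<close> by (simp add: dist_norm power_less_imp_less_base)
    then show "\<exists>y\<in>K. dist y (ind_L2 A v) < e" using op[OF T(1) T_lm] by blast
  qed
  then show ?thesis using K by simp
qed

instance L2 :: (euclidean_space, euclidean_space) second_countable_topology
proof
  obtain B :: "'a set set" where B: "countable B" "topological_basis B"
    using ex_countable_basis by auto
  define G :: "('a, 'b) L2 set" where "G = (\<lambda>(F, b). ind_L2 (\<Union>F) b) ` ({F. F \<subseteq> B \<and> finite F} \<times> Basis)"
  have "countable G"
    unfolding G_def
    using countable_Collect_finite_subset[OF B(1)]
    by (intro countable_image countable_SIGMA) (auto simp: conj_commute intro: countable_finite)
  define K where "K = closure (span G)"
  have K: "closed K" "subspace K" by (auto simp: K_def subspace_closure_span)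
  have ind_b: "ind_L2 A b \<in> K" if "A \<in> lmeasurable" "b \<in> Basis" for A b
  proof (rule ind_L2_closure[OF B K(1) _ that(1)])
    fix F assume "finite F" "F \<subseteq> B"
    then have "ind_L2 (\<Union>F) b \<in> G" using that(2) by (auto simp: G_def)
    then show "ind_L2 (\<Union>F) b \<in> K" using closure_subset span_base unfolding K_def by blast
  qed
  have ind: "ind_L2 A v \<in> K" if A: "A \<in> lmeasurable" for A v
  proof -
    have "AE x in lebesgue. \<forall>b\<in>Basis. fn_L2 ((v \<bullet> b) *\<^sub>R ind_L2 A b) x = (v \<bullet> b) *\<^sub>R indicator A x *\<^sub>R b"
    proof (intro AE_finite_allI finite_Basis)
      fix b :: 'b
      show "AE x in lebesgue. fn_L2 ((v \<bullet> b) *\<^sub>R ind_L2 A b) x = (v \<bullet> b) *\<^sub>R indicator A x *\<^sub>R b"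
        using fn_L2_scaleR[of "v \<bullet> b" "ind_L2 A b"] fn_ind_L2[OF A, of b] by eventually_elim simp
    qed
    have sum: "AE x in lebesgue. fn_L2 (\<Sum>i\<in>I. f i) x = (\<Sum>i\<in>I. fn_L2 (f i) x)" if "finite I" 
      for I :: "'b set" and f :: "'b \<Rightarrow> ('a, 'b) L2"
      using that
    proof induction
      case empty
      then show ?case using fn_L2_zero by simp
    next
      case (insert i I)
      show ?case using insert.IH fn_L2_add[of "f i" "sum f I"]
        by eventually_elim (use insert.hyps in simp)
    qed
    have "ind_L2 A v = (\<Sum>b\<in>Basis. (v \<bullet> b) *\<^sub>R ind_L2 A b)"
      unfolding L2_eq_iff
      using sum[OF finite_Basis, of "\<lambda>b. (v \<bullet> b) *\<^sub>R ind_L2 A b"] fn_ind_L2[OF A, of v]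
        \<open>AE x in lebesgue. \<forall>b\<in>Basis. _ x b\<close>
    proof eventually_elim
      case (elim x)
      have "indicator A x *\<^sub>R v = indicator A x *\<^sub>R (\<Sum>b\<in>Basis. (v \<bullet> b) *\<^sub>R b)"
        by (simp add: euclidean_representation)
      then show ?case using elim by (simp add: scaleR_sum_right mult.commute)
    qed
    also have "\<dots> \<in> K"
      by (intro subspace_sum[OF K(2)] subspace_scale[OF K(2)] ind_b[OF A])
    finally show ?thesis .
  qed
  have all: "u \<in> K" for u
  proof -
    let ?f = "fn_L2 u"
    have sq: "square_integrable ?f" by simp
    obtain s where s: "\<And>i. simple_function lebesgue (s i)" "\<And>x. (\<lambda>i. s i x) \<longlonglongrightarrow> ?f x"
      "\<And>i x. norm (s i x) \<le> 2 * norm (?f x)"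
      using borel_measurable_implies_sequence_metric[OF fn_L2_measurable[of u], of 0]
      unfolding norm_conv_dist by (simp, metis)
    have [measurable]: "s i \<in> borel_measurable lebesgue" for i
      by (rule borel_measurable_simple_function[OF s(1)])
    have s_sq: "square_integrable (s i)" for i
      unfolding square_integrable_def
    proof
      show "integrable lebesgue (\<lambda>x. (norm (s i x))\<^sup>2)"
      proof (rule Bochner_Integration.integrable_bound)
        show "integrable lebesgue (\<lambda>x. 4 * (norm (?f x))\<^sup>2)" using sq by (simp add: square_integrable_def)
        show "AE x in lebesgue. norm ((norm (s i x))\<^sup>2) \<le> norm (4 * (norm (?f x))\<^sup>2)"
          using power_mono[OF s(3) norm_ge_zero, of _ _ 2] by (simp add: power_mult_distrib)
      qed measurable
    qed measurable
    have simple: "to_L2 (s i) \<in> K" for i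
    proof -
      have fin: "finite (range (s i))" using simple_functionD(1)[OF s(1)[of i]] by simp
      have lm: "s i -` {y} \<in> lmeasurable" if "y \<noteq> 0" for y
      proof (rule fmeasurableI)
        show m: "s i -` {y} \<in> sets lebesgue" using simple_functionD(2)[OF s(1)[of i]] by simp
        have "emeasure lebesgue (s i -` {y}) = (\<integral>\<^sup>+x. indicator (s i -` {y}) x \<partial>lebesgue)"
          using m by simp
        also have "\<dots> \<le> (\<integral>\<^sup>+x. ennreal ((norm (s i x))\<^sup>2 / (norm y)\<^sup>2) \<partial>lebesgue)"
          using that by (intro nn_integral_mono) (auto simp: indicator_def)
        also have "\<dots> < \<infinity>"
        proof -
          have "integrable lebesgue (\<lambda>x. (norm (s i x))\<^sup>2 / (norm y)\<^sup>2)"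
            using s_sq[of i] by (auto simp: square_integrable_def)
          from integrableD(2)[OF this] show ?thesis by (simp add: top.not_eq_extremum)
        qed
        finally show "emeasure lebesgue (s i -` {y}) < \<infinity>" .
      qed
      have sum: "AE x in lebesgue. fn_L2 (\<Sum>y\<in>Y. ind_L2 (s i -` {y}) y) x = (\<Sum>y\<in>Y. indicator (s i -` {y}) x *\<^sub>R y)" 
        if "finite Y" "0 \<notin> Y" for Y
        using that
      proof induction
        case empty
        then show ?case using fn_L2_zero by simp
      next
        case (insert y Y)
        have "y \<noteq> 0" "0 \<notin> Y" using insert by auto
        show ?case using insert.IH[OF \<open>0 \<notin> Y\<close>] fn_L2_add[of "ind_L2 (s i -` {y}) y" "\<Sum>y\<in>Y. ind_L2 (s i -` {y}) y"]
            fn_ind_L2[OF lm[OF \<open>y \<noteq> 0\<close>], of y]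
          by eventually_elim (simp only: sum.insert[OF insert.hyps(1,2)])
      qed
      have not0: "0 \<notin> range (s i) - {0}" by simp
      have "to_L2 (s i) = (\<Sum>y\<in>range (s i) - {0}. ind_L2 (s i -` {y}) y)"
        unfolding L2_eq_iff
        using sum[OF finite_Diff[OF fin, of "{0}"] not0] fn_L2_to_L2[OF s_sq[of i]]
      proof eventually_elim
        case (elim x)
        have "(\<Sum>y\<in>range (s i) - {0}. indicator (s i -` {y}) x *\<^sub>R y) = (\<Sum>y\<in>range (s i) - {0}. if y = s i x then y else 0)"
          by (intro sum.cong) (auto simp: indicator_def)
        also have "\<dots> = s i x" using fin by (auto simp: sum.delta)
        finally show ?case using elim by (simp only:)
      qed
      also have "\<dots> \<in> K"
        by (intro subspace_sum[OF K(2)] ind lm) auto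
      finally show ?thesis .
    qed
    have "(\<lambda>i. LINT x|lebesgue. (norm (?f x - s i x))\<^sup>2) \<longlonglongrightarrow> integral\<^sup>L (lebesgue :: 'a measure) (\<lambda>_. 0)"
    proof (rule integral_dominated_convergence)
      show "integrable lebesgue (\<lambda>x. 9 * (norm (?f x))\<^sup>2)" using sq by (simp add: square_integrable_def)
      show "AE x in lebesgue. (\<lambda>i. (norm (?f x - s i x))\<^sup>2) \<longlonglongrightarrow> 0"
      proof (rule AE_I2)
        fix x
        have "(\<lambda>i. (norm (?f x - s i x))\<^sup>2) \<longlonglongrightarrow> (norm (?f x - ?f x))\<^sup>2"
          by (intro tendsto_intros s(2))
        then show "(\<lambda>i. (norm (?f x - s i x))\<^sup>2) \<longlonglongrightarrow> 0" by simp
      qed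
      show "AE x in lebesgue. norm ((norm (?f x - s i x))\<^sup>2) \<le> 9 * (norm (?f x))\<^sup>2" for i
      proof (rule AE_I2)
        fix x
        have "norm (?f x - s i x) \<le> 3 * norm (?f x)"
          using norm_triangle_ineq4[of "?f x" "s i x"] s(3)[of i x] by simp
        then have "(norm (?f x - s i x))\<^sup>2 \<le> (3 * norm (?f x))\<^sup>2" by (intro power_mono) auto
        then show "norm ((norm (?f x - s i x))\<^sup>2) \<le> 9 * (norm (?f x))\<^sup>2" by (simp add: power_mult_distrib)
      qed
    qed measurable
    moreover have "(LINT x|lebesgue. (norm (?f x - s i x))\<^sup>2) = (norm (u - to_L2 (s i)))\<^sup>2" for i
      unfolding norm_L2_square
    proof (intro integral_cong_AE, measurable)
      show "AE x in lebesgue. (norm (?f x - s i x))\<^sup>2 = (norm (fn_L2 (u - to_L2 (s i)) x))\<^sup>2"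
        using fn_L2_diff[of u "to_L2 (s i)"] fn_L2_to_L2[OF s_sq[of i]] by eventually_elim simp
    qed
    ultimately have "(\<lambda>i. (norm (u - to_L2 (s i)))\<^sup>2) \<longlonglongrightarrow> 0" by simp
    then have "(\<lambda>i. sqrt ((norm (u - to_L2 (s i)))\<^sup>2)) \<longlonglongrightarrow> sqrt 0"
      by (rule tendsto_real_sqrt)
    then have "(\<lambda>i. to_L2 (s i)) \<longlonglongrightarrow> u"
      by (subst tendsto_dist_iff) (simp add: dist_norm norm_minus_commute)
    then show ?thesis by (rule closed_sequentially[OF K(1) simple])
  qed
  obtain C where "countable C" "K \<subseteq> closure C"
    using countable_dense_of_span[OF \<open>countable G\<close>] unfolding K_def by auto
  then have "closure C = UNIV" using all by auto
  then show "\<exists>B::('a, 'b) L2 set set. countable B \<and> open = generate_topology B"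
    by (rule second_countable_of_dense[OF \<open>countable C\<close>])
qed


section \<open>Test functions and classical differential operators\<close>

type_synonym r3 = "real^3"

definition partial :: "3 \<Rightarrow> (r3 \<Rightarrow> real) \<Rightarrow> r3 \<Rightarrow> real"
  where "partial i f x = frechet_derivative f (at x) (axis i 1)"

primrec C_k :: "nat \<Rightarrow> (r3 \<Rightarrow> real) \<Rightarrow> bool"
  where
    "C_k 0 f \<longleftrightarrow> continuous_on UNIV f"
  | "C_k (Suc k) f \<longleftrightarrow> (\<forall>x. f differentiable (at x)) \<and> (\<forall>i. C_k k (partial i f))"

definition smooth :: "(r3 \<Rightarrow> real) \<Rightarrow> bool"
  where "smooth f \<longleftrightarrow> (\<forall>k. C_k k f)"

definition test_fun :: "r3 set \<Rightarrow> (r3 \<Rightarrow> real) set"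
  where "test_fun D = {\<phi>. smooth \<phi> \<and> compact (closure {x. \<phi> x \<noteq> 0}) \<and> closure {x. \<phi> x \<noteq> 0} \<subseteq> D}"

definition smooth_field :: "(r3 \<Rightarrow> r3) set"
  where "smooth_field = {\<phi>. \<forall>i. smooth (\<lambda>x. \<phi> x $ i)}"

definition test_field :: "r3 set \<Rightarrow> (r3 \<Rightarrow> r3) set"
  where "test_field D = {\<phi>. \<forall>i. (\<lambda>x. \<phi> x $ i) \<in> test_fun D}"

definition grad :: "(r3 \<Rightarrow> real) \<Rightarrow> r3 \<Rightarrow> r3"
  where "grad f x = (\<chi> i. partial i f x)"

definition curl :: "(r3 \<Rightarrow> r3) \<Rightarrow> r3 \<Rightarrow> r3"
  where "curl \<phi> x = vector
    [partial 2 (\<lambda>y. \<phi> y $ 3) x - partial 3 (\<lambda>y. \<phi> y $ 2) x,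
     partial 3 (\<lambda>y. \<phi> y $ 1) x - partial 1 (\<lambda>y. \<phi> y $ 3) x,
     partial 1 (\<lambda>y. \<phi> y $ 2) x - partial 2 (\<lambda>y. \<phi> y $ 1) x]"


section \<open>The Maxwell operator\<close>

definition L2_on :: "r3 set \<Rightarrow> (r3, 'b::euclidean_space) L2 set"
  where "L2_on D = {u. AE x in lebesgue. x \<notin> D \<longrightarrow> fn_L2 u x = 0}"

definition weak_curl :: "r3 set \<Rightarrow> (r3, r3) L2 \<Rightarrow> (r3, r3) L2 \<Rightarrow> bool"
  where "weak_curl D v w \<longleftrightarrow> v \<in> L2_on D \<and> w \<in> L2_on D \<and>
    (\<forall>\<phi>\<in>test_field D. (LINT x:D|lebesgue. fn_L2 w x \<bullet> \<phi> x) = (LINT x:D|lebesgue. fn_L2 v x \<bullet> curl \<phi> x))"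

text \<open>For \<open>v\<close> with weak curl \<open>w\<close>, the tangential trace \<open>n \<times> v\<close> on the boundary is the functional
  \<open>\<phi> \<mapsto> \<integral>\<^sub>D w \<bullet> \<phi> - v \<bullet> curl \<phi>\<close> on fields \<open>\<phi>\<close> that are smooth up to the boundary; by Green's
  formula it is the boundary integral of \<open>(n \<times> v) \<bullet> \<phi>\<close> when \<open>v\<close> is smooth.\<close>

definition tangential_trace :: "r3 set \<Rightarrow> (r3, r3) L2 \<Rightarrow> (r3, r3) L2 \<Rightarrow> (r3 \<Rightarrow> r3) \<Rightarrow> real"
  where "tangential_trace D v w \<phi> =
    (LINT x:D|lebesgue. fn_L2 w x \<bullet> \<phi> x) - (LINT x:D|lebesgue. fn_L2 v x \<bullet> curl \<phi> x)"

definition H_curl :: "r3 set \<Rightarrow> (r3, r3) L2 set"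
  where "H_curl D = {v. \<exists>w. weak_curl D v w}"

definition H0_curl :: "r3 set \<Rightarrow> (r3, r3) L2 set"
  where "H0_curl D = {v. \<exists>w. weak_curl D v w \<and> (\<forall>\<phi>\<in>smooth_field. tangential_trace D v w \<phi> = 0)}"

type_synonym state = "(r3, r3) L2 \<times> (r3, r3) L2"

definition state_space :: "r3 set \<Rightarrow> state set"
  where "state_space D = L2_on D \<times> L2_on D"

definition bounded_coefficient :: "r3 set \<Rightarrow> real \<Rightarrow> (r3 \<Rightarrow> real) \<Rightarrow> bool"
  where "bounded_coefficient D \<delta> a \<longleftrightarrow> set_borel_measurable lebesgue D a \<and>
    (\<exists>C. AE x in lebesgue. x \<in> D \<longrightarrow> \<delta> \<le> a x \<and> a x \<le> C)"

text \<open>The weighted inner product.  As the weights are bounded above and away from zero, the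
  topology of the state space is that of the product type \<^typ>\<open>state\<close>.\<close>

definition state_inner :: "r3 set \<Rightarrow> (r3 \<Rightarrow> real) \<Rightarrow> (r3 \<Rightarrow> real) \<Rightarrow> state \<Rightarrow> state \<Rightarrow> real"
  where "state_inner D \<epsilon> \<mu> u v = (LINT x:D|lebesgue.
    \<epsilon> x * (fn_L2 (fst u) x \<bullet> fn_L2 (fst v) x) + \<mu> x * (fn_L2 (snd u) x \<bullet> fn_L2 (snd v) x))"

text \<open>Unbounded operators are represented by their graphs.\<close>

definition maxwell_domain :: "r3 set \<Rightarrow> state set"
  where "maxwell_domain D = H0_curl D \<times> H_curl D"

definition maxwell :: "r3 set \<Rightarrow> (r3 \<Rightarrow> real) \<Rightarrow> (r3 \<Rightarrow> real) \<Rightarrow> (state \<times> state) set"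
  where "maxwell D \<epsilon> \<mu> = {(u, w). u \<in> maxwell_domain D \<and> w \<in> state_space D \<and>
    (\<exists>cE cH. weak_curl D (fst u) cE \<and> weak_curl D (snd u) cH \<and>
      (AE x in lebesgue. x \<in> D \<longrightarrow>
        fn_L2 (fst w) x = (1 / \<epsilon> x) *\<^sub>R fn_L2 cH x \<and> fn_L2 (snd w) x = - (1 / \<mu> x) *\<^sub>R fn_L2 cE x))}"

definition graph_norm :: "r3 set \<Rightarrow> (r3 \<Rightarrow> real) \<Rightarrow> (r3 \<Rightarrow> real) \<Rightarrow> state \<Rightarrow> real"
  where "graph_norm D \<epsilon> \<mu> u = (let Mu = (THE w. (u, w) \<in> maxwell D \<epsilon> \<mu>) in
    sqrt (state_inner D \<epsilon> \<mu> u u + state_inner D \<epsilon> \<mu> Mu Mu))"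

definition linear_operator_on :: "'a::real_vector set \<Rightarrow> 'b::real_vector set \<Rightarrow> ('a \<Rightarrow> 'b) \<Rightarrow> bool"
  where "linear_operator_on V W A \<longleftrightarrow> (\<forall>x\<in>V. A x \<in> W) \<and>
    (\<forall>x\<in>V. \<forall>y\<in>V. A (x + y) = A x + A y) \<and> (\<forall>c. \<forall>x\<in>V. A (c *\<^sub>R x) = c *\<^sub>R A x)"

definition bounded_operator_on ::
  "'a::real_normed_vector set \<Rightarrow> 'b::real_normed_vector set \<Rightarrow> ('a \<Rightarrow> 'b) \<Rightarrow> bool"
  where "bounded_operator_on V W A \<longleftrightarrow> linear_operator_on V W A \<and> (\<exists>K. \<forall>x\<in>V. norm (A x) \<le> K * norm x)"

definition unitary_group_on :: "'a::real_normed_vector set \<Rightarrow> ('a \<Rightarrow> 'a \<Rightarrow> real) \<Rightarrow> (real \<Rightarrow> 'a \<Rightarrow> 'a) \<Rightarrow> bool"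
  where "unitary_group_on H ip S \<longleftrightarrow>
    (\<forall>t. linear_operator_on H H (S t)) \<and>
    (\<forall>t. \<forall>u\<in>H. \<forall>v\<in>H. ip (S t u) (S t v) = ip u v) \<and>
    (\<forall>u\<in>H. S 0 u = u) \<and> (\<forall>s t. \<forall>u\<in>H. S (s + t) u = S s (S t u)) \<and>
    (\<forall>u\<in>H. continuous_on UNIV (\<lambda>t. S t u))"

definition generator :: "'a::real_normed_vector set \<Rightarrow> (real \<Rightarrow> 'a \<Rightarrow> 'a) \<Rightarrow> ('a \<times> 'a) set"
  where "generator H S = {(u, w). u \<in> H \<and> w \<in> H \<and> ((\<lambda>h. (1 / h) *\<^sub>R (S h u - u)) \<longlongrightarrow> w) (at 0)}"


section \<open>Coefficients of the stochastic equation\<close>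

definition lipschitz_current :: "r3 set \<Rightarrow> real \<Rightarrow> real \<Rightarrow> (real \<Rightarrow> r3 \<Rightarrow> r3 \<Rightarrow> r3 \<Rightarrow> r3) \<Rightarrow> bool"
  where "lipschitz_current D T L J \<longleftrightarrow>
    continuous_on ({0..T} \<times> D \<times> UNIV \<times> UNIV) (\<lambda>(t, x, a, b). J t x a b) \<and>
    (\<forall>t\<in>{0..T}. \<forall>x\<in>D. \<forall>a b. norm (J t x a b) \<le> L * (1 + norm a + norm b)) \<and>
    (\<forall>t\<in>{0..T}. \<forall>s\<in>{0..T}. \<forall>x\<in>D. \<forall>a1 b1 a2 b2.
      norm (J t x a1 b1 - J s x a2 b2) \<le> L * (\<bar>t - s\<bar> + norm (a1 - a2) + norm (b1 - b2)))"

definition bounded_current :: "r3 set \<Rightarrow> real \<Rightarrow> (real \<Rightarrow> r3 \<Rightarrow> r3) \<Rightarrow> bool"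
  where "bounded_current D T J \<longleftrightarrow>
    continuous_on ({0..T} \<times> D) (\<lambda>(t, x). J t x) \<and> bounded ((\<lambda>(t, x). J t x) ` ({0..T} \<times> D))"

definition at_state :: "(real \<Rightarrow> r3 \<Rightarrow> r3 \<Rightarrow> r3 \<Rightarrow> r3) \<Rightarrow> real \<Rightarrow> state \<Rightarrow> r3 \<Rightarrow> r3"
  where "at_state J t u x = J t x (fn_L2 (fst u) x) (fn_L2 (snd u) x)"

definition drift ::
  "r3 set \<Rightarrow> (r3 \<Rightarrow> real) \<Rightarrow> (r3 \<Rightarrow> real) \<Rightarrow> (real \<Rightarrow> r3 \<Rightarrow> r3 \<Rightarrow> r3 \<Rightarrow> r3) \<Rightarrow>
    (real \<Rightarrow> r3 \<Rightarrow> r3 \<Rightarrow> r3 \<Rightarrow> r3) \<Rightarrow> real \<Rightarrow> state \<Rightarrow> state"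
  where "drift D \<epsilon> \<mu> Je Jm t u =
    (to_L2 (\<lambda>x. if x \<in> D then - (1 / \<epsilon> x) *\<^sub>R at_state Je t u x else 0),
     to_L2 (\<lambda>x. if x \<in> D then - (1 / \<mu> x) *\<^sub>R at_state Jm t u x else 0))"

definition diffusion ::
  "r3 set \<Rightarrow> (r3 \<Rightarrow> real) \<Rightarrow> (r3 \<Rightarrow> real) \<Rightarrow> (real \<Rightarrow> r3 \<Rightarrow> r3) \<Rightarrow>
    (real \<Rightarrow> r3 \<Rightarrow> r3) \<Rightarrow> real \<Rightarrow> (r3, real) L2 \<Rightarrow> state"
  where "diffusion D \<epsilon> \<mu> Jer Jmr t v =
    (to_L2 (\<lambda>x. if x \<in> D then - (fn_L2 v x / \<epsilon> x) *\<^sub>R Jer t x else 0),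
     to_L2 (\<lambda>x. if x \<in> D then - (fn_L2 v x / \<mu> x) *\<^sub>R Jmr t x else 0))"

text \<open>\<open>C\<^sup>2\<close> self-maps, with bounded first and second Frechet derivatives, of a linear
  subspace \<open>V\<close> that is normed by \<open>N\<close> rather than by the norm of the type.\<close>

definition C2_bounded_on :: "'a::real_vector set \<Rightarrow> ('a \<Rightarrow> real) \<Rightarrow> ('a \<Rightarrow> 'a) \<Rightarrow> bool"
  where "C2_bounded_on V N f \<longleftrightarrow> (\<forall>x\<in>V. f x \<in> V) \<and>
    (\<exists>f' f'' K.
      (\<forall>x\<in>V. linear_operator_on V V (f' x)) \<and>
      (\<forall>x\<in>V. \<forall>h\<in>V. linear_operator_on V V (f'' x h)) \<and>
      (\<forall>x\<in>V. \<forall>k\<in>V. linear_operator_on V V (\<lambda>h. f'' x h k)) \<and>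
      (\<forall>x\<in>V. \<forall>h\<in>V. N (f' x h) \<le> K * N h) \<and>
      (\<forall>x\<in>V. \<forall>h\<in>V. \<forall>k\<in>V. N (f'' x h k) \<le> K * N h * N k) \<and>
      (\<forall>x\<in>V. \<forall>r>0. \<exists>d>0. \<forall>h\<in>V. N h < d \<longrightarrow> N (f (x + h) - f x - f' x h) \<le> r * N h) \<and>
      (\<forall>x\<in>V. \<forall>r>0. \<exists>d>0. \<forall>h\<in>V. N h < d \<longrightarrow>
        (\<forall>k\<in>V. N (f' (x + h) k - f' x k - f'' x h k) \<le> r * N h * N k)) \<and>
      (\<forall>x\<in>V. \<forall>r>0. \<exists>d>0. \<forall>y\<in>V. N (y - x) < d \<longrightarrow>
        (\<forall>h\<in>V. \<forall>k\<in>V. N (f'' y h k - f'' x h k) \<le> r * N h * N k)))"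


section \<open>The Wiener process and its covariance\<close>

definition orthonormal_basis :: "'a::real_inner set \<Rightarrow> (nat \<Rightarrow> 'a) \<Rightarrow> bool"
  where "orthonormal_basis U e \<longleftrightarrow>
    (\<forall>i j. e i \<bullet> e j = (if i = j then 1 else 0)) \<and> closure (span (range e)) = U"

text \<open>The trace below, and the Hilbert-Schmidt norms later on, do not depend on the choice of the
  orthonormal basis \<open>e\<close> used to express them.\<close>

definition covariance_operator :: "'a::real_inner set \<Rightarrow> (nat \<Rightarrow> 'a) \<Rightarrow> ('a \<Rightarrow> 'a) \<Rightarrow> bool"
  where "covariance_operator U e Q \<longleftrightarrow> bounded_operator_on U U Q \<and>
    (\<forall>u\<in>U. \<forall>v\<in>U. Q u \<bullet> v = u \<bullet> Q v) \<and> (\<forall>u\<in>U. u \<noteq> 0 \<longrightarrow> Q u \<bullet> u > 0) \<and>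
    summable (\<lambda>k. Q (e k) \<bullet> e k)"

definition positive_sqrt :: "'a::real_inner set \<Rightarrow> ('a \<Rightarrow> 'a) \<Rightarrow> ('a \<Rightarrow> 'a) \<Rightarrow> bool"
  where "positive_sqrt U Q R \<longleftrightarrow> bounded_operator_on U U R \<and>
    (\<forall>u\<in>U. \<forall>v\<in>U. R u \<bullet> v = u \<bullet> R v) \<and> (\<forall>u\<in>U. R u \<bullet> u \<ge> 0) \<and> (\<forall>u\<in>U. R (R u) = Q u)"

text \<open>Hilbert-Schmidt operators from \<open>U\<^sub>0 = R ` U\<close>, where \<open>R\<close> is the square root of the covariance,
  to a subspace \<open>V\<close> normed by \<open>N\<close>.  The norm of \<open>R v\<close> in \<open>U\<^sub>0\<close> is the norm of \<open>v\<close> in \<open>U\<close> and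
  \<open>R \<circ> e\<close> is an orthonormal basis of \<open>U\<^sub>0\<close>.\<close>

definition hilbert_schmidt_on ::
  "'a::real_inner set \<Rightarrow> (nat \<Rightarrow> 'a) \<Rightarrow> ('a \<Rightarrow> 'a) \<Rightarrow> 'b::real_vector set \<Rightarrow> ('b \<Rightarrow> real) \<Rightarrow> ('a \<Rightarrow> 'b) \<Rightarrow> bool"
  where "hilbert_schmidt_on U e R V N A \<longleftrightarrow> linear_operator_on (R ` U) V A \<and>
    (\<exists>K. \<forall>v\<in>U. N (A (R v)) \<le> K * norm v) \<and> summable (\<lambda>k. (N (A (R (e k))))\<^sup>2)"

definition filtered_prob_space :: "'w measure \<Rightarrow> (real \<Rightarrow> 'w measure) \<Rightarrow> real \<Rightarrow> bool"
  where "filtered_prob_space P F T \<longleftrightarrow> prob_space P \<and> (\<forall>t\<in>{0..T}. subalgebra P (F t)) \<and>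
    (\<forall>s t. 0 \<le> s \<and> s \<le> t \<and> t \<le> T \<longrightarrow> sets (F s) \<subseteq> sets (F t))"

definition predictable :: "'w measure \<Rightarrow> (real \<Rightarrow> 'w measure) \<Rightarrow> real \<Rightarrow> (real \<times> 'w) measure"
  where "predictable P F T = sigma ({0..T} \<times> space P)
    ({{0} \<times> A | A. A \<in> sets (F 0)} \<union>
     {{s<..t} \<times> A | s t A. 0 \<le> s \<and> s \<le> t \<and> t \<le> T \<and> A \<in> sets (F s)})"

definition wiener_process ::
  "'w measure \<Rightarrow> (real \<Rightarrow> 'w measure) \<Rightarrow> real \<Rightarrow> 'a::{real_inner, second_countable_topology} set \<Rightarrow>
    ('a \<Rightarrow> 'a) \<Rightarrow> (real \<Rightarrow> 'w \<Rightarrow> 'a) \<Rightarrow> bool"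
  where "wiener_process P F T U Q W \<longleftrightarrow>
    (\<forall>t\<in>{0..T}. W t \<in> borel_measurable (F t) \<and> (\<forall>\<omega>\<in>space P. W t \<omega> \<in> U)) \<and>
    (AE \<omega> in P. W 0 \<omega> = 0) \<and> (AE \<omega> in P. continuous_on {0..T} (\<lambda>t. W t \<omega>)) \<and>
    (\<forall>s t. 0 \<le> s \<and> s < t \<and> t \<le> T \<longrightarrow>
      prob_space.indep_set P (sets (F s))
        (sets (vimage_algebra (space P) (\<lambda>\<omega>. W t \<omega> - W s \<omega>) borel)) \<and>
      (\<forall>v\<in>U. v \<noteq> 0 \<longrightarrow> distributed P lborel (\<lambda>\<omega>. (W t \<omega> - W s \<omega>) \<bullet> v)
        (\<lambda>x. ennreal (normal_density 0 (sqrt ((t - s) * (Q v \<bullet> v))) x))))"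


section \<open>The Ito integral and mild solutions\<close>

text \<open>A list entry \<open>(a, b, A, \<Lambda>)\<close> stands for the elementary integrand that equals the bounded operator \<open>\<Lambda>\<close>
  on \<open>(a, b] \<times> A\<close>, with \<open>A\<close> an event of the \<open>\<sigma>\<close>-algebra at time \<open>a\<close>, and vanishes elsewhere;
  a list stands for the sum of its entries.\<close>

type_synonym ('w, 'a, 'b) elementary = "(real \<times> real \<times> 'w set \<times> ('a \<Rightarrow> 'b)) list"

definition elementary_process ::
  "(real \<Rightarrow> 'w measure) \<Rightarrow> real \<Rightarrow> 'a::real_normed_vector set \<Rightarrow> 'b::real_normed_vector set \<Rightarrow>
    ('w, 'a, 'b) elementary \<Rightarrow> bool"
  where "elementary_process F t U H xs \<longleftrightarrow> (\<forall>(a, b, A, \<Lambda>)\<in>set xs.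
    0 \<le> a \<and> a \<le> b \<and> b \<le> t \<and> A \<in> sets (F a) \<and> bounded_operator_on U H \<Lambda>)"

definition elementary_value :: "('w, 'a, 'b::real_vector) elementary \<Rightarrow> real \<Rightarrow> 'w \<Rightarrow> 'a \<Rightarrow> 'b"
  where "elementary_value xs s \<omega> v =
    (\<Sum>(a, b, A, \<Lambda>)\<leftarrow>xs. (indicator {a<..b} s * indicator A \<omega>) *\<^sub>R \<Lambda> v)"

definition elementary_integral ::
  "(real \<Rightarrow> 'w \<Rightarrow> 'a::real_vector) \<Rightarrow> ('w, 'a, 'b::real_vector) elementary \<Rightarrow> 'w \<Rightarrow> 'b"
  where "elementary_integral W xs \<omega> =
    (\<Sum>(a, b, A, \<Lambda>)\<leftarrow>xs. indicator A \<omega> *\<^sub>R \<Lambda> (W b \<omega> - W a \<omega>))"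

text \<open>\<open>X\<close> is (a version of) the Ito integral over \<open>[0, t]\<close> of the predictable integrand \<open>\<Phi>\<close>, with
  values in the Hilbert-Schmidt operators from \<open>U\<^sub>0 = R ` U\<close> to \<open>H\<close>: the mean square limit of the
  integrals of elementary integrands that approximate \<open>\<Phi>\<close> in mean square.\<close>

definition has_ito_integral ::
  "'w measure \<Rightarrow> (real \<Rightarrow> 'w measure) \<Rightarrow> 'a::real_inner set \<Rightarrow> (nat \<Rightarrow> 'a) \<Rightarrow> ('a \<Rightarrow> 'a) \<Rightarrow>
    'b::{real_normed_vector, second_countable_topology} set \<Rightarrow> (real \<Rightarrow> 'w \<Rightarrow> 'a) \<Rightarrow>
    (real \<Rightarrow> 'w \<Rightarrow> 'a \<Rightarrow> 'b) \<Rightarrow> real \<Rightarrow> ('w \<Rightarrow> 'b) \<Rightarrow> bool"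
  where "has_ito_integral P F U e R H W \<Phi> t X \<longleftrightarrow>
    X \<in> borel_measurable P \<and>
    (\<forall>k. (\<lambda>(s, \<omega>). \<Phi> s \<omega> (R (e k))) \<in> borel_measurable (predictable P F t)) \<and>
    (\<exists>xs :: nat \<Rightarrow> ('w, 'a, 'b) elementary.
      (\<forall>n. elementary_process F t U H (xs n)) \<and>
      (\<lambda>n. \<integral>\<^sup>+\<omega>. (\<integral>\<^sup>+s\<in>{0..t}. (\<Sum>k. ennreal ((norm
          (elementary_value (xs n) s \<omega> (R (e k)) - \<Phi> s \<omega> (R (e k))))\<^sup>2)) \<partial>lborel) \<partial>P)
        \<longlonglongrightarrow> 0 \<and>
      (\<lambda>n. \<integral>\<^sup>+\<omega>. ennreal ((norm (elementary_integral W (xs n) \<omega> - X \<omega>))\<^sup>2) \<partial>P) \<longlonglongrightarrow> 0)"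

definition mild_solution ::
  "'w measure \<Rightarrow> (real \<Rightarrow> 'w measure) \<Rightarrow> real \<Rightarrow> 'a::real_inner set \<Rightarrow> (nat \<Rightarrow> 'a) \<Rightarrow> ('a \<Rightarrow> 'a) \<Rightarrow>
    'b::{banach, second_countable_topology} set \<Rightarrow> (real \<Rightarrow> 'w \<Rightarrow> 'a) \<Rightarrow> (real \<Rightarrow> 'b \<Rightarrow> 'b) \<Rightarrow>
    (real \<Rightarrow> 'b \<Rightarrow> 'b) \<Rightarrow> (real \<Rightarrow> 'a \<Rightarrow> 'b) \<Rightarrow> ('w \<Rightarrow> 'b) \<Rightarrow> (real \<Rightarrow> 'w \<Rightarrow> 'b) \<Rightarrow> bool"
  where "mild_solution P F T U e R H W S G B u0 u \<longleftrightarrow>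
    (\<forall>t\<in>{0..T}. \<forall>\<omega>\<in>space P. u t \<omega> \<in> H) \<and>
    (\<lambda>(t, \<omega>). u t \<omega>) \<in> borel_measurable (predictable P F T) \<and>
    (AE \<omega> in P. (\<integral>\<^sup>+t\<in>{0..T}. ennreal ((norm (u t \<omega>))\<^sup>2) \<partial>lborel) < \<infinity>) \<and>
    (\<forall>t\<in>{0..T}. \<exists>X. has_ito_integral P F U e R H W (\<lambda>s \<omega> v. S (t - s) (B s v)) t X \<and>
      (AE \<omega> in P. set_integrable lborel {0..t} (\<lambda>s. S (t - s) (G s (u s \<omega>))) \<and>
        u t \<omega> = S t (u0 \<omega>) + (LINT s:{0..t}|lborel. S (t - s) (G s (u s \<omega>))) + X \<omega>))"


section \<open>Distributional divergence and its average\<close>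

text \<open>A distribution on \<open>D\<close> is given by its values on \<open>test_fun D\<close>; averages and time integrals of
  distributions are taken in the weak sense, that is, for each test function.\<close>

definition divergence :: "r3 set \<Rightarrow> (r3 \<Rightarrow> r3) \<Rightarrow> (r3 \<Rightarrow> real) \<Rightarrow> real"
  where "divergence D V \<phi> = - (LINT x:D|lebesgue. V x \<bullet> grad \<phi> x)"

definition distr_time_integrable :: "r3 set \<Rightarrow> real \<Rightarrow> (real \<Rightarrow> (r3 \<Rightarrow> real) \<Rightarrow> real) \<Rightarrow> bool"
  where "distr_time_integrable D t \<Lambda> \<longleftrightarrow> (\<forall>\<phi>\<in>test_fun D. set_integrable lborel {0..t} (\<lambda>s. \<Lambda> s \<phi>))"

definition distr_time_integral :: "real \<Rightarrow> (real \<Rightarrow> (r3 \<Rightarrow> real) \<Rightarrow> real) \<Rightarrow> (r3 \<Rightarrow> real) \<Rightarrow> real"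
  where "distr_time_integral t \<Lambda> \<phi> = (LINT s:{0..t}|lborel. \<Lambda> s \<phi>)"

definition distr_integrable :: "r3 set \<Rightarrow> 'w measure \<Rightarrow> ('w \<Rightarrow> (r3 \<Rightarrow> real) \<Rightarrow> real) \<Rightarrow> bool"
  where "distr_integrable D P \<Lambda> \<longleftrightarrow> (\<forall>\<phi>\<in>test_fun D. integrable P (\<lambda>\<omega>. \<Lambda> \<omega> \<phi>))"

definition distr_expectation :: "'w measure \<Rightarrow> ('w \<Rightarrow> (r3 \<Rightarrow> real) \<Rightarrow> real) \<Rightarrow> (r3 \<Rightarrow> real) \<Rightarrow> real"
  where "distr_expectation P \<Lambda> \<phi> = (LINT \<omega>|P. \<Lambda> \<omega> \<phi>)"

end

theory Submission
  imports Defs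
begin

text \<open>For a test function \<open>\<phi>\<close>, \<open>div (\<epsilon> E)\<close> tested with \<open>\<phi>\<close> is \<open>- \<langle>(E, H), w\<rangle>\<close> in the weighted inner product, where
  \<open>w = (\<nabla>\<phi>, 0)\<close>.  As \<open>curl \<nabla>\<phi> = 0\<close> and \<open>\<phi>\<close> has compact support in \<open>D\<close>, the vector \<open>w\<close> lies in the kernel of the
  Maxwell operator, so the unitary group fixes \<open>w\<close> and preserves the functional.  Applied to the mild
  formulation, the functional removes the group from the initial term and from the drift term, the latter
  becoming \<open>- div J\<^sub>e\<close>, and the stochastic term has mean zero.  The interchange of expectation and time
  integral needs \<open>E \<integral> \<parallel>u\<parallel> dt < \<infinity>\<close>, which a mild solution satisfies only after a pathwise
  Gronwall argument; the stochastic convolution in it is bounded in mean square, uniformly in time, by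
  the Ito isometry.  Magnetic fields are treated in the same way with \<open>w = (0, \<nabla>\<phi>)\<close>.\<close>

section \<open>Gradients and the kernel of the Maxwell operator\<close>

text \<open>The obstacle is the notion of mild solution: it asks only for almost surely square
  integrable paths, and it states the equation for each t outside a null set that depends on t.
  Neither moments nor continuity in t can be assumed, so Gronwall is run with a remainder that is
  defined at every (t, \<omega>) and controlled in mean at each fixed t. The stochastic term is
  known only as a mean square limit of elementary integrals; its mean and second moment are derived
  from independence and the Gaussian law of projected increments, one pair of entries at a time. Two
  norms coexist: the group is unitary for the weighted inner product, and only bounded uniformly in
  time for the norm of the product type, in which limits and Bochner integrals are taken. The
  vanishing of the curl of a gradient is tested against all smooth fields, because the tangential
  trace is a functional on these; the compact support of \<phi> replaces a boundary condition. The
  averaging is carried out for an abstract bounded functional that is invariant under the group, and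
  both fields are instances.\<close>

lemma differentiable_line_derivative:
  fixes g :: "r3 \<Rightarrow> real"
  assumes "\<And>x. g differentiable (at x)"
  shows "((\<lambda>t. g (x + t *\<^sub>R axis i 1)) has_real_derivative partial i g (x + t *\<^sub>R axis i 1)) (at t)"
proof -
  let ?l = "\<lambda>t. x + t *\<^sub>R axis i (1::real)"
  have l: "(?l has_derivative (\<lambda>s. s *\<^sub>R axis i 1)) (at t)"
    by (auto intro!: derivative_eq_intros)
  have g: "(g has_derivative frechet_derivative g (at (?l t))) (at (?l t))"
    using assms frechet_derivative_works by blast
  then have lin: "linear (frechet_derivative g (at (?l t)))"
    by (rule has_derivative_linear)
  have "(g \<circ> ?l has_derivative (frechet_derivative g (at (?l t)) \<circ> (\<lambda>s. s *\<^sub>R axis i 1))) (at t)"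
    by (rule diff_chain_at[OF l g])
  moreover have "frechet_derivative g (at (?l t)) \<circ> (\<lambda>s. s *\<^sub>R axis i 1) = (*) (partial i g (?l t))"
    using linear_scale[OF lin] by (auto simp: fun_eq_iff partial_def)
  ultimately show ?thesis by (simp add: has_field_derivative_def o_def)
qed

lemma difference_quotient_tendsto:
  fixes g :: "r3 \<Rightarrow> real"
  assumes "\<And>x. g differentiable (at x)"
  shows "(\<lambda>n. (g (x + (1 / real (Suc n)) *\<^sub>R axis i 1) - g x) * real (Suc n)) \<longlonglongrightarrow> partial i g x"
proof -
  have "((\<lambda>h. (g (x + h *\<^sub>R axis i 1) - g x) / h) \<longlongrightarrow> partial i g x) (at 0)"
    using differentiable_line_derivative[OF assms, of x i 0] by (simp add: DERIV_def)
  moreover have "filterlim (\<lambda>n. 1 / real (Suc n)) (at 0) sequentially"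
    unfolding filterlim_at using LIMSEQ_inverse_real_of_nat by (auto simp: inverse_eq_divide)
  ultimately show ?thesis
    by (auto dest: filterlim_compose)
qed

lemma difference_bound:
  fixes g :: "r3 \<Rightarrow> real"
  assumes g: "\<And>x. g differentiable (at x)" and "0 \<le> h"
    and M: "\<And>s. 0 \<le> s \<Longrightarrow> s \<le> h \<Longrightarrow> \<bar>partial i g (x + s *\<^sub>R axis i 1)\<bar> \<le> M"
  shows "\<bar>g (x + h *\<^sub>R axis i 1) - g x\<bar> \<le> M * h"
proof -
  have "norm ((\<lambda>t. g (x + t *\<^sub>R axis i 1)) h - (\<lambda>t. g (x + t *\<^sub>R axis i 1)) 0) \<le> M * norm (h - 0)"
    by (rule field_differentiable_bound[where S = "{0..h}" and f' = "\<lambda>t. partial i g (x + t *\<^sub>R axis i 1)"])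
       (use M \<open>0 \<le> h\<close> in \<open>auto intro!: DERIV_subset[OF differentiable_line_derivative[OF g]]\<close>)
  then show ?thesis using \<open>0 \<le> h\<close> by simp
qed

lemma differentiable_borel_measurable:
  fixes g :: "r3 \<Rightarrow> real"
  assumes "\<And>x. g differentiable (at x)"
  shows "g \<in> borel_measurable borel"
  by (intro borel_measurable_continuous_onI continuous_at_imp_continuous_on)
     (use assms differentiable_imp_continuous_within in blast)

text \<open>Dominated convergence. The compact support sits on the weight \<phi>, so g may grow at
  infinity, and \<phi> may be as rough as the indicator used in
  \<open>integral_partial_eq_zero\<close>.\<close>

lemma weighted_difference_quotient_tendsto:
  fixes g \<phi> :: "r3 \<Rightarrow> real"
  assumes g: "\<And>x. g differentiable (at x)" "continuous_on UNIV (partial i g)"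
    and \<phi>: "\<phi> \<in> borel_measurable borel" "\<And>x. \<bar>\<phi> x\<bar> \<le> C" "compact K" "\<And>x. x \<notin> K \<Longrightarrow> \<phi> x = 0"
  shows "(\<lambda>n. LINT x|lborel. \<phi> x * ((g (x + (1 / real (Suc n)) *\<^sub>R axis i 1) - g x) * real (Suc n)))
    \<longlonglongrightarrow> (LINT x|lborel. \<phi> x * partial i g x)"
proof -
  let ?s = "\<lambda>n x. x + (1 / real (Suc n)) *\<^sub>R axis i 1"
  let ?q = "\<lambda>n x. (g (?s n x) - g x) * real (Suc n)"
  \<comment> \<open>\<open>K\<close> swept by unit segments in direction i. All steps 1 / (n + 1)
    are at most 1, so the mean value estimate of the quotients sees the partial derivative on this
    compact set only.\<close>
  define K' where "K' = (\<lambda>(x, s). x + s *\<^sub>R axis i 1) ` (K \<times> {0..1::real})"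
  have "compact K'"
    unfolding K'_def using \<phi>(3)
    by (intro compact_continuous_image compact_Times) (auto simp: split_beta intro!: continuous_intros)
  then have "compact (partial i g ` K')"
    by (intro compact_continuous_image continuous_on_subset[OF g(2)]) auto
  then obtain M where M: "\<And>y. y \<in> K' \<Longrightarrow> \<bar>partial i g y\<bar> \<le> M"
    using compact_imp_bounded bounded_iff by (metis imageI real_norm_def)
  have [measurable]: "g \<in> borel_measurable borel" by (rule differentiable_borel_measurable[OF g(1)])
  have [measurable]: "partial i g \<in> borel_measurable borel" using g(2) by (rule borel_measurable_continuous_onI)
  note [measurable] = \<phi>(1)
  have C: "0 \<le> C" using \<phi>(2)[of 0] by simp
  show ?thesis
  proof (rule integral_dominated_convergence[where w = "\<lambda>x. indicator K x * (C * M)"])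
    have "K \<in> sets lborel" using \<phi>(3) by (auto dest: compact_imp_closed)
    then show "integrable lborel (\<lambda>x. indicator K x * (C * M))"
      using emeasure_compact_finite[OF \<phi>(3)] by (intro integrable_mult_left integrable_real_indicator) auto
    show "AE x in lborel. (\<lambda>n. \<phi> x * ?q n x) \<longlonglongrightarrow> \<phi> x * partial i g x"
      by (intro AE_I2 tendsto_intros difference_quotient_tendsto g)
    show "AE x in lborel. norm (\<phi> x * ?q n x) \<le> indicator K x * (C * M)" for n
    proof (rule AE_I2)
      fix x
      show "norm (\<phi> x * ?q n x) \<le> indicator K x * (C * M)"
      proof (cases "x \<in> K")
        case True
        have "\<bar>g (?s n x) - g x\<bar> \<le> M * (1 / real (Suc n))"
        proof (rule difference_bound[OF g(1)])
          fix s assume "0 \<le> s" "s \<le> 1 / real (Suc n)"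
          moreover have "1 / real (Suc n) \<le> 1" by simp
          ultimately have "0 \<le> s" "s \<le> 1" by linarith+
          then have "x + s *\<^sub>R axis i 1 \<in> K'"
            unfolding K'_def using True by (intro image_eqI[of _ _ "(x, s)"]) auto
          then show "\<bar>partial i g (x + s *\<^sub>R axis i 1)\<bar> \<le> M" by (rule M)
        qed simp
        then have "\<bar>g (?s n x) - g x\<bar> * real (Suc n) \<le> M"
          by (simp add: field_simps)
        then have "\<bar>\<phi> x\<bar> * (\<bar>g (?s n x) - g x\<bar> * real (Suc n)) \<le> C * M"
          using \<phi>(2)[of x] C by (intro mult_mono) auto
        then show ?thesis using True by (simp add: abs_mult)
      qed (simp add: \<phi>(4))
    qed
  qed measurable
qed

lemma partial_eq_zero_outside:
  assumes "closed K" "\<And>x. x \<notin> K \<Longrightarrow> f x = 0" "x \<notin> K"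
  shows "partial i f x = 0"
proof -
  have "(f has_derivative (\<lambda>_. 0)) (at x)"
    by (rule has_derivative_transform_within_open[where f = "\<lambda>_. 0" and s = "- K"]) (use assms in auto)
  note d = frechet_derivative_at[OF this]
  show ?thesis unfolding partial_def d[symmetric] by simp
qed

lemma integrable_compact_support:
  fixes f :: "r3 \<Rightarrow> real"
  assumes "continuous_on UNIV f" "compact K" "\<And>x. x \<notin> K \<Longrightarrow> f x = 0"
  shows "integrable lborel f"
proof -
  have "set_integrable lborel K f"
    unfolding set_integrable_def
    using assms by (intro borel_integrable_compact) (auto intro: continuous_on_subset)
  moreover have "(\<lambda>x. indicator K x *\<^sub>R f x) = f" using assms(3) by (auto simp: fun_eq_iff indicator_def)
  ultimately show ?thesis unfolding set_integrable_def by simp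
qed

text \<open>Translation invariance of Lebesgue measure makes the integral of every difference
  quotient vanish, and the partial derivative is their limit.\<close>

lemma integral_partial_eq_zero:
  fixes f :: "r3 \<Rightarrow> real"
  assumes f: "\<And>x. f differentiable (at x)" "continuous_on UNIV (partial i f)"
    and K: "compact K" "\<And>x. x \<notin> K \<Longrightarrow> f x = 0"
  shows "(LINT x|lborel. partial i f x) = 0"
proof -
  let ?s = "\<lambda>n x. x + (1 / real (Suc n)) *\<^sub>R axis i 1"
  let ?q = "\<lambda>n x. (f (?s n x) - f x) * real (Suc n)"
  \<comment> \<open>Here \<open>K\<close> is swept backwards, so that outside \<open>K'\<close> both
    f x and its value at the shifted point vanish. The indicator of \<open>K'\<close> is then a
    weight that changes neither the quotients nor the derivative.\<close>
  define K' where "K' = (\<lambda>(x, s). x - s *\<^sub>R axis i 1) ` (K \<times> {0..1::real})"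
  have K': "compact K'"
    unfolding K'_def using K(1)
    by (intro compact_continuous_image compact_Times) (auto simp: split_beta intro!: continuous_intros)
  have sub: "x \<in> K'" if "x + s *\<^sub>R axis i 1 \<in> K" "0 \<le> s" "s \<le> 1" for x s
    unfolding K'_def using that by (intro image_eqI[of _ _ "(x + s *\<^sub>R axis i 1, s)"]) auto
  have [measurable]: "f \<in> borel_measurable borel" by (rule differentiable_borel_measurable[OF f(1)])
  have cont: "continuous_on UNIV f"
    by (intro continuous_at_imp_continuous_on ballI differentiable_imp_continuous_within f)
  have int: "integrable lborel f" using cont K by (rule integrable_compact_support)
  have shift: "integrable lborel (\<lambda>x. f (x + a))" "(LINT x|lborel. f (x + a)) = (LINT x|lborel. f x)" for a
  proof -
    have d: "distr lborel borel ((+) a) = lborel" by (rule lborel_distr_plus)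
    have "integrable (distr lborel borel ((+) a)) f" unfolding d by (rule int)
    then show "integrable lborel (\<lambda>x. f (x + a))" by (simp add: integrable_distr_eq add.commute)
    have "(LINT x|distr lborel borel ((+) a). f x) = (LINT x|lborel. f (a + x))"
      by (rule integral_distr) auto
    then show "(LINT x|lborel. f (x + a)) = (LINT x|lborel. f x)" unfolding d by (simp add: add.commute)
  qed
  have "(\<lambda>n. LINT x|lborel. indicator K' x * ?q n x)
    \<longlonglongrightarrow> (LINT x|lborel. indicator K' x * partial i f x)"
    by (rule weighted_difference_quotient_tendsto[OF f _ _ K', where C = 1])
       (use borel_closed[OF compact_imp_closed[OF K']] in \<open>auto simp: indicator_def intro: borel_measurable_indicator\<close>)
  also have "(\<lambda>n. LINT x|lborel. indicator K' x * ?q n x) = (\<lambda>_. 0)"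
  proof
    fix n
    have "(LINT x|lborel. indicator K' x * ?q n x)
      = (LINT x|lborel. ?q n x)"
    proof (intro Bochner_Integration.integral_cong refl)
      fix x
      show "indicator K' x * ?q n x
        = ?q n x"
      proof (cases "x \<in> K'")
        case False
        then have "x \<notin> K" "?s n x \<notin> K"
          using sub[of x "1 / real (Suc n)"] sub[of x 0] by auto
        then have "f x = 0" "f (?s n x) = 0" by (simp_all only: K(2) simp_thms)
        then show ?thesis by (simp only: diff_self mult_zero_left mult_zero_right)
      qed simp
    qed
    also have "\<dots> = 0" using shift int by simp
    finally show "(LINT x|lborel. indicator K' x * ?q n x) = 0" .
  qed
  finally have "(LINT x|lborel. indicator K' x * partial i f x) = 0"
    using LIMSEQ_unique tendsto_const by blast
  also have "(\<lambda>x. indicator K' x * partial i f x) = partial i f"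
  proof
    fix x
    show "indicator K' x * partial i f x = partial i f x"
      using sub[of x 0] partial_eq_zero_outside[OF compact_imp_closed[OF K(1)], of f x i, OF K(2)]
      by (auto simp: indicator_def)
  qed
  finally show ?thesis .
qed

lemma partial_mult:
  assumes "f differentiable (at x)" "g differentiable (at x)"
  shows "partial i (\<lambda>x. f x * g x) x = f x * partial i g x + partial i f x * g x"
proof -
  have "((\<lambda>x. f x * g x) has_derivative (\<lambda>h. f x * frechet_derivative g (at x) h + frechet_derivative f (at x) h * g x)) (at x)"
    using assms by (intro has_derivative_mult) (simp_all add: frechet_derivative_works)
  note d = frechet_derivative_at[OF this]
  show ?thesis unfolding partial_def d[symmetric] by simp
qed

lemma integration_by_parts:
  fixes f g :: "r3 \<Rightarrow> real"
  assumes f: "\<And>x. f differentiable (at x)" "continuous_on UNIV (partial i f)"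
    and g: "\<And>x. g differentiable (at x)" "continuous_on UNIV (partial i g)"
    and K: "compact K" "\<And>x. x \<notin> K \<Longrightarrow> f x = 0"
  shows "(LINT x|lborel. f x * partial i g x) = - (LINT x|lborel. partial i f x * g x)"
proof -
  have cont: "continuous_on UNIV f" "continuous_on UNIV g"
    by (auto intro!: continuous_at_imp_continuous_on differentiable_imp_continuous_within f g)
  have eq: "partial i (\<lambda>x. f x * g x) = (\<lambda>x. f x * partial i g x + partial i f x * g x)"
    using partial_mult f(1) g(1) by blast
  have zero: "partial i f x = 0" if "x \<notin> K" for x
    using partial_eq_zero_outside[OF compact_imp_closed[OF K(1)], of f x i] K(2) that by blast
  have "continuous_on UNIV (partial i (\<lambda>x. f x * g x))"
    unfolding eq by (intro continuous_intros cont f g)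
  then have "(LINT x|lborel. partial i (\<lambda>x. f x * g x) x) = 0"
    by (intro integral_partial_eq_zero[where K = K] differentiable_mult f g K(1)) (simp_all add: K(2))
  moreover have "integrable lborel (\<lambda>x. f x * partial i g x)" "integrable lborel (\<lambda>x. partial i f x * g x)"
    by (intro integrable_compact_support[OF _ K(1)] continuous_on_mult cont f g; simp add: K(2) zero)+
  ultimately show ?thesis unfolding eq by simp
qed

text \<open>Symmetric mixed partial derivatives are not needed: the second derivative is moved by a
  difference quotient of \<open>g\<close> in direction \<open>i\<close>, to which integration by parts in direction \<open>j\<close> applies.\<close>

lemma integral_partial_antisym:
  fixes f g :: "r3 \<Rightarrow> real"
  assumes f: "smooth f" and g: "smooth g" and K: "compact K" "\<And>x. x \<notin> K \<Longrightarrow> f x = 0"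
  shows "(LINT x|lborel. partial i f x * partial j g x) = (LINT x|lborel. partial j f x * partial i g x)"
proof -
  have sm: "h differentiable (at x)" "continuous_on UNIV (partial k h)" "smooth (partial k h)" if "smooth h" for h x k
  proof -
    have C: "C_k k h" for k using that by (simp add: smooth_def)
    show "h differentiable (at x)" "continuous_on UNIV (partial k h)"
      using C[of "Suc 0"] by auto
    show "smooth (partial k h)" unfolding smooth_def using C[of "Suc _"] by auto
  qed
  have cont: "continuous_on UNIV h" if "smooth h" for h :: "r3 \<Rightarrow> real"
    by (auto intro!: continuous_at_imp_continuous_on differentiable_imp_continuous_within sm that)
  have bdd: "\<exists>C. \<forall>x. \<bar>h x\<bar> \<le> C" if "continuous_on UNIV h" "\<And>x. x \<notin> K \<Longrightarrow> h x = 0" for h :: "r3 \<Rightarrow> real"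
  proof -
    have "compact (h ` K)" by (intro compact_continuous_image continuous_on_subset[OF that(1)] K) auto
    then obtain C where C: "\<And>x. x \<in> K \<Longrightarrow> \<bar>h x\<bar> \<le> C" 
      using compact_imp_bounded bounded_iff by (metis imageI real_norm_def)
    have "\<bar>h x\<bar> \<le> max C 0" for x using C[of x] that(2)[of x] by (cases "x \<in> K") (auto simp: max_def)
    then show ?thesis by blast
  qed
  have out: "partial k f x = 0" if "x \<notin> K" for k x
    using partial_eq_zero_outside[OF compact_imp_closed[OF K(1)], of f x k] K(2) that by blast
  define \<tau> where "\<tau> n x = x + (1 / real (Suc n)) *\<^sub>R axis i (1::real)" for n and x :: r3
  define q where "q n x = (g (\<tau> n x) - g x) * real (Suc n)" for n x
  have has: "(h has_derivative frechet_derivative h (at x)) (at x)" if "smooth h" for h :: "r3 \<Rightarrow> real" and x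
    using sm(1)[OF that] frechet_derivative_works by blast
  have q_der: "(q n has_derivative (\<lambda>v. (frechet_derivative g (at (\<tau> n x)) v - frechet_derivative g (at x) v) * real (Suc n))) (at x)" for n x
  proof -
    have \<tau>: "(\<tau> n has_derivative (\<lambda>v. v)) (at x)" unfolding \<tau>_def by (auto intro!: derivative_eq_intros)
    have "(g \<circ> \<tau> n has_derivative frechet_derivative g (at (\<tau> n x)) \<circ> (\<lambda>v. v)) (at x)"
      by (rule diff_chain_at[OF \<tau> has[OF g]])
    then have "((\<lambda>x. g (\<tau> n x)) has_derivative frechet_derivative g (at (\<tau> n x))) (at x)" by (simp add: o_def)
    then show ?thesis unfolding q_def by (intro has_derivative_mult_left has_derivative_diff has[OF g])
  qed
  have q_diff: "q n differentiable (at x)" for n x using q_der differentiableI by blast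
  have q_partial: "partial j (q n) = (\<lambda>x. (partial j g (\<tau> n x) - partial j g x) * real (Suc n))" for n
    unfolding partial_def[of j "q n"] frechet_derivative_at[OF q_der, symmetric] by (simp add: partial_def)
  have q_cont: "continuous_on UNIV (partial j (q n))" for n
    unfolding q_partial \<tau>_def
    by (intro continuous_intros continuous_on_compose2[OF sm(2)[OF g]]) auto
  obtain C where C: "\<bar>f x\<bar> \<le> C" for x using bdd[OF cont[OF f] K(2)] by blast
  obtain C' where C': "\<bar>partial j f x\<bar> \<le> C'" for x using bdd[OF sm(2)[OF f] out] by blast
  \<comment> \<open>In the limit, integration by parts of the quotients equates the integral of f
    times the mixed derivative with minus that of \<open>partial j f\<close> times
    \<open>partial i g\<close>. A second integration by parts, in direction i, finishes.\<close>
  have lim1: "(\<lambda>n. LINT x|lborel. f x * partial j (q n) x) \<longlonglongrightarrow> (LINT x|lborel. f x * partial i (partial j g) x)"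
    unfolding q_partial \<tau>_def
    by (rule weighted_difference_quotient_tendsto[OF sm(1,2)[OF sm(3)[OF g]] _ C K])
       (intro borel_measurable_continuous_onI cont f)
  have lim2: "(\<lambda>n. LINT x|lborel. partial j f x * q n x) \<longlonglongrightarrow> (LINT x|lborel. partial j f x * partial i g x)"
    unfolding q_def \<tau>_def
    by (rule weighted_difference_quotient_tendsto[OF sm(1,2)[OF g] _ C' K(1) out])
       (intro borel_measurable_continuous_onI sm f)
  have ibp: "(LINT x|lborel. f x * partial j (q n) x) = - (LINT x|lborel. partial j f x * q n x)" for n
    by (rule integration_by_parts[OF sm(1,2)[OF f] q_diff q_cont K])
  have "- (LINT x|lborel. partial j f x * partial i g x) = (LINT x|lborel. f x * partial i (partial j g) x)"
    using LIMSEQ_unique[OF lim1[unfolded ibp] tendsto_minus[OF lim2]] by (simp only:)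
  also have "\<dots> = - (LINT x|lborel. partial i f x * partial j g x)"
    by (rule integration_by_parts[OF sm(1,2)[OF f] sm(1,2)[OF sm(3)[OF g]] K])
  finally show ?thesis by simp
qed

section \<open>Gradients of test functions: weak curl and tangential trace\<close>

lemma smooth_partial: "smooth f \<Longrightarrow> smooth (partial i f)"
  unfolding smooth_def using C_k.simps(2) by blast

lemma smooth_continuous: "smooth f \<Longrightarrow> continuous_on UNIV f"
  unfolding smooth_def using C_k.simps(1) by blast

lemma test_fun_smooth: "\<phi> \<in> test_fun D \<Longrightarrow> smooth \<phi>"
  by (simp add: test_fun_def)

lemma grad_continuous:
  assumes "smooth \<phi>"
  shows "continuous_on UNIV (grad \<phi>)"
  unfolding grad_def by (intro continuous_on_vec_lambda smooth_continuous smooth_partial assms)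

lemma grad_measurable: "smooth \<phi> \<Longrightarrow> grad \<phi> \<in> borel_measurable lebesgue"
  by (simp add: borel_measurable_continuous_onI grad_continuous measurable_completion)

lemma test_fun_grad_outside:
  assumes "\<phi> \<in> test_fun D" "x \<notin> D"
  shows "grad \<phi> x = 0"
proof -
  have "partial i \<phi> x = 0" for i
    by (rule partial_eq_zero_outside[of "closure {x. \<phi> x \<noteq> 0}"])
       (use assms closure_subset[of "{x. \<phi> x \<noteq> 0}"] in \<open>auto simp: test_fun_def\<close>)
  then show ?thesis by (simp add: grad_def vec_eq_iff)
qed

lemma square_integrable_grad:
  assumes \<phi>: "\<phi> \<in> test_fun D"
  shows "square_integrable (grad \<phi>)"
  unfolding square_integrable_def
proof
  let ?K = "closure {x. \<phi> x \<noteq> 0}"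
  show [measurable]: "grad \<phi> \<in> borel_measurable lebesgue"
    by (rule grad_measurable[OF test_fun_smooth[OF \<phi>]])
  have zero: "grad \<phi> x = 0" if "x \<notin> ?K" for x
    by (rule test_fun_grad_outside[of _ ?K]) (use assms that in \<open>auto simp: test_fun_def\<close>)
  have "integrable lborel (\<lambda>x. (norm (grad \<phi> x))\<^sup>2)"
    using \<phi> zero by (intro integrable_compact_support[of _ ?K] continuous_intros grad_continuous)
      (auto simp: test_fun_def)
  then show "integrable lebesgue (\<lambda>x. (norm (grad \<phi> x))\<^sup>2)"
    by (subst integrable_completion) auto
qed

text \<open>The six products in the expansion cancel in pairs by
  \<open>integral_partial_antisym\<close>. Compact support comes from \<phi> alone, which admits
  every smooth \<psi>, as the tangential trace requires.\<close>

lemma integral_grad_inner_curl: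
  assumes \<phi>: "\<phi> \<in> test_fun D" and \<psi>: "\<psi> \<in> smooth_field"
  shows "(LINT x|lebesgue. grad \<phi> x \<bullet> curl \<psi> x) = 0"
proof -
  let ?K = "closure {x. \<phi> x \<noteq> 0}"
  have K: "compact ?K" "\<And>x. x \<notin> ?K \<Longrightarrow> \<phi> x = 0"
    using \<phi> closure_subset[of "{x. \<phi> x \<noteq> 0}"] by (auto simp: test_fun_def)
  have sm: "smooth \<phi>" "\<And>i. smooth (\<lambda>x. \<psi> x $ i)"
    using \<phi> \<psi> by (auto simp: test_fun_def smooth_field_def)
  define m where "m i j k x = partial i \<phi> x * partial j (\<lambda>y. \<psi> y $ k) x" for i j k x
  have c: "continuous_on UNIV (m i j k)" for i j k
    unfolding m_def by (intro continuous_intros smooth_continuous smooth_partial sm)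
  have m0: "m i j k x = 0" if "x \<notin> ?K" for i j k x
    using partial_eq_zero_outside[OF compact_imp_closed[OF K(1)], of \<phi> x i, OF K(2) that] by (simp add: m_def)
  have i: "integrable lborel (m i j k)" for i j k
    by (rule integrable_compact_support[OF c K(1) m0])
  have a: "integral\<^sup>L lborel (m i j k) = integral\<^sup>L lborel (m j i k)" for i j k
    unfolding m_def by (rule integral_partial_antisym[OF sm(1) sm(2) K])
  have eq: "(\<lambda>x. grad \<phi> x \<bullet> curl \<psi> x) = (\<lambda>x. (m 1 2 3 x - m 2 1 3 x) + (m 2 3 1 x - m 3 2 1 x) + (m 3 1 2 x - m 1 3 2 x))"
    unfolding fun_eq_iff m_def grad_def curl_def inner_vec_def sum_3 vec_lambda_beta vector_3 inner_real_def
    by (simp only: right_diff_distrib) simp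
  have "(LINT x|lebesgue. grad \<phi> x \<bullet> curl \<psi> x) = (LINT x|lborel. grad \<phi> x \<bullet> curl \<psi> x)"
    unfolding eq
    by (intro integral_completion borel_measurable_add borel_measurable_diff)
       (use c in \<open>auto intro!: borel_measurable_continuous_onI\<close>)
  also have "\<dots> = 0"
    unfolding eq using i a[of 1 2 3] a[of 2 3 1] a[of 3 1 2] by simp
  finally show ?thesis .
qed

lemma to_L2_in_L2_on:
  assumes "square_integrable f" "\<And>x. x \<notin> D \<Longrightarrow> f x = 0"
  shows "to_L2 f \<in> L2_on D"
  using fn_L2_to_L2[OF assms(1)] assms(2) by (auto simp: L2_on_def elim!: eventually_mono)

lemma zero_in_L2_on: "0 \<in> L2_on D"
  unfolding L2_on_def using fn_L2_zero by (auto elim!: eventually_mono)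

lemma set_integral_fn_L2_zero: "(LINT x:D|lebesgue. fn_L2 (0 :: (r3, 'b::euclidean_space) L2) x \<bullet> f x) = 0"
proof -
  have "AE x in lebesgue. indicator D x *\<^sub>R (fn_L2 (0 :: (r3, 'b::euclidean_space) L2) x \<bullet> f x) = 0"
    using fn_L2_zero[where 'a = r3 and 'b = 'b] by eventually_elim simp
  then show ?thesis unfolding set_lebesgue_integral_def by (rule integral_eq_zero_AE)
qed

lemma curl_measurable:
  assumes "\<psi> \<in> smooth_field"
  shows "curl \<psi> \<in> borel_measurable lebesgue"
proof -
  have c: "continuous_on UNIV (partial i (\<lambda>y. \<psi> y $ j))" for i j
    using assms by (intro smooth_continuous smooth_partial) (simp add: smooth_field_def)
  have "continuous_on UNIV (\<lambda>x. curl \<psi> x $ k)" for k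
    using exhaust_3[of k] continuous_on_diff[OF c c] by (auto simp: curl_def)
  then have "continuous_on UNIV (curl \<psi>)"
    using continuous_on_vec_lambda[of UNIV "\<lambda>k x. curl \<psi> x $ k"] by simp
  then show ?thesis by (simp add: borel_measurable_continuous_onI measurable_completion)
qed

lemma set_integral_grad_curl:
  assumes D: "open D" and \<phi>: "\<phi> \<in> test_fun D" and \<psi>: "\<psi> \<in> smooth_field"
  shows "(LINT x:D|lebesgue. fn_L2 (to_L2 (grad \<phi>)) x \<bullet> curl \<psi> x) = 0"
proof -
  have [measurable]: "D \<in> sets lebesgue" using D by auto
  note [measurable] = curl_measurable[OF \<psi>] grad_measurable[OF test_fun_smooth[OF \<phi>]]
  have "(LINT x:D|lebesgue. fn_L2 (to_L2 (grad \<phi>)) x \<bullet> curl \<psi> x) = (LINT x|lebesgue. grad \<phi> x \<bullet> curl \<psi> x)"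
    unfolding set_lebesgue_integral_def
  proof (intro integral_cong_AE, measurable)
    show "AE x in lebesgue. indicator D x *\<^sub>R (fn_L2 (to_L2 (grad \<phi>)) x \<bullet> curl \<psi> x) = grad \<phi> x \<bullet> curl \<psi> x"
      using fn_L2_to_L2[OF square_integrable_grad[OF \<phi>]]
      by eventually_elim (use test_fun_grad_outside[OF \<phi>] in \<open>auto simp: indicator_def\<close>)
  qed
  then show ?thesis using integral_grad_inner_curl[OF \<phi> \<psi>] by simp
qed

text \<open>For the candidate curl 0 both claims are the same identity, tested on
  \<open>test_field\<close> and on \<open>smooth_field\<close>. The second one places the gradient
  in \<open>H0_curl\<close>, the electric factor of the Maxwell domain.\<close>

lemma weak_curl_grad:
  assumes D: "open D" and \<phi>: "\<phi> \<in> test_fun D"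
  shows "weak_curl D (to_L2 (grad \<phi>)) 0"
    and "\<psi> \<in> smooth_field \<Longrightarrow> tangential_trace D (to_L2 (grad \<phi>)) 0 \<psi> = 0"
proof -
  have "test_field D \<subseteq> smooth_field" by (auto simp: test_field_def smooth_field_def test_fun_def)
  then show "weak_curl D (to_L2 (grad \<phi>)) 0"
    unfolding weak_curl_def
    using set_integral_grad_curl[OF D \<phi>] square_integrable_grad[OF \<phi>] test_fun_grad_outside[OF \<phi>]
    by (auto simp: set_integral_fn_L2_zero zero_in_L2_on to_L2_in_L2_on)
  show "tangential_trace D (to_L2 (grad \<phi>)) 0 \<psi> = 0" if "\<psi> \<in> smooth_field"
    unfolding tangential_trace_def using set_integral_grad_curl[OF D \<phi> that] by (simp add: set_integral_fn_L2_zero)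
qed

lemma weak_curl_zero: "weak_curl D 0 0"
  by (simp add: weak_curl_def zero_in_L2_on set_integral_fn_L2_zero)

lemma maxwell_kernel:
  assumes D: "open D" and \<phi>: "\<phi> \<in> test_fun D"
  shows "((to_L2 (grad \<phi>), 0), 0) \<in> maxwell D \<epsilon> \<mu>" (is ?C1) and "((0, to_L2 (grad \<phi>)), 0) \<in> maxwell D \<epsilon> \<mu>" (is ?C2)
proof -
  note g = weak_curl_grad[OF D \<phi>]
  have z: "tangential_trace D 0 0 \<psi> = 0" for \<psi>
    by (simp add: tangential_trace_def set_integral_fn_L2_zero)
  have AE0: "AE x in lebesgue. x \<in> D \<longrightarrow> fn_L2 (0::(r3, r3) L2) x = a x *\<^sub>R fn_L2 (0::(r3, r3) L2) x \<and>
     fn_L2 (0::(r3, r3) L2) x = - (b x *\<^sub>R fn_L2 (0::(r3, r3) L2) x)" for a b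
    using fn_L2_zero[where 'a = r3 and 'b = r3] by eventually_elim simp
  have "(0, 0) \<in> state_space D" by (simp add: state_space_def zero_in_L2_on)
  then show ?C1 ?C2
    using g weak_curl_zero z AE0
    by (auto simp: maxwell_def maxwell_domain_def H0_curl_def H_curl_def zero_prod_def intro!: exI[of _ 0])
qed

text \<open>The derivative of the orbit of w at time s is S s applied to its derivative at 0, hence
  zero, and the orbit is constant. The bound by K is in the norm of the type, in which the generator
  takes its limit, whereas \<open>ip\<close> may be a different inner product.\<close>

lemma unitary_group_fixes_kernel:
  fixes S :: "real \<Rightarrow> 'a::real_normed_vector \<Rightarrow> 'a"
  assumes S: "unitary_group_on H ip S" and H: "subspace H"
    and bdd: "\<And>t v. v \<in> H \<Longrightarrow> norm (S t v) \<le> K * norm v"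
    and w: "(w, 0) \<in> generator H S"
  shows "S t w = w"
proof -
  have wH: "w \<in> H" and lim: "((\<lambda>h. (1 / h) *\<^sub>R (S h w - w)) \<longlongrightarrow> 0) (at 0)"
    using w by (auto simp: generator_def)
  have lin: "linear_operator_on H H (S s)" and add: "v \<in> H \<Longrightarrow> S (s + r) v = S s (S r v)" for s r v
    using S by (auto simp: unitary_group_on_def)
  have mem: "v \<in> H \<Longrightarrow> S s v \<in> H" for s v using lin by (auto simp: linear_operator_on_def)
  have diff: "S s (u - v) = S s u - S s v" if "u \<in> H" "v \<in> H" for s u v
  proof -
    have "S s (u + (- 1) *\<^sub>R v) = S s u + (- 1) *\<^sub>R S s v"
      using lin[of s] that H by (metis linear_operator_on_def subspace_scale)
    then show ?thesis by simp
  qed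
  have scale: "S s (c *\<^sub>R u) = c *\<^sub>R S s u" if "u \<in> H" for s u c
    using lin[of s] that by (auto simp: linear_operator_on_def)
  have "((\<lambda>t. S t w) has_vector_derivative 0) (at s)" for s
  proof -
    have "((\<lambda>h. norm (S (s + h) w - S s w - h *\<^sub>R 0) / norm h) \<longlongrightarrow> 0) (at 0)"
    proof (rule Lim_null_comparison)
      show "\<forall>\<^sub>F h in at 0. norm (norm (S (s + h) w - S s w - h *\<^sub>R 0) / norm h) \<le> K * norm ((1 / h) *\<^sub>R (S h w - w))"
      proof (rule eventuallyI)
        fix h
        have "S (s + h) w - S s w = S s (S h w - w)" using wH mem by (simp add: diff add)
        then have "(1 / h) *\<^sub>R (S (s + h) w - S s w) = S s ((1 / h) *\<^sub>R (S h w - w))"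
          using wH mem H by (simp add: scale subspace_diff)
        then have "norm ((1 / h) *\<^sub>R (S (s + h) w - S s w)) \<le> K * norm ((1 / h) *\<^sub>R (S h w - w))"
          using bdd wH mem H by (simp add: subspace_diff subspace_scale del: norm_scaleR)
        then show "norm (norm (S (s + h) w - S s w - h *\<^sub>R 0) / norm h) \<le> K * norm ((1 / h) *\<^sub>R (S h w - w))"
          by simp
      qed
      show "((\<lambda>h. K * norm ((1 / h) *\<^sub>R (S h w - w))) \<longlongrightarrow> 0) (at 0)"
        using tendsto_mult_right_zero[OF tendsto_norm_zero[OF lim]] .
    qed
    then show ?thesis
      unfolding has_vector_derivative_def has_derivative_at by (simp add: bounded_linear_scaleR_left bounded_linear_zero)
  qed
  then obtain c where "\<And>s. S s w = c"
    using has_vector_derivative_zero_constant[of UNIV "\<lambda>t. S t w"] by auto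
  then have "S t w = S 0 w" by metis
  then show ?thesis using S wH by (simp add: unitary_group_on_def)
qed

section \<open>Moments of the Wiener process\<close>

text \<open>Operators are linear and bounded only on the closed span U, not on the ambient type.
  They are reached through the finite projections \<open>proj\<close>, whose values stay in
  U.\<close>

locale orthonormal_closed_span =
  fixes U :: "'a::real_inner set" and e :: "nat \<Rightarrow> 'a"
  assumes onb: "orthonormal_basis U e"
begin

definition proj :: "nat \<Rightarrow> 'a \<Rightarrow> 'a"
  where "proj n x = (\<Sum>k<n. (x \<bullet> e k) *\<^sub>R e k)"

lemma inner_e: "e i \<bullet> e j = (if i = j then 1 else 0)"
  using onb by (simp add: orthonormal_basis_def)

lemma U_eq: "U = closure (span (range e))"
  using onb by (simp add: orthonormal_basis_def)

lemma subspace_U: "subspace U"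
  unfolding U_eq by (rule subspace_closure_span)

lemma e_in_U: "e k \<in> U"
  unfolding U_eq by (rule subsetD[OF closure_subset]) (simp add: span_base)

lemma proj_in_U: "proj n x \<in> U"
  unfolding proj_def by (intro subspace_sum subspace_scale subspace_U e_in_U)

lemma inner_proj_e: "proj n x \<bullet> e k = (if k < n then x \<bullet> e k else 0)"
  unfolding proj_def by (simp add: inner_sum_left inner_e if_distrib sum.delta cong: if_cong)

lemma inner_proj: "proj n x \<bullet> y = (\<Sum>k<n. (x \<bullet> e k) * (y \<bullet> e k))"
  unfolding proj_def inner_sum_left by (intro sum.cong) (simp_all add: inner_commute)

lemma inner_proj_self: "proj n x \<bullet> proj n x = proj n x \<bullet> x"
  unfolding inner_proj[of n x "proj n x"] inner_proj[of n x x] by (intro sum.cong refl) (simp add: inner_proj_e)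

lemma norm_proj_le: "norm (proj n x) \<le> norm x"
proof -
  have "(norm (proj n x))\<^sup>2 \<le> norm (proj n x) * norm x"
    unfolding power2_norm_eq_inner inner_proj_self by (rule norm_cauchy_schwarz)
  then show ?thesis unfolding power2_eq_square by (cases "norm (proj n x) = 0") auto
qed

lemma proj_add: "proj n (x + y) = proj n x + proj n y"
  unfolding proj_def by (simp add: inner_add_left scaleR_add_left sum.distrib)

lemma proj_diff: "proj n (x - y) = proj n x - proj n y"
  unfolding proj_def by (simp add: inner_diff_left scaleR_diff_left sum_subtractf)

lemma proj_scaleR: "proj n (c *\<^sub>R x) = c *\<^sub>R proj n x"
  unfolding proj_def by (simp add: scaleR_sum_right)

lemma proj_e: "k < n \<Longrightarrow> proj n (e k) = e k"
  unfolding proj_def by (simp add: inner_e if_distrib[where f = "\<lambda>c. c *\<^sub>R _"] sum.delta cong: if_cong)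

lemma proj_span_eventually:
  assumes "x \<in> span (range e)"
  shows "\<forall>\<^sub>F n in sequentially. proj n x = x"
  using assms
proof (induction rule: span_induct_alt)
  case base
  show ?case by (simp add: proj_def)
next
  case (step c v y)
  then obtain k where v: "v = e k" by auto
  show ?case using step.IH eventually_gt_at_top[of k]
    by eventually_elim (simp add: proj_add proj_scaleR proj_e v)
qed

text \<open>On the span the projections are eventually the identity; being contractions, they
  converge on its closure.\<close>

lemma proj_tendsto:
  assumes "x \<in> U"
  shows "(\<lambda>n. proj n x) \<longlonglongrightarrow> x"
proof (rule tendstoI)
  fix r :: real assume "r > 0"
  then obtain y where y: "y \<in> span (range e)" "dist y x < r / 2"
    using assms unfolding U_eq closure_approachable by (meson half_gt_zero)
  show "\<forall>\<^sub>F n in sequentially. dist (proj n x) x < r"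
    using proj_span_eventually[OF y(1)]
  proof eventually_elim
    case (elim n)
    have "proj n x - x = proj n (x - y) + (y - x)" using elim by (simp add: proj_diff)
    then have "norm (proj n x - x) \<le> norm (proj n (x - y)) + norm (y - x)" by (simp only: norm_triangle_ineq)
    also have "\<dots> < r" using norm_proj_le[of n "x - y"] y(2) by (simp add: dist_norm norm_minus_commute)
    finally show ?case by (simp add: dist_norm)
  qed
qed

lemma parseval:
  assumes "x \<in> U"
  shows "(\<lambda>k. (x \<bullet> e k) * (y \<bullet> e k)) sums (x \<bullet> y)"
  using tendsto_inner[OF proj_tendsto[OF assms] tendsto_const[of y]] by (simp add: sums_def inner_proj)

text \<open>Turns an operator applied to a projected increment into a finite sum over scalar
  coordinates, the form in which measurability, independence and Gaussian moments are
  available.\<close>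

lemma linear_on_proj:
  assumes "linear_operator_on U V \<Lambda>"
  shows "\<Lambda> (proj n x) = (\<Sum>k<n. (x \<bullet> e k) *\<^sub>R \<Lambda> (e k))"
proof (induction n)
  case 0
  have "\<Lambda> (0 *\<^sub>R e 0) = 0 *\<^sub>R \<Lambda> (e 0)"
    using assms e_in_U[of 0] unfolding linear_operator_on_def by blast
  then show ?case by (simp add: proj_def)
next
  case (Suc n)
  have "\<Lambda> (proj (Suc n) x) = \<Lambda> (proj n x + (x \<bullet> e n) *\<^sub>R e n)" by (simp add: proj_def)
  also have "\<dots> = \<Lambda> (proj n x) + \<Lambda> ((x \<bullet> e n) *\<^sub>R e n)"
    using assms proj_in_U[of n x] subspace_scale[OF subspace_U e_in_U[of n]] unfolding linear_operator_on_def by blast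
  also have "\<Lambda> ((x \<bullet> e n) *\<^sub>R e n) = (x \<bullet> e n) *\<^sub>R \<Lambda> (e n)"
    using assms e_in_U[of n] unfolding linear_operator_on_def by blast
  finally show ?case by (simp add: Suc.IH)
qed

lemma linear_on_diff:
  assumes "linear_operator_on U V \<Lambda>" "x \<in> U" "y \<in> U"
  shows "\<Lambda> (x - y) = \<Lambda> x - \<Lambda> y"
proof -
  have "\<Lambda> (x + (-1) *\<^sub>R y) = \<Lambda> x + (-1) *\<^sub>R \<Lambda> y"
    using assms subspace_scale[OF subspace_U assms(3)] unfolding linear_operator_on_def by metis
  then show ?thesis by simp
qed

lemma bounded_operator_proj_tendsto:
  fixes \<Lambda> :: "'a \<Rightarrow> 'b::real_normed_vector"
  assumes \<Lambda>: "bounded_operator_on U V \<Lambda>" and x: "x \<in> U"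
  shows "(\<lambda>n. \<Lambda> (proj n x)) \<longlonglongrightarrow> \<Lambda> x"
proof -
  obtain K where K: "\<And>v. v \<in> U \<Longrightarrow> norm (\<Lambda> v) \<le> K * norm v" and lin: "linear_operator_on U V \<Lambda>"
    using \<Lambda> by (auto simp: bounded_operator_on_def)
  show ?thesis
  proof (rule LIM_zero_cancel, rule Lim_null_comparison)
    show "\<forall>\<^sub>F n in sequentially. norm (\<Lambda> (proj n x) - \<Lambda> x) \<le> K * norm (proj n x - x)"
      using K subspace_diff[OF subspace_U proj_in_U x]
      by (auto simp: linear_on_diff[OF lin proj_in_U x, symmetric])
    show "(\<lambda>n. K * norm (proj n x - x)) \<longlonglongrightarrow> 0"
      using tendsto_mult_right_zero[OF tendsto_norm_zero[OF LIM_zero[OF proj_tendsto[OF x]]]] .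
  qed
qed

end

section \<open>Increments of the Wiener process: law, independence and second moments\<close>

locale wiener_basis = orthonormal_closed_span U e
  for U :: "'a::{real_inner, second_countable_topology} set" and e +
  fixes P :: "'w measure" and F :: "real \<Rightarrow> 'w measure" and T :: real
    and Q R :: "'a \<Rightarrow> 'a" and W :: "real \<Rightarrow> 'w \<Rightarrow> 'a"
  assumes basis: "filtered_prob_space P F T"
    and cov: "covariance_operator U e Q"
    and sqrt: "positive_sqrt U Q R"
    and wiener: "wiener_process P F T U Q W"
begin

lemma prob: "prob_space P" using basis by (simp add: filtered_prob_space_def)

sublocale prob_space P by (rule prob)

lemma subalgebra: "0 \<le> t \<Longrightarrow> t \<le> T \<Longrightarrow> subalgebra P (F t)"
  using basis by (simp add: filtered_prob_space_def)

lemma space_F: "0 \<le> t \<Longrightarrow> t \<le> T \<Longrightarrow> space (F t) = space P"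
  using subalgebra by (simp add: subalgebra_def)

lemma sets_F_subset: "0 \<le> t \<Longrightarrow> t \<le> T \<Longrightarrow> A \<in> sets (F t) \<Longrightarrow> A \<in> sets P"
  using subalgebra by (auto simp: subalgebra_def)

lemma sets_F_mono: "0 \<le> s \<Longrightarrow> s \<le> t \<Longrightarrow> t \<le> T \<Longrightarrow> A \<in> sets (F s) \<Longrightarrow> A \<in> sets (F t)"
  using basis by (auto simp: filtered_prob_space_def)

lemma measurable_F_mono:
  assumes "0 \<le> s" "s \<le> t" "t \<le> T" "f \<in> measurable (F s) M"
  shows "f \<in> measurable (F t) M"
  by (rule measurable_from_subalg[OF _ assms(4)])
     (use assms in \<open>auto simp: subalgebra_def space_F dest: sets_F_mono\<close>)

lemma measurable_F_P: "0 \<le> t \<Longrightarrow> t \<le> T \<Longrightarrow> f \<in> measurable (F t) M \<Longrightarrow> f \<in> measurable P M"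
  using subalgebra by (rule measurable_from_subalg)

lemma W_measurable_F: "0 \<le> s \<Longrightarrow> s \<le> t \<Longrightarrow> t \<le> T \<Longrightarrow> W s \<in> borel_measurable (F t)"
  using wiener by (auto intro!: measurable_F_mono[of s t] simp: wiener_process_def)

lemma W_measurable: "0 \<le> t \<Longrightarrow> t \<le> T \<Longrightarrow> W t \<in> borel_measurable P"
  using W_measurable_F measurable_F_P by blast

definition inc :: "real \<Rightarrow> real \<Rightarrow> 'w \<Rightarrow> 'a"
  where "inc s t \<omega> = W t \<omega> - W s \<omega>"

lemma inc_self [simp]: "inc s s = (\<lambda>_. 0)"
  by (simp add: inc_def fun_eq_iff)

lemma inc_split: "inc s t \<omega> = inc s r \<omega> + inc r t \<omega>"
  by (simp add: inc_def)

lemma inc_in_U: "0 \<le> s \<Longrightarrow> s \<le> T \<Longrightarrow> 0 \<le> t \<Longrightarrow> t \<le> T \<Longrightarrow> \<omega> \<in> space P \<Longrightarrow> inc s t \<omega> \<in> U"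
  using wiener unfolding inc_def by (intro subspace_diff[OF subspace_U]) (auto simp: wiener_process_def)

lemma inc_measurable_F: "0 \<le> s \<Longrightarrow> s \<le> t \<Longrightarrow> t \<le> r \<Longrightarrow> r \<le> T \<Longrightarrow> inc s t \<in> borel_measurable (F r)"
  unfolding inc_def by (intro borel_measurable_diff W_measurable_F) auto

lemma inc_measurable: "0 \<le> s \<Longrightarrow> s \<le> t \<Longrightarrow> t \<le> T \<Longrightarrow> inc s t \<in> borel_measurable P"
  unfolding inc_def by (intro borel_measurable_diff W_measurable) auto

lemma Q_sym: "u \<in> U \<Longrightarrow> v \<in> U \<Longrightarrow> Q u \<bullet> v = Q v \<bullet> u"
  using cov by (auto simp: covariance_operator_def inner_commute)

lemma Q_linear: "linear_operator_on U U Q"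
  using cov by (simp add: covariance_operator_def bounded_operator_on_def)

lemma Q_zero: "Q 0 = 0"
  using linear_on_diff[OF Q_linear, of 0 0] subspace_U by (simp add: subspace_0)

lemma inc_gaussian:
  assumes "0 \<le> s" "s \<le> t" "t \<le> T" "v \<in> U"
  shows "integrable P (\<lambda>\<omega>. inc s t \<omega> \<bullet> v)" (is ?C1) "(LINT \<omega>|P. inc s t \<omega> \<bullet> v) = 0" (is ?C2)
    "integrable P (\<lambda>\<omega>. (inc s t \<omega> \<bullet> v)\<^sup>2)" (is ?C3) "(LINT \<omega>|P. (inc s t \<omega> \<bullet> v)\<^sup>2) = (t - s) * (Q v \<bullet> v)" (is ?C4)
proof -
  have "?C1 \<and> ?C2 \<and>
    ?C3 \<and> ?C4"
  proof (cases "s = t \<or> v = 0")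
    \<comment> \<open>\<open>wiener_process\<close> prescribes a density only for s < t and v
      \<noteq> 0. The degenerate law has none, but there the scalar increment is identically
      0.\<close>
    case True
    then show ?thesis by (auto simp: Q_zero)
  next
    case False
    define \<sigma> where "\<sigma> = sqrt ((t - s) * (Q v \<bullet> v))"
    have pos: "0 < (t - s) * (Q v \<bullet> v)"
      using False assms cov by (intro mult_pos_pos) (auto simp: covariance_operator_def)
    then have \<sigma>: "0 < \<sigma>" "\<sigma>\<^sup>2 = (t - s) * (Q v \<bullet> v)" by (auto simp: \<sigma>_def)
    have D: "distributed P lborel (\<lambda>\<omega>. inc s t \<omega> \<bullet> v) (\<lambda>x. ennreal (normal_density 0 \<sigma> x))"
      using wiener assms False unfolding wiener_process_def inc_def \<sigma>_def by auto
    have 1: ?C1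
      by (rule distributed_integrable_var[OF D normal_density_nonneg integrable_normal_moment_nz_1[OF \<sigma>(1)]])
    have 2: ?C2
      by (rule normal_distributed_expectation[OF \<sigma>(1) D])
    have "integrable lborel (\<lambda>x. normal_density 0 \<sigma> x * x\<^sup>2)"
      using integrable_normal_moment[OF \<sigma>(1), of 0 2] by simp
    then have 3: ?C3
      using distributed_integrable[OF D, of "\<lambda>x. x\<^sup>2"] by (simp add: normal_density_nonneg)
    have 4: ?C4
      using normal_distributed_variance[OF \<sigma>(1) D] 2 \<sigma>(2) by simp
    show ?thesis using 1 2 3 4 by blast
  qed
  then show ?C1 ?C2
    ?C3 ?C4
    by auto
qed

text \<open>Polarisation of the variance, with the symmetry of Q for the mixed term.\<close>

lemma inc_covariance:
  assumes "0 \<le> s" "s \<le> t" "t \<le> T" "v \<in> U" "w \<in> U"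
  shows "integrable P (\<lambda>\<omega>. (inc s t \<omega> \<bullet> v) * (inc s t \<omega> \<bullet> w))" (is ?C1)
    "(LINT \<omega>|P. (inc s t \<omega> \<bullet> v) * (inc s t \<omega> \<bullet> w)) = (t - s) * (Q v \<bullet> w)" (is ?C2)
proof -
  have vw: "v + w \<in> U" using assms subspace_U by (simp add: subspace_add)
  have eq: "(\<lambda>\<omega>. (inc s t \<omega> \<bullet> v) * (inc s t \<omega> \<bullet> w)) =
    (\<lambda>\<omega>. ((inc s t \<omega> \<bullet> (v + w))\<^sup>2 - (inc s t \<omega> \<bullet> v)\<^sup>2 - (inc s t \<omega> \<bullet> w)\<^sup>2) / 2)"
    by (simp add: fun_eq_iff inner_add_right power2_eq_square algebra_simps)
  note g = inc_gaussian(3,4)[OF assms(1-3)]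
  show ?C1
    unfolding eq using g(1)[OF vw] g(1)[OF assms(4)] g(1)[OF assms(5)] by simp
  have "Q (v + w) = Q v + Q w" using Q_linear assms by (auto simp: linear_operator_on_def)
  then have "Q (v + w) \<bullet> (v + w) = Q v \<bullet> v + Q w \<bullet> w + 2 * (Q v \<bullet> w)"
    using Q_sym[OF assms(4,5)] by (simp add: inner_add_left inner_add_right)
  then show ?C2
    unfolding eq using g(1)[OF vw] g(1)[OF assms(4)] g(1)[OF assms(5)]
    by (simp add: g(2)[OF vw] g(2)[OF assms(4)] g(2)[OF assms(5)] field_simps del: inner_add_right)
qed

text \<open>By Parseval the second moment is t - s times the trace of Q, which
  \<open>covariance_operator\<close> makes finite.\<close>

lemma norm_inc_square_integrable:
  assumes "0 \<le> s" "s \<le> t" "t \<le> T"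
  shows "integrable P (\<lambda>\<omega>. (norm (inc s t \<omega>))\<^sup>2)"
proof (rule integrableI_nonneg)
  note [measurable] = inc_measurable[OF assms]
  show "(\<lambda>\<omega>. (norm (inc s t \<omega>))\<^sup>2) \<in> borel_measurable P" by measurable
  have "(\<integral>\<^sup>+\<omega>. ennreal ((norm (inc s t \<omega>))\<^sup>2) \<partial>P) = (\<integral>\<^sup>+\<omega>. (\<Sum>k. ennreal ((inc s t \<omega> \<bullet> e k)\<^sup>2)) \<partial>P)"
  proof (rule nn_integral_cong)
    fix \<omega> assume "\<omega> \<in> space P"
    then have "inc s t \<omega> \<in> U" using assms by (intro inc_in_U) auto
    then have "(\<lambda>k. (inc s t \<omega> \<bullet> e k)\<^sup>2) sums (norm (inc s t \<omega>))\<^sup>2"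
      using parseval[of "inc s t \<omega>" "inc s t \<omega>"] by (simp only: power2_norm_eq_inner) (simp only: power2_eq_square)
    then show "ennreal ((norm (inc s t \<omega>))\<^sup>2) = (\<Sum>k. ennreal ((inc s t \<omega> \<bullet> e k)\<^sup>2))"
      by (subst suminf_ennreal2) (auto simp: sums_iff)
  qed
  also have "\<dots> = (\<Sum>k. \<integral>\<^sup>+\<omega>. ennreal ((inc s t \<omega> \<bullet> e k)\<^sup>2) \<partial>P)"
    by (rule nn_integral_suminf) measurable
  also have "\<dots> = (\<Sum>k. ennreal ((t - s) * (Q (e k) \<bullet> e k)))"
    using inc_gaussian[OF assms e_in_U] by (subst nn_integral_eq_integral) auto
  also have "\<dots> < \<infinity>"
  proof -
    have "0 \<le> (t - s) * (Q (e k) \<bullet> e k)" for k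
      unfolding inc_gaussian(4)[OF assms e_in_U, of k, symmetric] by simp
    then show ?thesis
      using cov by (subst suminf_ennreal2) (auto simp: covariance_operator_def intro: summable_mult)
  qed
  finally show "(\<integral>\<^sup>+\<omega>. ennreal ((norm (inc s t \<omega>))\<^sup>2) \<partial>P) < \<infinity>" .
qed simp

text \<open>Independence is given between \<open>F s\<close> and the sigma-algebra of the vector
  increment; that of h of the increment is contained in the latter. A nonlinear h is used for
  products of two coordinates.\<close>

lemma inc_indep:
  assumes st: "0 \<le> s" "s < t" "t \<le> T" and Y: "Y \<in> borel_measurable (F s)" and h: "h \<in> borel_measurable borel"
  shows "indep_var borel (Y :: 'w \<Rightarrow> real) borel (\<lambda>\<omega>. h (inc s t \<omega>) :: real)"
proof -
  let ?h = "\<lambda>\<omega>. h (inc s t \<omega>)"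
  let ?V = "vimage_algebra (space P) (inc s t) borel"
  let ?Y = "{Y -` A \<inter> space P |A. A \<in> sets borel}"
  let ?H = "{(\<lambda>\<omega>. h (inc s t \<omega>)) -` A \<inter> space P |A. A \<in> sets borel}"
  have ind: "indep_set (sets (F s)) (sets ?V)"
    using wiener st unfolding wiener_process_def inc_def by auto
  have [measurable]: "Y \<in> borel_measurable P" using st by (intro measurable_F_P[OF _ _ Y]) auto
  have [measurable]: "inc s t \<in> borel_measurable P" using inc_measurable st by auto
  note [measurable] = h
  have sp: "space (F s) = space P" using space_F st by auto
  have 1: "sigma_sets (space P) ?Y \<subseteq> sets (F s)"
    using Y sp by (intro sets.sigma_sets_subset'[of _ "F s", unfolded sp]) (auto dest: measurable_sets)
  have 2: "sigma_sets (space P) ?H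
      \<subseteq> sets ?V"
  proof -
    have "?h -` A \<inter> space P \<in> sets ?V"
      if "A \<in> sets borel" for A
    proof -
      have "?h -` A \<inter> space P = inc s t -` (h -` A) \<inter> space P" by auto
      moreover have "h -` A \<in> sets borel" using measurable_sets[OF h that] by simp
      ultimately show ?thesis by (auto intro!: in_vimage_algebra)
    qed
    then have "?H
        \<subseteq> sets ?V" by auto
    from sets.sigma_sets_subset[OF this] show ?thesis by simp
  qed
  show ?thesis
    unfolding indep_var_eq
  proof (intro conjI)
    show "indep_set (sigma_sets (space P) ?Y)
      (sigma_sets (space P) ?H)"
      unfolding indep_sets2_eq
    proof (intro conjI ballI)
      note i = ind[unfolded indep_sets2_eq]
      show "sigma_sets (space P) ?Y \<subseteq> events"
        using 1 i by (meson subset_trans)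
      show "sigma_sets (space P) ?H \<subseteq> events"
        using 2 i by (meson subset_trans)
      fix a b
      assume "a \<in> sigma_sets (space P) ?Y"
        "b \<in> sigma_sets (space P) ?H"
      from subsetD[OF 1 this(1)] subsetD[OF 2 this(2)] show "prob (a \<inter> b) = prob a * prob b"
        using i by blast
    qed
  qed measurable
qed

text \<open>The martingale property in product form: an integrable weight from the past factors out
  of the mean, and the increment is centred. All contributions from disjoint time intervals vanish
  through this.\<close>

lemma mult_inc_mean_zero:
  assumes st: "0 \<le> s" "s \<le> t" "t \<le> T" and Y: "Y \<in> borel_measurable (F s)" "integrable P Y" and v: "v \<in> U"
  shows "integrable P (\<lambda>\<omega>. Y \<omega> * (inc s t \<omega> \<bullet> v))" (is ?C1) "(LINT \<omega>|P. Y \<omega> * (inc s t \<omega> \<bullet> v)) = 0" (is ?C2)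
proof -
  have "?C1 \<and> ?C2"
  proof (cases "s = t")
    case False
    then have "indep_var borel Y borel (\<lambda>\<omega>. inc s t \<omega> \<bullet> v)"
      using st by (intro inc_indep Y) auto
    then show ?thesis
      using indep_var_integrable[OF _ Y(2) inc_gaussian(1)[OF st v]]
        indep_var_lebesgue_integral[OF _ Y(2) inc_gaussian(1)[OF st v]] inc_gaussian(2)[OF st v] by simp
  qed simp
  then show ?C1 ?C2 by auto
qed

lemma indicator_inc_covariance:
  assumes st: "0 \<le> s" "s \<le> t" "t \<le> T" and A: "A \<in> sets (F s)" and vw: "v \<in> U" "w \<in> U"
  shows "integrable P (\<lambda>\<omega>. indicator A \<omega> * ((inc s t \<omega> \<bullet> v) * (inc s t \<omega> \<bullet> w)))" (is ?C1)
    "(LINT \<omega>|P. indicator A \<omega> * ((inc s t \<omega> \<bullet> v) * (inc s t \<omega> \<bullet> w))) = prob A * ((t - s) * (Q v \<bullet> w))" (is ?C2)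
proof -
  have "?C1 \<and>
    ?C2"
  proof (cases "s = t")
    case False
    have A': "A \<in> sets P" using A sets_F_subset st by auto
    have ind: "indep_var borel (indicator A :: _ \<Rightarrow> real) borel (\<lambda>\<omega>. (inc s t \<omega> \<bullet> v) * (inc s t \<omega> \<bullet> w))"
      using st False A by (intro inc_indep[where h = "\<lambda>x. (x \<bullet> v) * (x \<bullet> w)"]) auto
    have int: "integrable P (indicator A :: _ \<Rightarrow> real)" using A' by (simp add: integrable_real_indicator less_top[symmetric])
    show ?thesis
      using indep_var_integrable[OF ind int inc_covariance(1)[OF st vw]]
        indep_var_lebesgue_integral[OF ind int inc_covariance(1)[OF st vw]] inc_covariance(2)[OF st vw] A'
      by simp
  qed simp
  then show ?C1
    ?C2 by auto
qed

end

section \<open>The Ito isometry\<close>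

text \<open>Here f may be nonmeasurable. The integral is then a supremum over simple minorants and
  not subadditive in general, but a finite measurable summand h can still be split off: if g is a
  simple minorant of the sum, then (g - h) / c is a measurable minorant of f. Errors of Ito
  approximations are bounded in this way without a separate proof of measurability.\<close>

lemma nn_integral_cmult_add_le:
  fixes f h :: "'a \<Rightarrow> ennreal"
  assumes [measurable]: "h \<in> borel_measurable M" and h: "\<And>x. h x \<noteq> \<top>" and c: "0 < c"
  shows "(\<integral>\<^sup>+x. ennreal c * f x + h x \<partial>M) \<le> ennreal c * (\<integral>\<^sup>+x. f x \<partial>M) + (\<integral>\<^sup>+x. h x \<partial>M)"
proof -
  let ?f = "\<integral>\<^sup>+x. f x \<partial>M"
  let ?h = "\<integral>\<^sup>+x. h x \<partial>M"
  have "(\<integral>\<^sup>+x. ennreal c * f x + h x \<partial>M) = (SUP g \<in> {g. simple_function M g \<and> g \<le> (\<lambda>x. ennreal c * f x + h x)}. integral\<^sup>S M g)"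
    by (rule nn_integral_def)
  also have "\<dots> \<le> ennreal c * ?f + ?h"
  proof (rule SUP_least)
    fix g assume g: "g \<in> {g. simple_function M g \<and> g \<le> (\<lambda>x. ennreal c * f x + h x)}"
    then have [measurable]: "g \<in> borel_measurable M" by (auto intro: borel_measurable_simple_function)
    define d where "d x = ennreal (1 / c) * (g x - h x)" for x
    have [measurable]: "d \<in> borel_measurable M" unfolding d_def by measurable
    have cc: "ennreal c * ennreal (1 / c) = 1" using c by (simp flip: ennreal_mult)
    have "d x \<le> f x" for x
    proof -
      have "g x - h x \<le> ennreal c * f x" using g h[of x] by (auto simp: le_fun_def ennreal_minus_le_iff add.commute)
      then have "d x \<le> ennreal (1 / c) * (ennreal c * f x)" unfolding d_def by (rule mult_left_mono) simp
      then show ?thesis using cc by (simp add: mult.assoc[symmetric] mult.commute)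
    qed
    moreover have "g x \<le> ennreal c * d x + h x" for x
    proof -
      have "ennreal c * d x = g x - h x" unfolding d_def using cc by (simp add: mult.assoc[symmetric])
      then show ?thesis using h[of x] by (metis add.commute ennreal_minus_le_iff order_refl)
    qed
    ultimately have "integral\<^sup>S M g \<le> (\<integral>\<^sup>+x. ennreal c * d x + h x \<partial>M)" "(\<integral>\<^sup>+x. d x \<partial>M) \<le> ?f"
      using g by (auto simp: nn_integral_eq_simple_integral[symmetric] intro!: nn_integral_mono)
    note this(1)
    also have "(\<integral>\<^sup>+x. ennreal c * d x + h x \<partial>M) = ennreal c * (\<integral>\<^sup>+x. d x \<partial>M) + ?h"
      by (simp add: nn_integral_add nn_integral_cmult)
    also have "\<dots> \<le> ennreal c * ?f + ?h"
      using \<open>(\<integral>\<^sup>+x. d x \<partial>M) \<le> ?f\<close> by (intro add_mono mult_left_mono) auto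
    finally show "integral\<^sup>S M g \<le> ennreal c * ?f + ?h" .
  qed
  finally show ?thesis .
qed

lemma norm_add_square_le: "(norm (x + y :: 'a::real_normed_vector))\<^sup>2 \<le> 2 * (norm x)\<^sup>2 + 2 * (norm y)\<^sup>2"
proof -
  have "(norm (x + y))\<^sup>2 \<le> (norm x + norm y)\<^sup>2" by (intro power_mono norm_triangle_ineq) auto
  also have "\<dots> \<le> 2 * (norm x)\<^sup>2 + 2 * (norm y)\<^sup>2"
    using zero_le_power2[of "norm x - norm y"] by (simp add: power2_eq_square algebra_simps)
  finally show ?thesis .
qed

lemma integrable_mult_of_squares:
  fixes f g :: "'a \<Rightarrow> real"
  assumes [measurable]: "f \<in> borel_measurable M" "g \<in> borel_measurable M"
    and "integrable M (\<lambda>x. (f x)\<^sup>2)" "integrable M (\<lambda>x. (g x)\<^sup>2)"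
  shows "integrable M (\<lambda>x. f x * g x)"
proof (rule Bochner_Integration.integrable_bound)
  show "integrable M (\<lambda>x. (f x)\<^sup>2 + (g x)\<^sup>2)" using assms by simp
  show "AE x in M. norm (f x * g x) \<le> norm ((f x)\<^sup>2 + (g x)\<^sup>2)"
  proof (rule AE_I2)
    fix x
    have "2 * (\<bar>f x\<bar> * \<bar>g x\<bar>) \<le> (f x)\<^sup>2 + (g x)\<^sup>2"
      using zero_le_power2[of "\<bar>f x\<bar> - \<bar>g x\<bar>"] by (simp add: power2_diff)
    moreover have "0 \<le> \<bar>f x\<bar> * \<bar>g x\<bar>" by simp
    ultimately have "\<bar>f x\<bar> * \<bar>g x\<bar> \<le> (f x)\<^sup>2 + (g x)\<^sup>2" by linarith
    then show "norm (f x * g x) \<le> norm ((f x)\<^sup>2 + (g x)\<^sup>2)" by (simp add: abs_mult)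
  qed
qed measurable

context wiener_basis
begin

lemma sqrt_linear: "linear_operator_on U U R"
  using sqrt by (simp add: positive_sqrt_def bounded_operator_on_def)

lemma sqrt_in_U: "u \<in> U \<Longrightarrow> R u \<in> U"
  using sqrt_linear by (simp add: linear_operator_on_def)

lemma sqrt_sym: "u \<in> U \<Longrightarrow> v \<in> U \<Longrightarrow> R u \<bullet> v = u \<bullet> R v"
  using sqrt by (simp add: positive_sqrt_def)

lemma inner_sqrt: "u \<in> U \<Longrightarrow> v \<in> U \<Longrightarrow> R u \<bullet> R v = Q u \<bullet> v"
  using sqrt sqrt_sym[of "R u" v] sqrt_in_U by (simp add: positive_sqrt_def)

lemma sqrt_summable: "summable (\<lambda>m. (norm (R (e m)))\<^sup>2)"
  using cov unfolding power2_norm_eq_inner inner_sqrt[OF e_in_U e_in_U] covariance_operator_def by blast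

text \<open>Split the longer increment at the end of the shorter one. The surplus is a centred
  factor independent of the rest, and the common part contributes its length
  \<open>min s t - c\<close>.\<close>

lemma indicator_inc_inc:
  assumes c: "0 \<le> c" "c \<le> s" "c \<le> t" "s \<le> T" "t \<le> T" and A: "A \<in> sets (F c)" and vw: "v \<in> U" "w \<in> U"
  shows "integrable P (\<lambda>\<omega>. indicator A \<omega> * ((inc c s \<omega> \<bullet> v) * (inc c t \<omega> \<bullet> w)))" (is ?C1)
    "(LINT \<omega>|P. indicator A \<omega> * ((inc c s \<omega> \<bullet> v) * (inc c t \<omega> \<bullet> w))) = prob A * ((min s t - c) * (Q v \<bullet> w))" (is ?C2)
proof -
  let ?f = "\<lambda>s t v w \<omega>. indicator A \<omega> * ((inc c s \<omega> \<bullet> v) * (inc c t \<omega> \<bullet> w)) :: real"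
  have *: "integrable P (?f s t v w) \<and>
    integral\<^sup>L P (?f s t v w) = prob A * ((s - c) * (Q v \<bullet> w))"
    if "s \<le> t" "c \<le> s" "t \<le> T" "v \<in> U" "w \<in> U" for s t v w
  proof -
    have eq: "?f s t v w =
      (\<lambda>\<omega>. indicator A \<omega> * ((inc c s \<omega> \<bullet> v) * (inc c s \<omega> \<bullet> w)) + (indicator A \<omega> * (inc c s \<omega> \<bullet> v)) * (inc s t \<omega> \<bullet> w))"
      unfolding inc_split[of c t _ s] by (simp add: fun_eq_iff inner_add_left algebra_simps)
    have A': "A \<in> sets (F s)" "A \<in> sets P" using sets_F_mono[of c s A] sets_F_subset[of c A] A c that by auto
    have [measurable]: "inc c s \<in> borel_measurable (F s)" using c that by (intro inc_measurable_F) auto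
    have Y: "(\<lambda>\<omega>. indicator A \<omega> * (inc c s \<omega> \<bullet> v) :: real) \<in> borel_measurable (F s)"
      using A'(1) by measurable
    have "integrable P (\<lambda>\<omega>. indicator A \<omega> * (inc c s \<omega> \<bullet> v) :: real)"
      using integrable_mult_indicator[OF A'(2) inc_gaussian(1)[of c s v]] c that by simp
    from mult_inc_mean_zero[OF _ _ _ Y this, of t w] indicator_inc_covariance[OF _ _ _ A, of s v w]
    show ?thesis unfolding eq using c that by simp
  qed
  have "?C1 \<and>
    ?C2"
  proof (cases "s \<le> t")
    case True
    then show ?thesis using *[of s t v w] c vw by simp
  next
    case False
    then show ?thesis using *[of t s w v] c vw Q_sym[of v w] by (simp add: mult.commute)
  qed
  then show ?C1
    ?C2
    by auto
qed

section \<open>Covariance of pairs of elementary entries\<close>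

abbreviation entry :: "'w set \<Rightarrow> ('a \<Rightarrow> 'b::real_vector) \<Rightarrow> real \<Rightarrow> real \<Rightarrow> 'w \<Rightarrow> 'b"
  where "entry A \<Lambda> a b \<omega> \<equiv> indicator A \<omega> *\<^sub>R \<Lambda> (inc a b \<omega>)"

abbreviation scalar_entry :: "'w set \<Rightarrow> 'a \<Rightarrow> real \<Rightarrow> real \<Rightarrow> 'w \<Rightarrow> real"
  where "scalar_entry A v a b \<omega> \<equiv> indicator A \<omega> * (inc a b \<omega> \<bullet> v)"

text \<open>For a \<le> b and a' \<le> b' this is the Lebesgue measure of the intersection of (a, b]
  and (a', b'].\<close>

definition overlap :: "real \<Rightarrow> real \<Rightarrow> real \<Rightarrow> real \<Rightarrow> real"
  where "overlap a b a' b' = max 0 (min b b' - max a a')"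

lemma inc_inner_square_integrable:
  assumes "0 \<le> a" "a \<le> b" "b \<le> T" "A \<in> sets P"
  shows "integrable P (\<lambda>\<omega>. (scalar_entry A v a b \<omega>)\<^sup>2)"
proof (rule Bochner_Integration.integrable_bound[OF integrable_mult_right[OF norm_inc_square_integrable[OF assms(1-3)], of "(norm v)\<^sup>2"]])
  note [measurable] = inc_measurable[OF assms(1-3)] assms(4)
  show "(\<lambda>\<omega>. (scalar_entry A v a b \<omega>)\<^sup>2) \<in> borel_measurable P" by measurable
  have "(inc a b \<omega> \<bullet> v)\<^sup>2 \<le> (norm v)\<^sup>2 * (norm (inc a b \<omega>))\<^sup>2" for \<omega>
    using Cauchy_Schwarz_ineq[of "inc a b \<omega>" v] by (simp add: power2_norm_eq_inner mult.commute)
  then show "AE \<omega> in P. norm ((scalar_entry A v a b \<omega>)\<^sup>2) \<le> norm ((norm v)\<^sup>2 * (norm (inc a b \<omega>))\<^sup>2)"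
    by (auto simp: indicator_def intro!: AE_I2)
qed

text \<open>For the entry that starts at the later time a', the part of the other increment before
  a' is a known weight and contributes zero. Only the part after a' correlates with it.\<close>

lemma elementary_scalar_pair_ordered:
  assumes a: "0 \<le> a" "a \<le> b" "b \<le> T" "A \<in> sets (F a)" and a': "a \<le> a'" "a' \<le> b'" "b' \<le> T" "A' \<in> sets (F a')"
    and vw: "v \<in> U" "w \<in> U"
  shows "(LINT \<omega>|P. (scalar_entry A v a b \<omega>) * (scalar_entry A' w a' b' \<omega>))
    = prob (A \<inter> A') * (overlap a b a' b' * (Q v \<bullet> w))"
proof -
  have a'0: "0 \<le> a'" "a' \<le> T" using a a' by auto
  have AA: "A \<in> sets (F a')" "A \<inter> A' \<in> sets (F a')" "A' \<in> sets P" "A \<in> sets P"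
    using sets_F_mono[of a a' A] sets_F_subset[of a A] sets_F_subset[of a' A'] a a' a'0 by (auto intro: sets.Int)
  have mean0: "integrable P (\<lambda>\<omega>. (scalar_entry (A \<inter> A') v a r \<omega>) * (inc a' b' \<omega> \<bullet> w)) \<and>
      (LINT \<omega>|P. (scalar_entry (A \<inter> A') v a r \<omega>) * (inc a' b' \<omega> \<bullet> w)) = 0"
    if r: "a \<le> r" "r \<le> a'" for r
  proof -
    have [measurable]: "inc a r \<in> borel_measurable (F a')" using a a'0 r by (intro inc_measurable_F) auto
    have Y: "(\<lambda>\<omega>. scalar_entry (A \<inter> A') v a r \<omega> :: real) \<in> borel_measurable (F a')"
      using AA(2) by measurable
    have "integrable P (\<lambda>\<omega>. scalar_entry (A \<inter> A') v a r \<omega> :: real)"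
      using integrable_mult_indicator[OF sets.Int[OF AA(4,3)] inc_gaussian(1)[of a r v]] a r vw a'0 by simp
    from mult_inc_mean_zero[OF _ _ _ Y this, of b' w] show ?thesis using a' a'0 vw by simp
  qed
  show ?thesis
  proof (cases "b \<le> a'")
    case True
    have "(\<lambda>\<omega>. (scalar_entry A v a b \<omega>) * (scalar_entry A' w a' b' \<omega>))
        = (\<lambda>\<omega>. (scalar_entry (A \<inter> A') v a b \<omega>) * (inc a' b' \<omega> \<bullet> w))"
      by (auto simp: fun_eq_iff indicator_def)
    then show ?thesis using mean0[of b] True a a' by (simp add: overlap_def)
  next
    case False
    have "(\<lambda>\<omega>. (scalar_entry A v a b \<omega>) * (scalar_entry A' w a' b' \<omega>))
        = (\<lambda>\<omega>. (scalar_entry (A \<inter> A') v a a' \<omega>) * (inc a' b' \<omega> \<bullet> w)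
             + indicator (A \<inter> A') \<omega> * ((inc a' b \<omega> \<bullet> v) * (inc a' b' \<omega> \<bullet> w)))"
      unfolding inc_split[of a b _ a'] by (auto simp: fun_eq_iff indicator_def inner_add_left algebra_simps)
    moreover note mean0[of a']
    moreover note indicator_inc_inc[OF a'0(1) _ a'(2) a(3) a'(3) AA(2) vw]
    ultimately show ?thesis using False a' by (simp add: overlap_def)
  qed
qed

lemma elementary_scalar_pair:
  assumes a: "0 \<le> a" "a \<le> b" "b \<le> T" "A \<in> sets (F a)" and a': "0 \<le> a'" "a' \<le> b'" "b' \<le> T" "A' \<in> sets (F a')"
    and vw: "v \<in> U" "w \<in> U"
  shows "(LINT \<omega>|P. (scalar_entry A v a b \<omega>) * (scalar_entry A' w a' b' \<omega>))
    = prob (A \<inter> A') * (overlap a b a' b' * (Q v \<bullet> w))"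
proof (cases "a \<le> a'")
  case True
  then show ?thesis by (intro elementary_scalar_pair_ordered assms)
next
  case False
  have "(LINT \<omega>|P. (scalar_entry A' w a' b' \<omega>) * (scalar_entry A v a b \<omega>))
    = prob (A' \<inter> A) * (overlap a' b' a b * (Q w \<bullet> v))"
    using False by (intro elementary_scalar_pair_ordered assms) auto
  then show ?thesis using Q_sym[OF vw]
    by (simp add: overlap_def mult.commute Int_commute min.commute max.commute)
qed


text \<open>Nothing is known about \<Lambda> outside U. Composed with a U-valued variable it is a
  pointwise limit of finite coordinate sums, hence measurable.\<close>

lemma bounded_operator_measurable:
  fixes \<Lambda> :: "'a \<Rightarrow> 'b::{real_inner, second_countable_topology}"
  assumes \<Lambda>: "bounded_operator_on U V \<Lambda>" and f: "f \<in> borel_measurable P" "\<And>\<omega>. \<omega> \<in> space P \<Longrightarrow> f \<omega> \<in> U"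
  shows "(\<lambda>\<omega>. \<Lambda> (f \<omega>)) \<in> borel_measurable P"
proof (rule borel_measurable_LIMSEQ_metric)
  note [measurable] = f(1)
  have lin: "linear_operator_on U V \<Lambda>" using \<Lambda> by (simp add: bounded_operator_on_def)
  show "(\<lambda>\<omega>. \<Lambda> (proj n (f \<omega>))) \<in> borel_measurable P" for n
    unfolding linear_on_proj[OF lin] by measurable
  show "(\<lambda>n. \<Lambda> (proj n (f \<omega>))) \<longlonglongrightarrow> \<Lambda> (f \<omega>)" if "\<omega> \<in> space P" for \<omega>
    by (rule bounded_operator_proj_tendsto[OF \<Lambda> f(2)[OF that]])
qed

lemma square_integrable_operator_inc:
  fixes \<Lambda> :: "'a \<Rightarrow> 'b::{real_inner, second_countable_topology}"
  assumes a: "0 \<le> a" "a \<le> b" "b \<le> T" and A: "A \<in> sets P" and \<Lambda>: "bounded_operator_on U V \<Lambda>"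
  shows "(entry A \<Lambda> a b) \<in> borel_measurable P" (is ?C1)
    "integrable P (\<lambda>\<omega>. (norm (entry A \<Lambda> a b \<omega>))\<^sup>2)" (is ?C2)
proof -
  obtain K where K: "\<And>v. v \<in> U \<Longrightarrow> norm (\<Lambda> v) \<le> K * norm v" using \<Lambda> by (auto simp: bounded_operator_on_def)
  have inU: "inc a b \<omega> \<in> U" if "\<omega> \<in> space P" for \<omega> using a that by (intro inc_in_U) auto
  have [measurable]: "(\<lambda>\<omega>. \<Lambda> (inc a b \<omega>)) \<in> borel_measurable P"
    by (rule bounded_operator_measurable[OF \<Lambda> inc_measurable[OF a] inU])
  note [measurable] = A
  show ?C1 by measurable
  show ?C2
  proof (rule Bochner_Integration.integrable_bound[OF integrable_mult_right[OF norm_inc_square_integrable[OF a], of "K\<^sup>2"]])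
    show "(\<lambda>\<omega>. (norm (entry A \<Lambda> a b \<omega>))\<^sup>2) \<in> borel_measurable P" by measurable
    have "(norm (\<Lambda> (inc a b \<omega>)))\<^sup>2 \<le> K\<^sup>2 * (norm (inc a b \<omega>))\<^sup>2" if "\<omega> \<in> space P" for \<omega>
      using power_mono[OF K[OF inU[OF that]] norm_ge_zero, of 2] by (simp add: power_mult_distrib)
    then show "AE \<omega> in P. norm ((norm (entry A \<Lambda> a b \<omega>))\<^sup>2) \<le> norm (K\<^sup>2 * (norm (inc a b \<omega>))\<^sup>2)"
      by (auto simp: indicator_def intro!: AE_I2)
  qed
qed

text \<open>The Hilbert-Schmidt inner product of operators on \<open>U\<^sub>0\<close>, of which
  \<open>R \<circ> e\<close> is an orthonormal basis.\<close>

definition hs_inner :: "('a \<Rightarrow> 'b::real_inner) \<Rightarrow> ('a \<Rightarrow> 'b) \<Rightarrow> real"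
  where "hs_inner \<Lambda> \<Lambda>' = (\<Sum>m. \<Lambda> (R (e m)) \<bullet> \<Lambda>' (R (e m)))"

text \<open>The second claim expresses the inner product through the matrix of Q, the form in which
  covariances of increments deliver it. For operators cut off by \<open>proj n\<close>, Parseval and
  R R = Q yield the finite double sum. Tannery's theorem removes the cut-off: the terms are
  dominated by multiples of the squared norms of \<open>R (e m)\<close>, whose sum is the trace of
  Q.\<close>

lemma hs_inner_sums:
  fixes \<Lambda> \<Lambda>' :: "'a \<Rightarrow> 'b::real_inner"
  assumes \<Lambda>: "bounded_operator_on U V \<Lambda>" "bounded_operator_on U V \<Lambda>'"
  shows "(\<lambda>m. \<Lambda> (R (e m)) \<bullet> \<Lambda>' (R (e m))) sums hs_inner \<Lambda> \<Lambda>'" (is ?C1)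
    and "(\<lambda>n. \<Sum>k<n. \<Sum>l<n. (Q (e k) \<bullet> e l) * (\<Lambda> (e k) \<bullet> \<Lambda>' (e l))) \<longlonglongrightarrow> hs_inner \<Lambda> \<Lambda>'" (is ?C2)
proof -
  obtain K where K: "\<And>v. v \<in> U \<Longrightarrow> norm (\<Lambda> v) \<le> K * norm v" and lin: "linear_operator_on U V \<Lambda>"
    using \<Lambda> by (auto simp: bounded_operator_on_def)
  obtain K' where K': "\<And>v. v \<in> U \<Longrightarrow> norm (\<Lambda>' v) \<le> K' * norm v" and lin': "linear_operator_on U V \<Lambda>'"
    using \<Lambda> by (auto simp: bounded_operator_on_def)
  define a where "a m n = \<Lambda> (proj n (R (e m))) \<bullet> \<Lambda>' (proj n (R (e m)))" for m n
  have bound: "norm (\<Lambda> u \<bullet> \<Lambda>' u) \<le> \<bar>K\<bar> * \<bar>K'\<bar> * (norm v)\<^sup>2" if "u \<in> U" "norm u \<le> norm v" for u v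
  proof -
    have "norm (\<Lambda> u) \<le> \<bar>K\<bar> * norm v"
      using order_trans[OF K[OF that(1)] mult_mono[OF abs_ge_self that(2)]] by simp
    moreover have "norm (\<Lambda>' u) \<le> \<bar>K'\<bar> * norm v"
      using order_trans[OF K'[OF that(1)] mult_mono[OF abs_ge_self that(2)]] by simp
    ultimately have "norm (\<Lambda> u) * norm (\<Lambda>' u) \<le> (\<bar>K\<bar> * norm v) * (\<bar>K'\<bar> * norm v)"
      by (intro mult_mono) auto
    then show ?thesis using Cauchy_Schwarz_ineq2[of "\<Lambda> u" "\<Lambda>' u"] by (simp add: power2_eq_square mult_ac)
  qed
  have R: "R (e m) \<in> U" for m by (rule sqrt_in_U[OF e_in_U])
  have summ: "summable (\<lambda>m. \<bar>K\<bar> * \<bar>K'\<bar> * (norm (R (e m)))\<^sup>2)" by (intro summable_mult sqrt_summable)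
  have "summable (\<lambda>m. \<Lambda> (R (e m)) \<bullet> \<Lambda>' (R (e m)))"
    by (rule summable_comparison_test'[OF summ]) (use bound R in auto)
  then show ?C1
    unfolding hs_inner_def by (rule summable_sums)
  have "((\<lambda>n. \<Sum>m. a m n) \<longlonglongrightarrow> (\<Sum>m. \<Lambda> (R (e m)) \<bullet> \<Lambda>' (R (e m))))"
  proof (rule tannerys_theorem[THEN conjunct2, THEN conjunct2, OF _ _ summ])
    show "(\<lambda>n. a m n) \<longlonglongrightarrow> \<Lambda> (R (e m)) \<bullet> \<Lambda>' (R (e m))" for m
      unfolding a_def by (intro tendsto_inner bounded_operator_proj_tendsto[OF \<Lambda>(1)] bounded_operator_proj_tendsto[OF \<Lambda>(2)] R)
    show "\<forall>\<^sub>F (m, n) in at_top \<times>\<^sub>F sequentially. norm (a m n) \<le> \<bar>K\<bar> * \<bar>K'\<bar> * (norm (R (e m)))\<^sup>2"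
      unfolding a_def by (intro always_eventually) (auto intro!: bound proj_in_U norm_proj_le simp del: real_norm_def)
  qed simp
  moreover have "(\<Sum>m. a m n) = (\<Sum>k<n. \<Sum>l<n. (Q (e k) \<bullet> e l) * (\<Lambda> (e k) \<bullet> \<Lambda>' (e l)))" for n
  proof -
    have "(\<lambda>m. (R (e m) \<bullet> e k) * (R (e m) \<bullet> e l)) sums (Q (e k) \<bullet> e l)" for k l
    proof -
      have "R (e m) \<bullet> e j = R (e j) \<bullet> e m" for m j
        using sqrt_sym[OF e_in_U e_in_U, of m j] by (simp add: inner_commute)
      then show ?thesis
        using parseval[OF R[of k], of "R (e l)"] unfolding inner_sqrt[OF e_in_U e_in_U] by (simp only:)
    qed
    then have "(\<lambda>m. \<Sum>k<n. \<Sum>l<n. (R (e m) \<bullet> e k) * (R (e m) \<bullet> e l) * (\<Lambda> (e k) \<bullet> \<Lambda>' (e l))) sums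
      (\<Sum>k<n. \<Sum>l<n. (Q (e k) \<bullet> e l) * (\<Lambda> (e k) \<bullet> \<Lambda>' (e l)))"
      by (intro sums_sum sums_mult2)
    moreover have "a m n = (\<Sum>k<n. \<Sum>l<n. (R (e m) \<bullet> e k) * (R (e m) \<bullet> e l) * (\<Lambda> (e k) \<bullet> \<Lambda>' (e l)))" for m
      unfolding a_def linear_on_proj[OF lin] linear_on_proj[OF lin'] inner_sum_left unfolding inner_sum_right
      by (intro sum.cong refl) (simp add: mult_ac)
    ultimately show ?thesis by (simp add: sums_iff)
  qed
  ultimately show ?C2
    unfolding hs_inner_def by simp
qed

text \<open>Projecting both increments to the first n basis vectors reduces the pair to scalar
  entries. Dominated convergence restores the full increments, with the integrable majorant given by
  the product of their norms.\<close>

lemma elementary_pair: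
  fixes \<Lambda> \<Lambda>' :: "'a \<Rightarrow> 'b::{real_inner, second_countable_topology}"
  assumes a: "0 \<le> a" "a \<le> b" "b \<le> T" "A \<in> sets (F a)" and a': "0 \<le> a'" "a' \<le> b'" "b' \<le> T" "A' \<in> sets (F a')"
    and \<Lambda>: "bounded_operator_on U V \<Lambda>" "bounded_operator_on U V \<Lambda>'"
  shows "integrable P (\<lambda>\<omega>. (entry A \<Lambda> a b \<omega>) \<bullet> (entry A' \<Lambda>' a' b' \<omega>))"
    "(LINT \<omega>|P. (entry A \<Lambda> a b \<omega>) \<bullet> (entry A' \<Lambda>' a' b' \<omega>))
      = prob (A \<inter> A') * (overlap a b a' b' * hs_inner \<Lambda> \<Lambda>')"
proof -
  have AP: "A \<in> sets P" "A' \<in> sets P" using sets_F_subset[of a A] sets_F_subset[of a' A'] a a' by auto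
  note [measurable] = inc_measurable[OF a(1-3)] inc_measurable[OF a'(1-3)] AP
  obtain K where K: "\<And>v. v \<in> U \<Longrightarrow> norm (\<Lambda> v) \<le> K * norm v" and lin: "linear_operator_on U V \<Lambda>"
    using \<Lambda> by (auto simp: bounded_operator_on_def)
  obtain K' where K': "\<And>v. v \<in> U \<Longrightarrow> norm (\<Lambda>' v) \<le> K' * norm v" and lin': "linear_operator_on U V \<Lambda>'"
    using \<Lambda> by (auto simp: bounded_operator_on_def)
  define f where "f n \<omega> = (indicator A \<omega> *\<^sub>R \<Lambda> (proj n (inc a b \<omega>))) \<bullet> (indicator A' \<omega> *\<^sub>R \<Lambda>' (proj n (inc a' b' \<omega>)))" for n \<omega>
  let ?f = "\<lambda>\<omega>. (entry A \<Lambda> a b \<omega>) \<bullet> (entry A' \<Lambda>' a' b' \<omega>)"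
  let ?w = "\<lambda>\<omega>. \<bar>K\<bar> * \<bar>K'\<bar> * (norm (inc a b \<omega>) * norm (inc a' b' \<omega>))"
  have inU: "inc a b \<omega> \<in> U" "inc a' b' \<omega> \<in> U" if "\<omega> \<in> space P" for \<omega> using a a' that by (auto intro!: inc_in_U)
  have f_eq: "f n = (\<lambda>\<omega>. \<Sum>k<n. \<Sum>l<n. ((scalar_entry A (e k) a b \<omega>) * (scalar_entry A' (e l) a' b' \<omega>)) * (\<Lambda> (e k) \<bullet> \<Lambda>' (e l)))" for n
    unfolding f_def linear_on_proj[OF lin] linear_on_proj[OF lin'] inner_scaleR_left inner_scaleR_right
      inner_sum_left unfolding inner_sum_right sum_distrib_left
    by (intro ext sum.cong refl) (simp add: mult_ac)
  have [measurable]: "f n \<in> borel_measurable P" for n unfolding f_eq by measurable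
  have [measurable]: "(entry A \<Lambda> a b) \<in> borel_measurable P"
    "(entry A' \<Lambda>' a' b') \<in> borel_measurable P"
    using square_integrable_operator_inc(1) a a' AP \<Lambda> by blast+
  have w: "integrable P ?w"
    by (intro integrable_mult_right integrable_mult_of_squares norm_inc_square_integrable a a') measurable
  have lim: "AE \<omega> in P. (\<lambda>n. f n \<omega>) \<longlonglongrightarrow> ?f \<omega>"
    unfolding f_def
    by (intro AE_I2 tendsto_inner tendsto_scaleR tendsto_const bounded_operator_proj_tendsto[OF \<Lambda>(1)] bounded_operator_proj_tendsto[OF \<Lambda>(2)] inU)
  have bnd: "AE \<omega> in P. norm (f n \<omega>) \<le> ?w \<omega>" for n
  proof (rule AE_I2)
    fix \<omega>
    have 1: "norm (\<Lambda> (proj n (inc a b \<omega>))) \<le> \<bar>K\<bar> * norm (inc a b \<omega>)"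
      using order_trans[OF K[OF proj_in_U] mult_mono[OF abs_ge_self norm_proj_le]] by simp
    have 2: "norm (\<Lambda>' (proj n (inc a' b' \<omega>))) \<le> \<bar>K'\<bar> * norm (inc a' b' \<omega>)"
      using order_trans[OF K'[OF proj_in_U] mult_mono[OF abs_ge_self norm_proj_le]] by simp
    have "norm (f n \<omega>) \<le> norm (\<Lambda> (proj n (inc a b \<omega>))) * norm (\<Lambda>' (proj n (inc a' b' \<omega>)))"
      using Cauchy_Schwarz_ineq2[of "\<Lambda> (proj n (inc a b \<omega>))" "\<Lambda>' (proj n (inc a' b' \<omega>))"]
      by (auto simp: f_def indicator_def)
    also have "\<dots> \<le> (\<bar>K\<bar> * norm (inc a b \<omega>)) * (\<bar>K'\<bar> * norm (inc a' b' \<omega>))"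
      using 1 2 by (intro mult_mono) auto
    finally show "norm (f n \<omega>) \<le> ?w \<omega>" by (simp add: mult_ac)
  qed
  show "integrable P ?f"
    by (rule integrable_dominated_convergence[OF _ _ w lim bnd]) measurable
  have "(\<lambda>n. integral\<^sup>L P (f n)) \<longlonglongrightarrow> integral\<^sup>L P ?f"
    by (rule integral_dominated_convergence[OF _ _ w lim bnd]) measurable
  moreover have "integral\<^sup>L P (f n) = prob (A \<inter> A') * (overlap a b a' b' * (\<Sum>k<n. \<Sum>l<n. (Q (e k) \<bullet> e l) * (\<Lambda> (e k) \<bullet> \<Lambda>' (e l))))" for n
  proof -
    define g where "g k l \<omega> = (scalar_entry A (e k) a b \<omega>) * (scalar_entry A' (e l) a' b' \<omega>)" for k l \<omega>
    have int: "integrable P (g k l)" for k l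
      unfolding g_def by (intro integrable_mult_of_squares inc_inner_square_integrable a a' AP) measurable
    have val: "integral\<^sup>L P (g k l) = prob (A \<inter> A') * (overlap a b a' b' * (Q (e k) \<bullet> e l))" for k l
      unfolding g_def by (rule elementary_scalar_pair[OF a a' e_in_U e_in_U])
    have "integral\<^sup>L P (f n) = (\<Sum>k<n. \<Sum>l<n. integral\<^sup>L P (g k l) * (\<Lambda> (e k) \<bullet> \<Lambda>' (e l)))"
      unfolding f_eq g_def[symmetric] using int by simp
    then show ?thesis
      unfolding val by (simp add: sum_distrib_left mult_ac)
  qed
  moreover have "(\<lambda>n. prob (A \<inter> A') * (overlap a b a' b' * (\<Sum>k<n. \<Sum>l<n. (Q (e k) \<bullet> e l) * (\<Lambda> (e k) \<bullet> \<Lambda>' (e l)))))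
      \<longlonglongrightarrow> prob (A \<inter> A') * (overlap a b a' b' * hs_inner \<Lambda> \<Lambda>')"
    by (intro tendsto_intros hs_inner_sums(2)[OF \<Lambda>])
  ultimately show "integral\<^sup>L P ?f = prob (A \<inter> A') * (overlap a b a' b' * hs_inner \<Lambda> \<Lambda>')"
    using LIMSEQ_unique by simp
qed

lemma elementary_entry_mean_zero:
  fixes \<Lambda> :: "'a \<Rightarrow> 'b::{real_inner, second_countable_topology}" and \<l> :: "'b \<Rightarrow> real"
  assumes a: "0 \<le> a" "a \<le> b" "b \<le> T" "A \<in> sets (F a)" and \<Lambda>: "bounded_operator_on U V \<Lambda>"
    and \<l>: "bounded_linear \<l>"
  shows "integrable P (\<lambda>\<omega>. \<l> (entry A \<Lambda> a b \<omega>))"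
    "(LINT \<omega>|P. \<l> (entry A \<Lambda> a b \<omega>)) = 0"
proof -
  interpret \<l>: bounded_linear \<l> by fact
  obtain C where C: "\<And>x. norm (\<l> x) \<le> norm x * C" "0 < C" using \<l>.pos_bounded by auto
  have AP: "A \<in> sets P" using sets_F_subset[of a A] a by auto
  have [measurable]: "\<l> \<in> borel_measurable borel" by (intro borel_measurable_continuous_onI linear_continuous_on \<l>)
  note [measurable] = inc_measurable[OF a(1-3)] AP square_integrable_operator_inc(1)[OF a(1-3) AP \<Lambda>]
  obtain K where K: "\<And>v. v \<in> U \<Longrightarrow> norm (\<Lambda> v) \<le> K * norm v" and lin: "linear_operator_on U V \<Lambda>"
    using \<Lambda> by (auto simp: bounded_operator_on_def)
  define f where "f n \<omega> = \<l> (indicator A \<omega> *\<^sub>R \<Lambda> (proj n (inc a b \<omega>)))" for n \<omega>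
  let ?f = "\<lambda>\<omega>. \<l> (entry A \<Lambda> a b \<omega>)"
  let ?w = "\<lambda>\<omega>. (\<bar>K\<bar> * norm (inc a b \<omega>)) * C"
  have inU: "inc a b \<omega> \<in> U" if "\<omega> \<in> space P" for \<omega> using a that by (auto intro!: inc_in_U)
  have f_eq: "f n = (\<lambda>\<omega>. \<Sum>k<n. (scalar_entry A (e k) a b \<omega>) * \<l> (\<Lambda> (e k)))" for n
    unfolding f_def linear_on_proj[OF lin]
    by (simp add: fun_eq_iff \<l>.scaleR \<l>.sum sum_distrib_left mult_ac)
  have [measurable]: "f n \<in> borel_measurable P" for n unfolding f_eq by measurable
  have "integrable P (\<lambda>\<omega>. norm (inc a b \<omega>) * 1)"
    by (intro integrable_mult_of_squares norm_inc_square_integrable a) auto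
  then have w: "integrable P ?w" by (intro integrable_mult_left integrable_mult_right) simp
  have lim: "AE \<omega> in P. (\<lambda>n. f n \<omega>) \<longlonglongrightarrow> ?f \<omega>"
    unfolding f_def by (intro AE_I2 \<l>.tendsto tendsto_scaleR tendsto_const bounded_operator_proj_tendsto[OF \<Lambda>] inU)
  have bnd: "AE \<omega> in P. norm (f n \<omega>) \<le> ?w \<omega>" for n
  proof (rule AE_I2)
    fix \<omega>
    have "norm (\<Lambda> (proj n (inc a b \<omega>))) \<le> \<bar>K\<bar> * norm (inc a b \<omega>)"
      using order_trans[OF K[OF proj_in_U] mult_mono[OF abs_ge_self norm_proj_le]] by simp
    moreover have "norm (indicator A \<omega> *\<^sub>R \<Lambda> (proj n (inc a b \<omega>))) \<le> norm (\<Lambda> (proj n (inc a b \<omega>)))"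
      by (auto simp: indicator_def)
    ultimately have "norm (indicator A \<omega> *\<^sub>R \<Lambda> (proj n (inc a b \<omega>))) * C \<le> ?w \<omega>"
      using C(2) by (intro mult_right_mono) auto
    then show "norm (f n \<omega>) \<le> ?w \<omega>" unfolding f_def using C(1) order_trans by blast
  qed
  show "integrable P ?f"
    by (rule integrable_dominated_convergence[OF _ _ w lim bnd]) measurable
  have "(\<lambda>n. integral\<^sup>L P (f n)) \<longlonglongrightarrow> integral\<^sup>L P ?f"
    by (rule integral_dominated_convergence[OF _ _ w lim bnd]) measurable
  moreover have "integral\<^sup>L P (f n) = 0" for n
  proof -
    have ind: "(indicator A :: _ \<Rightarrow> real) \<in> borel_measurable (F a)" "integrable P (indicator A :: _ \<Rightarrow> real)"
      using a AP by (auto simp: integrable_real_indicator less_top[symmetric])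
    show ?thesis
      unfolding f_eq using mult_inc_mean_zero[OF a(1-3) ind e_in_U] by simp
  qed
  ultimately show "integral\<^sup>L P ?f = 0" by (simp add: LIMSEQ_const_iff)
qed

end

lemma integral_double_sum:
  fixes f :: "nat \<Rightarrow> nat \<Rightarrow> 'a \<Rightarrow> real"
  assumes f: "\<And>i j. i < n \<Longrightarrow> j < n \<Longrightarrow> integrable M (f i j)"
  shows "integrable M (\<lambda>x. \<Sum>i<n. \<Sum>j<n. f i j x)" (is ?C1)
    "(LINT x|M. (\<Sum>i<n. \<Sum>j<n. f i j x)) = (\<Sum>i<n. \<Sum>j<n. integral\<^sup>L M (f i j))" (is ?C2)
proof -
  have i: "integrable M (\<lambda>x. \<Sum>j<n. f i j x)" if "i < n" for i
    using f that by (intro Bochner_Integration.integrable_sum) auto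
  show ?C1
    by (rule Bochner_Integration.integrable_sum) (simp add: i)
  have "(LINT x|M. (\<Sum>i<n. \<Sum>j<n. f i j x)) = (\<Sum>i<n. LINT x|M. (\<Sum>j<n. f i j x))"
    by (rule Bochner_Integration.integral_sum) (simp add: i)
  also have "\<dots> = (\<Sum>i<n. \<Sum>j<n. integral\<^sup>L M (f i j))"
    by (rule sum.cong[OF refl], rule Bochner_Integration.integral_sum) (simp add: f)
  finally show ?C2 .
qed

section \<open>The isometry for elementary integrands and what survives in the mean square
  limit\<close>

context wiener_basis
begin

lemma overlap_eq:
  "a \<le> b \<Longrightarrow> a' \<le> b' \<Longrightarrow> emeasure lborel ({a<..b} \<inter> {a'<..b'}) = ennreal (overlap a b a' b')"
  unfolding Int_greaterThanAtMost overlap_def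
  by (cases "max a a' \<le> min b b'") (auto simp: max_def min_def)

lemma elementary_process_nth:
  assumes "elementary_process F t U H xs" "i < length xs" "t \<le> T"
  obtains a b A \<Lambda> where "xs ! i = (a, b, A, \<Lambda>)" "0 \<le> a" "a \<le> b" "b \<le> t" "b \<le> T" "A \<in> sets (F a)" "A \<in> sets P"
    "bounded_operator_on U H \<Lambda>"
proof -
  obtain a b A \<Lambda> where x: "xs ! i = (a, b, A, \<Lambda>)" using prod_cases4 by blast
  then have "(a, b, A, \<Lambda>) \<in> set xs" using assms(2) by (metis nth_mem)
  then have "0 \<le> a" "a \<le> b" "b \<le> t" "A \<in> sets (F a)" "bounded_operator_on U H \<Lambda>"
    using assms(1) by (auto simp: elementary_process_def)
  then show ?thesis using that[OF x] sets_F_subset[of a A] assms(3) by auto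
qed

text \<open>Both sides are quadratic in the list of entries, and to either side a pair of entries
  contributes the probability of the joint event times the overlap of the intervals times
  \<open>hs_inner\<close>. Overlapping intervals are thus handled directly, without passing to a
  common refinement.\<close>

lemma ito_isometry:
  fixes xs :: "('w, 'a, 'b::{real_inner, second_countable_topology}) elementary"
  assumes xs: "elementary_process F t U H xs" and t: "t \<le> T"
  shows "elementary_integral W xs \<in> borel_measurable P" (is ?C1)
    and "(\<integral>\<^sup>+\<omega>. ennreal ((norm (elementary_integral W xs \<omega>))\<^sup>2) \<partial>P) =
      (\<integral>\<^sup>+\<omega>. (\<integral>\<^sup>+s\<in>{0..t}. (\<Sum>k. ennreal ((norm (elementary_value xs s \<omega> (R (e k))))\<^sup>2)) \<partial>lborel) \<partial>P)" (is ?C2)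
    and "bounded_linear l \<Longrightarrow> integrable P (\<lambda>\<omega>. l (elementary_integral W xs \<omega>) :: real)"
    and "bounded_linear l \<Longrightarrow> (LINT \<omega>|P. l (elementary_integral W xs \<omega>) :: real) = 0"
proof -
  let ?X = "elementary_integral W xs" and ?v = "\<lambda>s \<omega> k. elementary_value xs s \<omega> (R (e k))"
  define n where "n = length xs"
  define a where "a i = fst (xs ! i)" for i
  define b where "b i = fst (snd (xs ! i))" for i
  define A where "A i = fst (snd (snd (xs ! i)))" for i
  define \<Lambda> where "\<Lambda> i = snd (snd (snd (xs ! i)))" for i
  have ent: "0 \<le> a i \<and> a i \<le> b i \<and> b i \<le> t \<and> b i \<le> T \<and> A i \<in> sets (F (a i)) \<and> A i \<in> sets P \<and> bounded_operator_on U H (\<Lambda> i)"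
    if "i < n" for i
    using elementary_process_nth[OF xs that[unfolded n_def] t] unfolding a_def b_def A_def \<Lambda>_def by (metis fst_conv snd_conv)
  define Y where "Y i \<omega> = entry (A i) (\<Lambda> i) (a i) (b i) \<omega>" for i \<omega>
  have I: "elementary_integral W xs \<omega> = (\<Sum>i<n. Y i \<omega>)" for \<omega>
    unfolding elementary_integral_def sum_list_sum_nth n_def Y_def inc_def a_def b_def A_def \<Lambda>_def
    by (simp add: atLeast0LessThan split_beta)
  define c where "c i s \<omega> = (indicator {a i<..b i} s * indicator (A i) \<omega> :: real)" for i s \<omega>
  have V: "elementary_value xs s \<omega> v = (\<Sum>i<n. c i s \<omega> *\<^sub>R \<Lambda> i v)" for s \<omega> v
    unfolding elementary_value_def sum_list_sum_nth n_def c_def a_def b_def A_def \<Lambda>_def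
    by (simp add: atLeast0LessThan split_beta)
  have Ym: "Y i \<in> borel_measurable P" if "i < n" for i
    unfolding Y_def using ent[OF that] square_integrable_operator_inc(1)[of "a i" "b i" "A i" H "\<Lambda> i"] by auto
  then show meas: ?C1
    unfolding I[abs_def] by (intro borel_measurable_sum) auto
  define h where "h i j = hs_inner (\<Lambda> i) (\<Lambda> j)" for i j
  define q where "q i j = overlap (a i) (b i) (a j) (b j)" for i j
  let ?J = "\<lambda>i j. {a i<..b i} \<inter> {a j<..b j}"
  let ?Q = "\<lambda>\<omega>. \<Sum>i<n. \<Sum>j<n. indicator (A i \<inter> A j) \<omega> * (q i j * h i j)"
  let ?q = "\<Sum>i<n. \<Sum>j<n. prob (A i \<inter> A j) * (q i j * h i j)"
  have pair: "integrable P (\<lambda>\<omega>. Y i \<omega> \<bullet> Y j \<omega>)" "(LINT \<omega>|P. Y i \<omega> \<bullet> Y j \<omega>) = prob (A i \<inter> A j) * (q i j * h i j)"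
    if "i < n" "j < n" for i j
    unfolding Y_def q_def h_def
    using elementary_pair[of "a i" "b i" "A i" "a j" "b j" "A j" H "\<Lambda> i" "\<Lambda> j"] ent[OF that(1)] ent[OF that(2)] by auto
  have sq: "(norm (?X \<omega>))\<^sup>2 = (\<Sum>i<n. \<Sum>j<n. Y i \<omega> \<bullet> Y j \<omega>)" for \<omega>
    unfolding power2_norm_eq_inner I inner_sum_left unfolding inner_sum_right ..
  have int_sq: "integrable P (\<lambda>\<omega>. (norm (?X \<omega>))\<^sup>2)"
    unfolding sq by (rule integral_double_sum(1)[OF pair(1)])
  have lint_sq: "(LINT \<omega>|P. (norm (?X \<omega>))\<^sup>2) = ?q"
    unfolding sq using pair by (simp add: integral_double_sum(2))
  have lhs: "(\<integral>\<^sup>+\<omega>. ennreal ((norm (?X \<omega>))\<^sup>2) \<partial>P) = ennreal ?q"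
    unfolding lint_sq[symmetric] by (rule nn_integral_eq_integral[OF int_sq]) simp
  \<comment> \<open>The squared Hilbert-Schmidt norm of the elementary integrand at (s, \<omega>),
    expanded over pairs of entries.\<close>
  define g where "g s \<omega> = (\<Sum>i<n. \<Sum>j<n. (c i s \<omega> * c j s \<omega>) * h i j)" for s \<omega>
  have g_sums: "(\<lambda>k. (norm (?v s \<omega> k))\<^sup>2) sums g s \<omega>" for s \<omega>
  proof -
    have "(\<lambda>k. (norm (?v s \<omega> k))\<^sup>2)
      = (\<lambda>k. \<Sum>i<n. \<Sum>j<n. (c i s \<omega> * c j s \<omega>) * (\<Lambda> i (R (e k)) \<bullet> \<Lambda> j (R (e k))))"
      unfolding power2_norm_eq_inner V inner_sum_left unfolding inner_sum_right by (intro ext sum.cong refl) (simp add: mult_ac)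
    also have "\<dots> sums g s \<omega>"
      unfolding g_def h_def
      by (rule sums_sum, rule sums_sum, rule sums_mult, rule hs_inner_sums(1)[where V = H]) (simp_all add: ent)
    finally show ?thesis .
  qed
  \<comment> \<open>Single terms of the double sum may be negative; the sum is nonnegative as a
    limit of sums of squared norms.\<close>
  have g_nonneg: "0 \<le> g s \<omega>" for s \<omega>
    by (rule sums_le[OF _ sums_zero g_sums]) simp
  have g_ennreal: "(\<Sum>k. ennreal ((norm (?v s \<omega> k))\<^sup>2)) = ennreal (g s \<omega>)" for s \<omega>
    using g_sums[of s \<omega>] by (subst suminf_ennreal2) (auto simp: sums_iff)
  have cc: "c i s \<omega> * c j s \<omega> = indicator (A i \<inter> A j) \<omega> * indicator (?J i j) s" for i j s \<omega>
    by (auto simp: c_def indicator_def)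
  have q_nonneg: "0 \<le> q i j" for i j by (simp add: q_def overlap_def)
  have em: "emeasure lborel (?J i j) = ennreal (q i j)" if "i < n" "j < n" for i j
    unfolding q_def using ent that by (intro overlap_eq) auto
  then have ov: "integrable lborel (indicator (?J i j) :: real \<Rightarrow> real)"
      "(LINT s|lborel. indicator (?J i j) s) = q i j" if "i < n" "j < n" for i j
    using that q_nonneg[of i j] by (auto simp: measure_def integrable_real_indicator)
  have g_eq: "g s \<omega> = (\<Sum>i<n. \<Sum>j<n. indicator (?J i j) s * (indicator (A i \<inter> A j) \<omega> * h i j))" for s \<omega>
    unfolding g_def cc by (intro sum.cong refl) (simp only: mult_ac)
  have g_int: "integrable lborel (\<lambda>s. g s \<omega>)" for \<omega>
    unfolding g_eq using ov(1) by (intro integral_double_sum(1) integrable_mult_left)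
  have g_val: "(LINT s|lborel. g s \<omega>) = ?Q \<omega>" for \<omega>
  proof -
    have "(LINT s|lborel. g s \<omega>) = (\<Sum>i<n. \<Sum>j<n. LINT s|lborel. indicator (?J i j) s * (indicator (A i \<inter> A j) \<omega> * h i j))"
      unfolding g_eq using ov(1) by (intro integral_double_sum(2) integrable_mult_left)
    also have "\<dots> = ?Q \<omega>"
    proof (intro sum.cong refl)
      fix i j assume "i \<in> {..<n}" "j \<in> {..<n}"
      then have ij: "i < n" "j < n" by auto
      show "(LINT s|lborel. indicator (?J i j) s * (indicator (A i \<inter> A j) \<omega> * h i j))
        = indicator (A i \<inter> A j) \<omega> * (q i j * h i j)"
        unfolding integral_mult_left_zero ov(2)[OF ij] by (simp only: mult_ac)
    qed
    finally show ?thesis .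
  qed
  have inner: "(\<integral>\<^sup>+s\<in>{0..t}. ennreal (g s \<omega>) \<partial>lborel) = ennreal (?Q \<omega>)" for \<omega>
  proof -
    have out: "g s \<omega> = 0" if "s \<notin> {0..t}" for s
    proof -
      have "c i s \<omega> = 0" if "i < n" for i
      proof -
        have "0 \<le> a i" "b i \<le> t" using ent[OF that] by blast+
        then have "s \<notin> {a i<..b i}" using \<open>s \<notin> {0..t}\<close> by (simp; linarith)
        then show ?thesis by (simp add: c_def)
      qed
      then show ?thesis by (simp add: g_def)
    qed
    have "(\<integral>\<^sup>+s\<in>{0..t}. ennreal (g s \<omega>) \<partial>lborel) = (\<integral>\<^sup>+s. ennreal (g s \<omega>) \<partial>lborel)"
      by (intro nn_integral_cong) (simp add: indicator_def out)
    also have "\<dots> = ennreal (LINT s|lborel. g s \<omega>)"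
      by (rule nn_integral_eq_integral[OF g_int]) (simp add: g_nonneg)
    finally show ?thesis unfolding g_val .
  qed
  have AAP: "A i \<inter> A j \<in> sets P" if "i < n" "j < n" for i j
    using ent[OF that(1)] ent[OF that(2)] by blast
  have A_int: "integrable P (\<lambda>\<omega>. indicator (A i \<inter> A j) \<omega> * (q i j * h i j))" if "i < n" "j < n" for i j
    using AAP[OF that] by (intro integrable_mult_left integrable_real_indicator) (simp_all add: emeasure_eq_measure)
  have "(\<integral>\<^sup>+\<omega>. (\<integral>\<^sup>+s\<in>{0..t}. (\<Sum>k. ennreal ((norm (?v s \<omega> k))\<^sup>2)) \<partial>lborel) \<partial>P)
      = (\<integral>\<^sup>+\<omega>. ennreal (?Q \<omega>) \<partial>P)"
    unfolding g_ennreal inner ..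
  also have "\<dots> = ennreal (LINT \<omega>|P. ?Q \<omega>)"
  proof (rule nn_integral_eq_integral)
    show "integrable P (\<lambda>\<omega>. \<Sum>i<n. \<Sum>j<n. indicator (A i \<inter> A j) \<omega> * (q i j * h i j))"
      by (rule integral_double_sum(1)[OF A_int])
    show "AE \<omega> in P. 0 \<le> ?Q \<omega>"
      unfolding g_val[symmetric] by (simp add: g_nonneg)
  qed
  also have "(LINT \<omega>|P. ?Q \<omega>)
      = (\<Sum>i<n. \<Sum>j<n. LINT \<omega>|P. indicator (A i \<inter> A j) \<omega> * (q i j * h i j))"
    by (rule integral_double_sum(2)[OF A_int])
  also have "\<dots> = ?q"
  proof (intro sum.cong refl)
    fix i j assume "i \<in> {..<n}" "j \<in> {..<n}"
    then have "A i \<inter> A j \<in> sets P" using AAP by simp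
    then have "A i \<inter> A j \<inter> space P = A i \<inter> A j" using sets.sets_into_space by blast
    then show "(LINT \<omega>|P. indicator (A i \<inter> A j) \<omega> * (q i j * h i j)) = prob (A i \<inter> A j) * (q i j * h i j)"
      by simp
  qed
  finally show ?C2
    unfolding lhs by simp
  assume l: "bounded_linear l"
  interpret l: bounded_linear l by fact
  have lY: "integrable P (\<lambda>\<omega>. l (Y i \<omega>))" "(LINT \<omega>|P. l (Y i \<omega>)) = 0" if "i < n" for i
    unfolding Y_def using elementary_entry_mean_zero[of "a i" "b i" "A i" H "\<Lambda> i" l] ent[OF that] l by auto
  show "integrable P (\<lambda>\<omega>. l (?X \<omega>))"
    unfolding I l.sum by (rule Bochner_Integration.integrable_sum) (simp add: lY)
  have "(LINT \<omega>|P. l (?X \<omega>)) = (\<Sum>i<n. LINT \<omega>|P. l (Y i \<omega>))"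
    unfolding I l.sum by (rule Bochner_Integration.integral_sum) (simp add: lY)
  then show "(LINT \<omega>|P. l (?X \<omega>)) = 0" by (simp add: lY)
qed

text \<open>A single approximation with both errors below 1 bounds the second moment: the splitting
  |x + y|^2 \<le> 2 |x|^2 + 2 |y|^2 gives 2 + 2 M t for the elementary integral, and once more 2 + 2
  (2 + 2 M t) = 6 + 4 M t for X. The mean of l vanishes for elementary integrals and passes to the
  limit.\<close>

lemma ito_integral_mean_square_bound:
  fixes X :: "'w \<Rightarrow> 'b::{real_inner, second_countable_topology}"
  assumes X: "has_ito_integral P F U e R H W \<Phi> t X" and t: "0 \<le> t" "t \<le> T"
    and M: "\<And>s \<omega>. s \<in> {0..t} \<Longrightarrow> \<omega> \<in> space P \<Longrightarrow> (\<Sum>k. ennreal ((norm (\<Phi> s \<omega> (R (e k))))\<^sup>2)) \<le> ennreal M" "0 \<le> M"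
  shows "(\<integral>\<^sup>+\<omega>. ennreal ((norm (X \<omega>))\<^sup>2) \<partial>P) \<le> ennreal (6 + 4 * M * t)" (is ?C1)
    and "bounded_linear l \<Longrightarrow> integrable P (\<lambda>\<omega>. l (X \<omega>) :: real)"
    and "bounded_linear l \<Longrightarrow> (LINT \<omega>|P. l (X \<omega>) :: real) = 0"
proof -
  have [measurable]: "X \<in> borel_measurable P" using X by (simp add: has_ito_integral_def)
  obtain xs :: "nat \<Rightarrow> ('w, 'a, 'b) elementary" where
    xs: "\<And>n. elementary_process F t U H (xs n)" and
    app: "(\<lambda>n. \<integral>\<^sup>+\<omega>. (\<integral>\<^sup>+s\<in>{0..t}. (\<Sum>k. ennreal ((norm
          (elementary_value (xs n) s \<omega> (R (e k)) - \<Phi> s \<omega> (R (e k))))\<^sup>2)) \<partial>lborel) \<partial>P) \<longlonglongrightarrow> 0" and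
    lim: "(\<lambda>n. \<integral>\<^sup>+\<omega>. ennreal ((norm (elementary_integral W (xs n) \<omega> - X \<omega>))\<^sup>2) \<partial>P) \<longlonglongrightarrow> 0"
    using X unfolding has_ito_integral_def by blast
  let ?I = "\<lambda>n. elementary_integral W (xs n)"
  let ?E = "\<lambda>n. \<integral>\<^sup>+\<omega>. (\<integral>\<^sup>+s\<in>{0..t}. (\<Sum>k. ennreal ((norm
    (elementary_value (xs n) s \<omega> (R (e k)) - \<Phi> s \<omega> (R (e k))))\<^sup>2)) \<partial>lborel) \<partial>P"
  note [measurable] = ito_isometry(1)[OF xs t(2)]
  define d where "d n = (\<integral>\<^sup>+\<omega>. ennreal ((norm (?I n \<omega> - X \<omega>))\<^sup>2) \<partial>P)" for n
  have ev: "\<forall>\<^sub>F n in sequentially. d n < r" if "0 < r" for r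
    using lim that unfolding d_def by (auto intro: order_tendstoD)
  have "\<forall>\<^sub>F n in sequentially. ?E n < 1"
    using app by (rule order_tendstoD) simp
  with ev[of 1] have ex: "\<forall>\<^sub>F n in sequentially. d n < 1 \<and> ?E n < 1"
    by (simp add: eventually_conj)
  then obtain n where n: "d n < 1" "?E n < 1"
    using eventually_happens'[OF sequentially_bot ex] by blast
  let ?v = "\<lambda>s \<omega> k. elementary_value (xs n) s \<omega> (R (e k))"
  let ?d = "\<lambda>s \<omega> k. ennreal ((norm (?v s \<omega> k - \<Phi> s \<omega> (R (e k))))\<^sup>2)"
  let ?V = "\<lambda>s \<omega>. \<Sum>k. ennreal ((norm (?v s \<omega> k))\<^sup>2)"
  let ?M = "\<lambda>f. \<integral>\<^sup>+\<omega>. ennreal ((norm (f \<omega>))\<^sup>2) \<partial>P"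
  let ?f = "\<lambda>s \<omega>. \<Sum>k. ?d s \<omega> k"
  let ?p = "\<lambda>s \<omega> k. (norm (\<Phi> s \<omega> (R (e k))))\<^sup>2"
  let ?F = "\<lambda>\<omega>. \<integral>\<^sup>+s\<in>{0..t}. ?f s \<omega> \<partial>lborel" and ?W = "\<lambda>\<omega>. \<integral>\<^sup>+s\<in>{0..t}. ?V s \<omega> \<partial>lborel"
  have pw: "?V s \<omega> * indicator {0..t} s \<le> ennreal 2 * (?f s \<omega> * indicator {0..t} s) + ennreal (2 * M) * indicator {0..t} s"
    if "\<omega> \<in> space P" for s \<omega>
  proof (cases "s \<in> {0..t}")
    case True
    have "?V s \<omega> \<le> (\<Sum>k. ennreal 2 * ?d s \<omega> k + ennreal 2 * ennreal (?p s \<omega> k))"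
    proof (intro suminf_le allI)
      fix k
      have "(norm (?v s \<omega> k))\<^sup>2 \<le> 2 * (norm (?v s \<omega> k - \<Phi> s \<omega> (R (e k))))\<^sup>2 + 2 * ?p s \<omega> k"
        using norm_add_square_le[of "?v s \<omega> k - \<Phi> s \<omega> (R (e k))" "\<Phi> s \<omega> (R (e k))"] by simp
      then show "ennreal ((norm (?v s \<omega> k))\<^sup>2) \<le> ennreal 2 * ?d s \<omega> k + ennreal 2 * ennreal (?p s \<omega> k)"
        by (simp add: ennreal_mult[symmetric] ennreal_plus[symmetric] del: ennreal_plus ennreal_numeral)
    qed auto
    also have "\<dots> = ennreal 2 * ?f s \<omega> + ennreal 2 * (\<Sum>k. ennreal (?p s \<omega> k))"
      by (simp add: suminf_add[symmetric] ennreal_suminf_cmult del: ennreal_numeral)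
    also have "\<dots> \<le> ennreal 2 * ?f s \<omega> + ennreal 2 * ennreal M"
      by (intro add_left_mono mult_left_mono M(1) True that) auto
    finally show ?thesis using True M(2) by (simp add: ennreal_mult[symmetric] del: ennreal_numeral)
  qed simp
  have "?M (?I n)
      = (\<integral>\<^sup>+\<omega>. ?W \<omega> \<partial>P)"
    by (rule ito_isometry(2)[OF xs t(2)])
  also have "\<dots> \<le> (\<integral>\<^sup>+\<omega>. ennreal 2 * ?F \<omega> + ennreal (2 * M * t) \<partial>P)"
  proof (rule nn_integral_mono)
    fix \<omega> assume \<omega>: "\<omega> \<in> space P"
    have "?W \<omega>
       \<le> (\<integral>\<^sup>+s. ennreal 2 * (?f s \<omega> * indicator {0..t} s) + ennreal (2 * M) * indicator {0..t} s \<partial>lborel)"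
      by (intro nn_integral_mono pw \<omega>)
    also have "\<dots> \<le> ennreal 2 * ?F \<omega> + (\<integral>\<^sup>+s. ennreal (2 * M) * indicator {0..t} s \<partial>lborel)"
      by (rule nn_integral_cmult_add_le) (auto simp: indicator_def)
    also have "(\<integral>\<^sup>+s. ennreal (2 * M) * indicator {0..t} s \<partial>lborel) = ennreal (2 * M * t)"
      using t M(2) by (simp add: nn_integral_cmult_indicator ennreal_mult[symmetric])
    finally show "?W \<omega>
      \<le> ennreal 2 * ?F \<omega> + ennreal (2 * M * t)" .
  qed
  also have "\<dots> \<le> ennreal 2 * (\<integral>\<^sup>+\<omega>. ?F \<omega> \<partial>P) + (\<integral>\<^sup>+\<omega>. ennreal (2 * M * t) \<partial>P)"
    by (rule nn_integral_cmult_add_le) auto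
  also have "\<dots> \<le> ennreal 2 * 1 + ennreal (2 * M * t)"
    using n(2) by (intro add_mono mult_left_mono) (auto simp: emeasure_space_1)
  also have "\<dots> = ennreal (2 + 2 * M * t)"
    using M(2) t by (simp add: ennreal_plus)
  finally have E: "?M (?I n) \<le> ennreal (2 + 2 * M * t)" .
  have "?M X \<le> (\<integral>\<^sup>+\<omega>. ennreal 2 * ennreal ((norm (?I n \<omega> - X \<omega>))\<^sup>2)
      + ennreal 2 * ennreal ((norm (?I n \<omega>))\<^sup>2) \<partial>P)"
  proof (rule nn_integral_mono)
    fix \<omega>
    have "(norm (X \<omega>))\<^sup>2 \<le> 2 * (norm (?I n \<omega> - X \<omega>))\<^sup>2 + 2 * (norm (?I n \<omega>))\<^sup>2"
      using norm_add_square_le[of "X \<omega> - ?I n \<omega>" "?I n \<omega>"]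
      by (simp add: norm_minus_commute)
    then show "ennreal ((norm (X \<omega>))\<^sup>2) \<le> ennreal 2 * ennreal ((norm (?I n \<omega> - X \<omega>))\<^sup>2)
      + ennreal 2 * ennreal ((norm (?I n \<omega>))\<^sup>2)"
      by (simp add: ennreal_mult[symmetric] ennreal_plus[symmetric] del: ennreal_plus ennreal_numeral)
  qed
  also have "\<dots> = ennreal 2 * d n + ennreal 2 * ?M (?I n)"
    unfolding d_def by (simp add: nn_integral_add nn_integral_cmult del: ennreal_numeral)
  also have "\<dots> \<le> ennreal 2 * 1 + ennreal 2 * ennreal (2 + 2 * M * t)"
    using n(1) E by (intro add_mono mult_left_mono) auto
  also have "\<dots> = ennreal (6 + 4 * M * t)"
  proof -
    have "ennreal 2 * 1 + ennreal 2 * ennreal (2 + 2 * M * t) = ennreal (2 + 2 * (2 + 2 * M * t))"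
      using M(2) t by (simp add: ennreal_mult[symmetric] ennreal_plus[symmetric] del: ennreal_plus ennreal_numeral)
    then show ?thesis by (simp add: algebra_simps)
  qed
  finally show bound: ?C1 .
  assume l: "bounded_linear l"
  interpret l: bounded_linear l by fact
  obtain C where C: "\<And>x. norm (l x) \<le> norm x * C" "0 < C" using l.pos_bounded by auto
  have [measurable]: "l \<in> borel_measurable borel"
    by (intro borel_measurable_continuous_onI linear_continuous_on l)
  have sq: "integrable P (\<lambda>\<omega>. (norm (X \<omega>))\<^sup>2)"
    by (rule integrableI_nonneg) (use bound in \<open>auto intro: le_less_trans\<close>)
  have "integrable P (\<lambda>\<omega>. norm (X \<omega>) * 1)"
    by (intro integrable_mult_of_squares sq) auto
  then have "integrable P (\<lambda>\<omega>. norm (X \<omega>) * C)" by (intro integrable_mult_left) simp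
  then show int: "integrable P (\<lambda>\<omega>. l (X \<omega>))"
    by (rule Bochner_Integration.integrable_bound) (use C order_trans[OF C(1) abs_ge_self] in auto)
  \<comment> \<open>Compare X with an elementary integral within r in mean square. Nonnegativity of
    the variance turns this into distance at most r in mean, and l of the elementary integral has
    mean zero.\<close>
  have "\<bar>LINT \<omega>|P. l (X \<omega>)\<bar> \<le> C * r" if r: "0 < r" for r
  proof -
    obtain m where m: "d m < ennreal (r\<^sup>2)"
      using eventually_happens'[OF sequentially_bot ev[of "ennreal (r\<^sup>2)"]] r by auto
    let ?D = "\<lambda>\<omega>. ?I m \<omega> - X \<omega>"
    have D2: "integrable P (\<lambda>\<omega>. (norm (?D \<omega>))\<^sup>2)"
      by (rule integrableI_nonneg) (use m in \<open>auto simp: d_def intro: less_trans\<close>)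
    have "ennreal (LINT \<omega>|P. (norm (?D \<omega>))\<^sup>2) < ennreal (r\<^sup>2)"
      using m nn_integral_eq_integral[OF D2] by (simp add: d_def)
    then have D2r: "(LINT \<omega>|P. (norm (?D \<omega>))\<^sup>2) < r\<^sup>2" by (simp add: ennreal_less_iff)
    have "integrable P (\<lambda>\<omega>. norm (?D \<omega>) * 1)"
      by (intro integrable_mult_of_squares D2) auto
    then have D1: "integrable P (\<lambda>\<omega>. norm (?D \<omega>))" by simp
    have "(LINT \<omega>|P. norm (?D \<omega>))\<^sup>2 \<le> (LINT \<omega>|P. (norm (?D \<omega>))\<^sup>2)"
    proof -
      have "0 \<le> variance (\<lambda>\<omega>. norm (?D \<omega>))" by (rule variance_positive)
      then show ?thesis using variance_eq[OF D1 D2] by simp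
    qed
    then have "(LINT \<omega>|P. norm (?D \<omega>))\<^sup>2 \<le> r\<^sup>2" using D2r by simp
    then have Dr: "(LINT \<omega>|P. norm (?D \<omega>)) \<le> r" by (rule power2_le_imp_le) (use r in simp)
    have lD: "integrable P (\<lambda>\<omega>. l (?D \<omega>))" "(LINT \<omega>|P. l (?D \<omega>)) = - (LINT \<omega>|P. l (X \<omega>))"
      unfolding l.diff using int ito_isometry(3,4)[OF xs t(2) l, of m] by simp_all
    have "\<bar>LINT \<omega>|P. l (X \<omega>)\<bar> = norm (LINT \<omega>|P. l (?D \<omega>))" using lD(2) by simp
    also have "\<dots> \<le> (LINT \<omega>|P. norm (l (?D \<omega>)))" by (rule integral_norm_bound)
    also have "\<dots> \<le> (LINT \<omega>|P. norm (?D \<omega>) * C)"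
      using lD(1) D1 C(1) by (intro integral_mono integrable_norm integrable_mult_left)
    also have "\<dots> \<le> C * r" using D1 Dr C(2) by (simp add: mult.commute)
    finally show ?thesis .
  qed
  note small = this
  have "\<bar>LINT \<omega>|P. l (X \<omega>)\<bar> \<le> r" if "0 < r" for r
    using small[of "r / C"] that C(2) by simp
  from this have "\<bar>LINT \<omega>|P. l (X \<omega>)\<bar> \<le> 0" by (rule field_le_epsilon) simp
  then show "(LINT \<omega>|P. l (X \<omega>)) = 0" by simp
qed

end

section \<open>Bounds for the coefficients\<close>

text \<open>The rectangles that generate the predictable sigma-algebra are product measurable.
  Extension by zero outside [0, t] gives a function on the whole product space, where Fubini
  applies.\<close>

lemma predictable_measurable:
  fixes f :: "real \<times> 'w \<Rightarrow> 'b::real_normed_vector"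
  assumes P: "filtered_prob_space P F T" and t: "0 \<le> t" "t \<le> T"
    and f: "f \<in> borel_measurable (predictable P F t)"
  shows "(\<lambda>(s, \<omega>). indicator {0..t} s *\<^sub>R f (s, \<omega>)) \<in> borel_measurable (lborel \<Otimes>\<^sub>M P)"
proof -
  let ?\<Omega> = "{0..t} \<times> space P"
  let ?L = "lborel \<Otimes>\<^sub>M P" and ?R = "restrict_space (lborel \<Otimes>\<^sub>M P) ({0..t} \<times> space P)"
  let ?G = "{{0} \<times> A | A. A \<in> sets (F 0)} \<union> {{s<..r} \<times> A | s r A. 0 \<le> s \<and> s \<le> r \<and> r \<le> t \<and> A \<in> sets (F s)}"
  have F: "A \<in> sets P" if "0 \<le> s" "s \<le> t" "A \<in> sets (F s)" for s A
    using P that t unfolding filtered_prob_space_def subalgebra_def by force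
  have sub: "?G \<subseteq> Pow ?\<Omega>"
  proof
    fix X assume "X \<in> ?G"
    then consider A where "X = {0} \<times> A" "A \<in> sets (F 0)"
      | s r A where "X = {s<..r} \<times> A" "0 \<le> s" "s \<le> r" "r \<le> t" "A \<in> sets (F s)" by blast
    then show "X \<in> Pow ?\<Omega>"
    proof cases
      case 1
      then have "A \<subseteq> space P" using F[of 0 A] t sets.sets_into_space by auto
      then show ?thesis using 1 t by auto
    next
      case 2
      then have "A \<subseteq> space P" using F[of s A] sets.sets_into_space by auto
      then show ?thesis using 2 by auto
    qed
  qed
  have \<Omega>: "?\<Omega> \<in> sets ?L" by (intro pair_measureI) auto
  have "?G \<subseteq> sets ?L"
    using F t by (auto intro!: pair_measureI)
  then have "?G \<subseteq> sets ?R"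
    using sub \<Omega> by (intro subsetI) (subst sets_restrict_space_iff, simp, blast)
  moreover have "?\<Omega> \<in> sets ?R"
    using \<Omega> by (subst sets_restrict_space_iff) auto
  ultimately have sets: "sets (predictable P F t) \<subseteq> sets ?R"
    unfolding predictable_def sets_measure_of[OF sub] by (rule sets.sigma_sets_subset')
  have sp: "space (predictable P F t) = ?\<Omega>" "space ?R = ?\<Omega>"
    unfolding predictable_def using sets.sets_into_space[OF \<Omega>]
    by (auto simp: space_measure_of[OF sub] space_restrict_space)
  have "f \<in> borel_measurable ?R"
    using f sets unfolding measurable_def sp by auto
  then have "(\<lambda>x. indicator ?\<Omega> x *\<^sub>R f x) \<in> borel_measurable ?L"
    using \<Omega> by (subst (asm) borel_measurable_restrict_space_iff) auto
  also have "?this \<longleftrightarrow> ?thesis"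
    by (intro measurable_cong) (auto simp: space_pair_measure indicator_def)
  finally show ?thesis .
qed

text \<open>Common form of the coefficient estimates: c = 1 for the drift, c the time difference for
  differences of currents, c = 0 for multiplication by bounded functions. The factor 2 L is the root
  of 4 L^2, from (a + b + d)^2 \<le> 4 (a^2 + b^2 + d^2).\<close>

lemma norm_L2_le_of_bound:
  fixes f :: "'a::euclidean_space \<Rightarrow> 'b::euclidean_space" and u :: "('a, 'c::euclidean_space) L2" and v :: "('a, 'd::euclidean_space) L2"
  assumes f: "f \<in> borel_measurable lebesgue" and D: "D \<in> lmeasurable"
    and bound: "AE x in lebesgue. norm (f x) \<le> L * (c * indicator D x + norm (fn_L2 u x) + norm (fn_L2 v x))"
    and L: "0 \<le> L" and c: "0 \<le> c"
  shows "square_integrable f" "norm (to_L2 f) \<le> 2 * L * (c * sqrt (measure lebesgue D) + norm u + norm v)"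
proof -
  let ?g = "\<lambda>x. 4 * L\<^sup>2 * (c\<^sup>2 * indicator D x + (norm (fn_L2 u x))\<^sup>2 + (norm (fn_L2 v x))\<^sup>2)"
  have sq: "integrable lebesgue (\<lambda>x. (norm (fn_L2 w x))\<^sup>2)" for w :: "('a, 'e::euclidean_space) L2"
    using square_integrable_fn_L2[of w] by (simp add: square_integrable_def)
  have ind: "integrable lebesgue (indicator D :: 'a \<Rightarrow> real)"
    using D by (auto simp: fmeasurable_def integrable_real_indicator)
  have g: "integrable lebesgue ?g"
    by (intro integrable_mult_right Bochner_Integration.integrable_add sq ind)
  have le: "AE x in lebesgue. (norm (f x))\<^sup>2 \<le> ?g x"
    using bound
  proof eventually_elim
    case (elim x)
    have "(norm (f x))\<^sup>2 \<le> (L * (c * indicator D x + norm (fn_L2 u x) + norm (fn_L2 v x)))\<^sup>2"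
      by (rule power_mono[OF elim]) simp
    also have "\<dots> = L\<^sup>2 * (c * indicator D x + norm (fn_L2 u x) + norm (fn_L2 v x))\<^sup>2"
      by (simp add: power_mult_distrib)
    also have "\<dots> \<le> L\<^sup>2 * (4 * ((c * indicator D x)\<^sup>2 + (norm (fn_L2 u x))\<^sup>2 + (norm (fn_L2 v x))\<^sup>2))"
    proof (rule mult_left_mono)
      have "(a + b + d)\<^sup>2 \<le> 4 * (a\<^sup>2 + b\<^sup>2 + d\<^sup>2)" for a b d :: real
      proof -
        have "4 * (a\<^sup>2 + b\<^sup>2 + d\<^sup>2) - (a + b + d)\<^sup>2 = (a - b)\<^sup>2 + (a - d)\<^sup>2 + (b - d)\<^sup>2 + (a\<^sup>2 + b\<^sup>2 + d\<^sup>2)"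
          by (simp add: power2_eq_square algebra_simps)
        moreover have "0 \<le> (a - b)\<^sup>2 + (a - d)\<^sup>2 + (b - d)\<^sup>2 + (a\<^sup>2 + b\<^sup>2 + d\<^sup>2)" by simp
        ultimately show ?thesis by linarith
      qed
      then show "(c * indicator D x + norm (fn_L2 u x) + norm (fn_L2 v x))\<^sup>2
        \<le> 4 * ((c * indicator D x)\<^sup>2 + (norm (fn_L2 u x))\<^sup>2 + (norm (fn_L2 v x))\<^sup>2)" .
    qed simp
    also have "(c * indicator D x)\<^sup>2 = c\<^sup>2 * indicator D x" by (simp add: indicator_def power2_eq_square)
    finally show ?case by (simp add: algebra_simps)
  qed
  have int: "integrable lebesgue (\<lambda>x. (norm (f x))\<^sup>2)"
    by (rule Bochner_Integration.integrable_bound[OF g]) (use f le in \<open>auto elim: eventually_mono\<close>)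
  then show fsq: "square_integrable f" using f by (simp add: square_integrable_def)
  let ?m = "measure lebesgue D"
  have "(norm (to_L2 f))\<^sup>2 = (LINT x|lebesgue. (norm (f x))\<^sup>2)"
    unfolding norm_L2_square
    by (intro integral_cong_AE) (use f fn_L2_to_L2[OF fsq] in \<open>auto elim: eventually_mono\<close>)
  also have "\<dots> \<le> integral\<^sup>L lebesgue ?g" by (rule integral_mono_AE[OF int g le])
  also have "\<dots> = 4 * L\<^sup>2 * (c\<^sup>2 * ?m + (norm u)\<^sup>2 + (norm v)\<^sup>2)"
  proof -
    have "(LINT x|lebesgue. c\<^sup>2 * indicator D x + (norm (fn_L2 u x))\<^sup>2 + (norm (fn_L2 v x))\<^sup>2)
      = c\<^sup>2 * ?m + (norm u)\<^sup>2 + (norm v)\<^sup>2"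
      using sq[of u] sq[of v] ind by (simp add: norm_L2_square)
    then show ?thesis by simp
  qed
  also have "\<dots> \<le> (2 * L * (c * sqrt ?m + norm u + norm v))\<^sup>2"
  proof -
    have "a\<^sup>2 + b\<^sup>2 + d\<^sup>2 \<le> (a + b + d)\<^sup>2" if "0 \<le> a" "0 \<le> b" "0 \<le> d" for a b d :: real
      using that by (simp add: power2_eq_square algebra_simps)
    from mult_left_mono[OF this[of "c * sqrt ?m" "norm u" "norm v"], of "4 * L\<^sup>2"] c
    show ?thesis by (simp add: power_mult_distrib)
  qed
  finally show "norm (to_L2 f) \<le> 2 * L * (c * sqrt ?m + norm u + norm v)"
    by (rule power2_le_imp_le) (use L c in auto)
qed

section \<open>The weighted inner product and the tested divergence as a functional\<close>

locale maxwell_coefficients =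
  fixes D :: "r3 set" and \<delta> :: real and \<epsilon> \<mu> :: "r3 \<Rightarrow> real"
  assumes open_D: "open D" and bounded_D: "bounded D" and \<delta>: "0 < \<delta>"
    and \<epsilon>: "bounded_coefficient D \<delta> \<epsilon>" and \<mu>: "bounded_coefficient D \<delta> \<mu>"
begin

lemma D_lmeasurable: "D \<in> lmeasurable"
  using open_D bounded_D by (intro lmeasurable_open)

lemma D_sets [measurable]: "D \<in> sets lebesgue"
  using open_D by auto

end

lemma bounded_coefficientE:
  assumes "bounded_coefficient D \<delta> a"
  obtains C where "0 \<le> C" "(\<lambda>x. indicator D x * a x) \<in> borel_measurable lebesgue"
    "AE x in lebesgue. x \<in> D \<longrightarrow> \<delta> \<le> a x \<and> a x \<le> C"
proof -
  obtain C where C: "AE x in lebesgue. x \<in> D \<longrightarrow> \<delta> \<le> a x \<and> a x \<le> C"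
    and m: "set_borel_measurable lebesgue D a"
    using assms by (auto simp: bounded_coefficient_def)
  have "AE x in lebesgue. x \<in> D \<longrightarrow> \<delta> \<le> a x \<and> a x \<le> max C 0"
    using C by eventually_elim auto
  then show ?thesis using that[of "max C 0"] m by (simp add: set_borel_measurable_def)
qed

context maxwell_coefficients
begin

text \<open>The Riesz representative is the class of the gradient of \<phi> times -a, cut off to D.
  It shows that the tested divergence is a bounded linear functional of the field.\<close>

lemma weighted_divergence_inner:
  assumes a: "bounded_coefficient D \<delta> a" and \<phi>: "\<phi> \<in> test_fun D"
  shows "\<exists>g. \<forall>w. divergence D (\<lambda>x. a x *\<^sub>R fn_L2 w x) \<phi> = w \<bullet> g"
proof -
  obtain C where C: "0 \<le> C" and am: "(\<lambda>x. indicator D x * a x) \<in> borel_measurable lebesgue"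
    and bnd: "AE x in lebesgue. x \<in> D \<longrightarrow> \<delta> \<le> a x \<and> a x \<le> C"
    by (rule bounded_coefficientE[OF a])
  define aD where "aD x = indicator D x * a x" for x
  have [measurable]: "aD \<in> borel_measurable lebesgue" using am by (simp add: aD_def[abs_def])
  note [measurable] = grad_measurable[OF test_fun_smooth[OF \<phi>]]
  let ?f = "\<lambda>x. - aD x *\<^sub>R grad \<phi> x"
  have sq: "square_integrable ?f"
  proof (rule norm_L2_le_of_bound(1)[where D = D and L = C and c = 0 and u = "to_L2 (grad \<phi>)" and v = "0 :: (r3, real) L2"])
    show "AE x in lebesgue. norm (?f x) \<le> C * (0 * indicator D x + norm (fn_L2 (to_L2 (grad \<phi>)) x) + norm (fn_L2 (0 :: (r3, real) L2) x))"
      using bnd fn_L2_to_L2[OF square_integrable_grad[OF \<phi>]] fn_L2_zero[where 'a = r3 and 'b = real]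
      by eventually_elim (use \<delta> C in \<open>auto simp: aD_def indicator_def intro!: mult_right_mono\<close>)
  qed (use C D_lmeasurable in auto)
  have "divergence D (\<lambda>x. a x *\<^sub>R fn_L2 w x) \<phi> = w \<bullet> to_L2 ?f" for w
  proof -
    have "divergence D (\<lambda>x. a x *\<^sub>R fn_L2 w x) \<phi> = (LINT x|lebesgue. fn_L2 w x \<bullet> ?f x)"
      unfolding divergence_def set_lebesgue_integral_def Bochner_Integration.integral_minus[symmetric]
      by (intro Bochner_Integration.integral_cong) (auto simp: aD_def indicator_def)
    also have "\<dots> = w \<bullet> to_L2 ?f"
      unfolding inner_L2_def
      by (intro integral_cong_AE, measurable) (use fn_L2_to_L2[OF sq] in eventually_elim, simp)
    finally show ?thesis .
  qed
  then show ?thesis by blast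
qed

lemma weighted_square_bounds:
  assumes a: "bounded_coefficient D \<delta> a"
  shows "\<exists>C\<ge>0. \<forall>w :: (r3, r3) L2. w \<in> L2_on D \<longrightarrow> integrable lebesgue (\<lambda>x. indicator D x * (a x * (fn_L2 w x \<bullet> fn_L2 w x))) \<and>
    \<delta> * (norm w)\<^sup>2 \<le> (LINT x|lebesgue. indicator D x * (a x * (fn_L2 w x \<bullet> fn_L2 w x))) \<and>
    (LINT x|lebesgue. indicator D x * (a x * (fn_L2 w x \<bullet> fn_L2 w x))) \<le> C * (norm w)\<^sup>2"
proof -
  obtain C where C: "0 \<le> C" and am: "(\<lambda>x. indicator D x * a x) \<in> borel_measurable lebesgue"
    and bnd: "AE x in lebesgue. x \<in> D \<longrightarrow> \<delta> \<le> a x \<and> a x \<le> C"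
    by (rule bounded_coefficientE[OF a])
  define aD where "aD x = indicator D x * a x" for x
  have [measurable]: "aD \<in> borel_measurable lebesgue" using am by (simp add: aD_def[abs_def])
  show ?thesis
  proof (intro exI[of _ C] conjI allI impI, rule C)
    fix w :: "(r3, r3) L2" assume w: "w \<in> L2_on D"
    let ?h = "\<lambda>x. indicator D x * (a x * (fn_L2 w x \<bullet> fn_L2 w x))"
    have [measurable]: "?h \<in> borel_measurable lebesgue"
      unfolding mult.assoc[symmetric] aD_def[symmetric] by measurable
    have sq: "integrable lebesgue (\<lambda>x. (norm (fn_L2 w x))\<^sup>2)"
      using square_integrable_fn_L2[of w] by (simp add: square_integrable_def)
    have b: "AE x in lebesgue. \<delta> * (norm (fn_L2 w x))\<^sup>2 \<le> ?h x \<and> ?h x \<le> C * (norm (fn_L2 w x))\<^sup>2"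
      using bnd w[unfolded L2_on_def mem_Collect_eq]
      by eventually_elim (auto simp: indicator_def power2_norm_eq_inner intro!: mult_right_mono)
    have int: "integrable lebesgue ?h"
    proof (rule Bochner_Integration.integrable_bound)
      show "integrable lebesgue (\<lambda>x. C * (norm (fn_L2 w x))\<^sup>2)" using sq by simp
      show "AE x in lebesgue. norm (?h x) \<le> norm (C * (norm (fn_L2 w x))\<^sup>2)"
        using b
      proof eventually_elim
        case (elim x)
        have "0 \<le> \<delta> * (norm (fn_L2 w x))\<^sup>2" using \<delta> by simp
        then show ?case using elim C by simp
      qed
    qed measurable
    show "integrable lebesgue ?h" by (rule int)
    show "\<delta> * (norm w)\<^sup>2 \<le> integral\<^sup>L lebesgue ?h"
        unfolding norm_L2_square integral_mult_right_zero[symmetric]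
        by (rule integral_mono_AE) (use sq int b in \<open>auto elim: eventually_mono\<close>)
    show "integral\<^sup>L lebesgue ?h \<le> C * (norm w)\<^sup>2"
        unfolding norm_L2_square integral_mult_right_zero[symmetric]
        by (rule integral_mono_AE) (use sq int b in \<open>auto elim: eventually_mono\<close>)
  qed
qed

lemma norm_state_square: "(norm (v :: state))\<^sup>2 = (norm (fst v))\<^sup>2 + (norm (snd v))\<^sup>2"
  by (simp add: norm_prod_def)

lemma state_inner_bounds:
  "\<exists>C\<ge>0. \<forall>v\<in>state_space D. \<delta> * (norm v)\<^sup>2 \<le> state_inner D \<epsilon> \<mu> v v \<and> state_inner D \<epsilon> \<mu> v v \<le> C * (norm v)\<^sup>2"
proof -
  let ?q = "\<lambda>a (w :: (r3, r3) L2) x. indicator D x * (a x * (fn_L2 w x \<bullet> fn_L2 w x))"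
  obtain C1 where C1: "0 \<le> C1" "\<And>w. w \<in> L2_on D \<Longrightarrow> integrable lebesgue (?q \<epsilon> w) \<and>
    \<delta> * (norm w)\<^sup>2 \<le> integral\<^sup>L lebesgue (?q \<epsilon> w) \<and>
    integral\<^sup>L lebesgue (?q \<epsilon> w) \<le> C1 * (norm w)\<^sup>2"
    using weighted_square_bounds[OF \<epsilon>] by blast
  obtain C2 where C2: "0 \<le> C2" "\<And>w. w \<in> L2_on D \<Longrightarrow> integrable lebesgue (?q \<mu> w) \<and>
    \<delta> * (norm w)\<^sup>2 \<le> integral\<^sup>L lebesgue (?q \<mu> w) \<and>
    integral\<^sup>L lebesgue (?q \<mu> w) \<le> C2 * (norm w)\<^sup>2"
    using weighted_square_bounds[OF \<mu>] by blast
  have "\<delta> * (norm v)\<^sup>2 \<le> state_inner D \<epsilon> \<mu> v v \<and> state_inner D \<epsilon> \<mu> v v \<le> (C1 + C2) * (norm v)\<^sup>2"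
    if v: "v \<in> state_space D" for v
  proof -
    have f: "fst v \<in> L2_on D" and s: "snd v \<in> L2_on D" using v by (auto simp: state_space_def)
    let ?f = "LINT x|lebesgue. indicator D x * (\<epsilon> x * (fn_L2 (fst v) x \<bullet> fn_L2 (fst v) x))"
    let ?s = "LINT x|lebesgue. indicator D x * (\<mu> x * (fn_L2 (snd v) x \<bullet> fn_L2 (snd v) x))"
    have "state_inner D \<epsilon> \<mu> v v = ?f + ?s"
      unfolding state_inner_def set_lebesgue_integral_def
      using C1(2)[OF f] C2(2)[OF s] by (simp add: distrib_left)
    moreover have "?f \<le> (C1 + C2) * (norm (fst v))\<^sup>2"
      using C1(2)[OF f] mult_nonneg_nonneg[OF C2(1) zero_le_power2[of "norm (fst v)"]] unfolding distrib_right by linarith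
    moreover have "?s \<le> (C1 + C2) * (norm (snd v))\<^sup>2"
      using C2(2)[OF s] mult_nonneg_nonneg[OF C1(1) zero_le_power2[of "norm (snd v)"]] unfolding distrib_right by linarith
    ultimately show ?thesis
      using C1(2)[OF f] C2(2)[OF s] unfolding norm_state_square distrib_left by linarith
  qed
  then show ?thesis using C1(1) C2(1) by (intro exI[of _ "C1 + C2"]) auto
qed

text \<open>Stated for every v of the type, because \<open>graph_norm\<close> evaluates the form at
  a \<open>THE\<close> term that has not been shown to lie in the state space.\<close>

lemma state_inner_nonneg: "0 \<le> state_inner D \<epsilon> \<mu> v v"
proof -
  obtain C1 where "AE x in lebesgue. x \<in> D \<longrightarrow> \<delta> \<le> \<epsilon> x \<and> \<epsilon> x \<le> C1" using \<epsilon> by (auto simp: bounded_coefficient_def)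
  moreover obtain C2 where "AE x in lebesgue. x \<in> D \<longrightarrow> \<delta> \<le> \<mu> x \<and> \<mu> x \<le> C2" using \<mu> by (auto simp: bounded_coefficient_def)
  ultimately have "AE x in lebesgue. 0 \<le> indicator D x *\<^sub>R (\<epsilon> x * (fn_L2 (fst v) x \<bullet> fn_L2 (fst v) x) + \<mu> x * (fn_L2 (snd v) x \<bullet> fn_L2 (snd v) x))"
    by eventually_elim (use \<delta> in \<open>auto simp: indicator_def\<close>)
  then show ?thesis unfolding state_inner_def set_lebesgue_integral_def by (rule integral_nonneg_AE)
qed

lemma graph_norm_ge:
  assumes "v \<in> state_space D"
  shows "sqrt \<delta> * norm v \<le> graph_norm D \<epsilon> \<mu> v"
proof -
  have "\<delta> * (norm v)\<^sup>2 \<le> state_inner D \<epsilon> \<mu> v v" using state_inner_bounds assms by blast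
  then have "sqrt (\<delta> * (norm v)\<^sup>2) \<le> graph_norm D \<epsilon> \<mu> v"
    unfolding graph_norm_def Let_def by (intro real_sqrt_le_mono add_increasing2 state_inner_nonneg)
  then show ?thesis by (simp add: real_sqrt_mult)
qed

lemma subspace_L2_on: "subspace (L2_on D :: (r3, 'b::euclidean_space) L2 set)"
proof (rule subspaceI)
  fix u v :: "(r3, 'b) L2" and c :: real
  show "0 \<in> (L2_on D :: (r3, 'b) L2 set)" by (rule zero_in_L2_on)
  assume u: "u \<in> L2_on D"
  show "c *\<^sub>R u \<in> L2_on D"
    using u fn_L2_scaleR[of c u] unfolding L2_on_def mem_Collect_eq by eventually_elim auto
  assume v: "v \<in> L2_on D"
  show "u + v \<in> L2_on D"
    using u v fn_L2_add[of u v] unfolding L2_on_def mem_Collect_eq by eventually_elim auto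
qed

lemma subspace_state_space: "subspace (state_space D)"
  unfolding state_space_def by (rule subspace_Times[OF subspace_L2_on subspace_L2_on])

text \<open>The constant, the root of C / \<delta>, is the price of passing from the norm of the
  type to the weighted norm and back. Unitarity makes it independent of t.\<close>

lemma unitary_group_bounded:
  assumes S: "unitary_group_on (state_space D) (state_inner D \<epsilon> \<mu>) S"
  shows "\<exists>K\<ge>0. \<forall>t. \<forall>v\<in>state_space D. norm (S t v) \<le> K * norm v"
proof -
  obtain C where C: "0 \<le> C" "\<And>v. v \<in> state_space D \<Longrightarrow> \<delta> * (norm v)\<^sup>2 \<le> state_inner D \<epsilon> \<mu> v v"
    "\<And>v. v \<in> state_space D \<Longrightarrow> state_inner D \<epsilon> \<mu> v v \<le> C * (norm v)\<^sup>2"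
    using state_inner_bounds by blast
  have "norm (S t v) \<le> sqrt (C / \<delta>) * norm v" if v: "v \<in> state_space D" for t v
  proof -
    have Sv: "S t v \<in> state_space D" using S v by (auto simp: unitary_group_on_def linear_operator_on_def)
    have "\<delta> * (norm (S t v))\<^sup>2 \<le> state_inner D \<epsilon> \<mu> (S t v) (S t v)" by (rule C(2)[OF Sv])
    also have "\<dots> = state_inner D \<epsilon> \<mu> v v" using S v by (simp add: unitary_group_on_def)
    also have "\<dots> \<le> C * (norm v)\<^sup>2" by (rule C(3)[OF v])
    finally have "(norm (S t v))\<^sup>2 \<le> (sqrt (C / \<delta>) * norm v)\<^sup>2"
      using \<delta> C(1) by (simp add: power_mult_distrib field_simps)
    then show ?thesis by (rule power2_le_imp_le) (use \<delta> C(1) in simp)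
  qed
  then show ?thesis using \<delta> C(1) by (intro exI[of _ "sqrt (C / \<delta>)"]) auto
qed

lemma state_inner_grad:
  assumes \<phi>: "\<phi> \<in> test_fun D"
  shows "state_inner D \<epsilon> \<mu> v (to_L2 (grad \<phi>), 0) = - divergence D (\<lambda>x. \<epsilon> x *\<^sub>R fn_L2 (fst v) x) \<phi>" (is ?C1)
    and "state_inner D \<epsilon> \<mu> v (0, to_L2 (grad \<phi>)) = - divergence D (\<lambda>x. \<mu> x *\<^sub>R fn_L2 (snd v) x) \<phi>" (is ?C2)
proof -
  define eD mD where "eD x = indicator D x * \<epsilon> x" and "mD x = indicator D x * \<mu> x" for x
  have [measurable]: "eD \<in> borel_measurable lebesgue" "mD \<in> borel_measurable lebesgue"
    using \<epsilon> \<mu> by (simp_all add: eD_def[abs_def] mD_def[abs_def] bounded_coefficient_def set_borel_measurable_def)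
  note [measurable] = grad_measurable[OF test_fun_smooth[OF \<phi>]]
  note g = fn_L2_to_L2[OF square_integrable_grad[OF \<phi>]] fn_L2_zero[where 'a = r3 and 'b = r3]
  have e: "indicator D x *\<^sub>R (p * a + q * b) = (indicator D x * p) * a + (indicator D x * q) * b"
    "indicator D x *\<^sub>R ((p *\<^sub>R y) \<bullet> z) = (indicator D x * p) * (y \<bullet> z)" for x p q a b and y z :: r3
    by (auto simp: indicator_def)
  show ?C1
    unfolding state_inner_def divergence_def set_lebesgue_integral_def minus_minus e eD_def[symmetric] mD_def[symmetric]
    by (intro integral_cong_AE, measurable) (use g in eventually_elim, simp)
  show ?C2
    unfolding state_inner_def divergence_def set_lebesgue_integral_def minus_minus e eD_def[symmetric] mD_def[symmetric]
    by (intro integral_cong_AE, measurable) (use g in eventually_elim, simp)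
qed

lemma divergence_group_invariant:
  assumes S: "unitary_group_on (state_space D) (state_inner D \<epsilon> \<mu>) S"
    and gen: "generator (state_space D) S = maxwell D \<epsilon> \<mu>"
    and \<phi>: "\<phi> \<in> test_fun D" and v: "v \<in> state_space D"
  shows "divergence D (\<lambda>x. \<epsilon> x *\<^sub>R fn_L2 (fst (S t v)) x) \<phi> = divergence D (\<lambda>x. \<epsilon> x *\<^sub>R fn_L2 (fst v) x) \<phi>" (is ?C1)
    and "divergence D (\<lambda>x. \<mu> x *\<^sub>R fn_L2 (snd (S t v)) x) \<phi> = divergence D (\<lambda>x. \<mu> x *\<^sub>R fn_L2 (snd v) x) \<phi>" (is ?C2)
proof -
  obtain K where K: "0 \<le> K" "\<And>t v. v \<in> state_space D \<Longrightarrow> norm (S t v) \<le> K * norm v"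
    using unitary_group_bounded[OF S] by blast
  have *: "state_inner D \<epsilon> \<mu> (S t v) w = state_inner D \<epsilon> \<mu> v w" if "(w, 0) \<in> maxwell D \<epsilon> \<mu>" for w
  proof -
    have w: "(w, 0) \<in> generator (state_space D) S" using that gen by simp
    then have "w \<in> state_space D" by (simp add: generator_def)
    moreover have "S t w = w" by (rule unitary_group_fixes_kernel[OF S subspace_state_space K(2) w])
    ultimately show ?thesis using S v by (metis unitary_group_on_def)
  qed
  show ?C1
    using *[OF maxwell_kernel(1)[OF open_D \<phi>]] by (simp add: state_inner_grad[OF \<phi>])
  show ?C2
    using *[OF maxwell_kernel(2)[OF open_D \<phi>]] by (simp add: state_inner_grad[OF \<phi>])
qed

end

section \<open>Growth, measurability and continuity of drift and diffusion\<close>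

context maxwell_coefficients
begin

lemma norm_state_le: "norm (v :: state) \<le> norm (fst v) + norm (snd v)"
  using norm_Pair_le[of "fst v" "snd v"] by simp

lemma norm_state_ge: "norm (fst (v :: state)) \<le> norm v" "norm (snd (v :: state)) \<le> norm v"
  using norm_fst_le[of "fst v" "snd v"] norm_snd_le[of "snd v" "fst v"] by simp_all

text \<open>As D is open, the current at time t cut off to D in its space variable is Borel in all
  its arguments; it is composed with the point and the two Lebesgue measurable
  representatives.\<close>

lemma at_state_measurable:
  assumes J: "lipschitz_current D T L J" and t: "t \<in> {0..T}"
  shows "(\<lambda>x. indicator D x *\<^sub>R at_state J t v x) \<in> borel_measurable lebesgue"
proof -
  let ?A = "D \<times> (UNIV :: r3 set) \<times> (UNIV :: r3 set)"
  let ?J = "\<lambda>(x, a, b). J t x a b"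
  have "continuous_on ({0..T} \<times> ?A) (\<lambda>(t, x, a, b). J t x a b)" using J by (simp add: lipschitz_current_def)
  then have "continuous_on ?A (\<lambda>p. (\<lambda>(t, x, a, b). J t x a b) (t, p))"
    by (rule continuous_on_compose2) (use t in \<open>auto intro!: continuous_intros\<close>)
  then have c: "continuous_on ?A ?J" by (simp add: split_beta)
  have "open ?A" using open_D by (intro open_Times) auto
  then have m: "(\<lambda>p. indicator ?A p *\<^sub>R ?J p) \<in> borel_measurable borel"
    by (intro borel_measurable_continuous_on_indicator c) auto
  have x: "(\<lambda>x :: r3. x) \<in> borel_measurable lebesgue" by (intro measurable_completion) simp
  have "(\<lambda>x. (x, fn_L2 (fst v) x, fn_L2 (snd v) x)) \<in> borel_measurable lebesgue"
    by (intro borel_measurable_Pair x fn_L2_measurable)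
  from measurable_compose[OF this m]
  show ?thesis by (simp add: at_state_def indicator_def cong: if_cong)
qed

lemma at_state_bound:
  assumes J: "lipschitz_current D T L J" and t: "t \<in> {0..T}" and x: "x \<in> D"
  shows "norm (at_state J t v x) \<le> L * (1 + norm (fn_L2 (fst v) x) + norm (fn_L2 (snd v) x))"
  using J t x by (simp add: lipschitz_current_def at_state_def)

lemma at_state_diff_bound:
  assumes J: "lipschitz_current D T L J" and t: "t \<in> {0..T}" "s \<in> {0..T}" and x: "x \<in> D"
  shows "norm (at_state J t v x - at_state J s w x) \<le>
    L * (\<bar>t - s\<bar> + norm (fn_L2 (fst v) x - fn_L2 (fst w) x) + norm (fn_L2 (snd v) x - fn_L2 (snd w) x))"
  using J t x by (simp add: lipschitz_current_def at_state_def)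

text \<open>The tested divergence inherits a Lipschitz bound in (t, v) jointly from the current.
  Continuity is what makes the divergence along a path jointly measurable in time and
  \<omega>.\<close>

lemma current_divergence_continuous:
  assumes J: "lipschitz_current D T L J" and L: "0 < L" and \<phi>: "\<phi> \<in> test_fun D"
  shows "continuous_on ({0..T} \<times> UNIV) (\<lambda>(t, v). divergence D (at_state J t v) \<phi>)"
proof -
  let ?m = "sqrt (measure lebesgue D)"
  define j where "j t v x = indicator D x *\<^sub>R at_state J t v x" for t v x
  have [measurable]: "j t v \<in> borel_measurable lebesgue" if "t \<in> {0..T}" for t v
    using at_state_measurable[OF J that] by (simp add: j_def[abs_def])
  have sq: "square_integrable (j t v)" if t: "t \<in> {0..T}" for t v
  proof (rule norm_L2_le_of_bound(1)[where D = D and L = L and c = 1 and u = "fst v" and v = "snd v"])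
    show "AE x in lebesgue. norm (j t v x) \<le> L * (1 * indicator D x + norm (fn_L2 (fst v) x) + norm (fn_L2 (snd v) x))"
      using at_state_bound[OF J t, of _ v] L by (intro AE_I2) (auto simp: j_def indicator_def)
  qed (use t L D_lmeasurable in auto)
  note [measurable] = grad_measurable[OF test_fun_smooth[OF \<phi>]]
  define G where "G = to_L2 (grad \<phi>)"
  have div: "divergence D (at_state J t v) \<phi> = - (to_L2 (j t v) \<bullet> G)" if t: "t \<in> {0..T}" for t v
  proof -
    have "(LINT x:D|lebesgue. at_state J t v x \<bullet> grad \<phi> x) = (LINT x|lebesgue. j t v x \<bullet> grad \<phi> x)"
      unfolding set_lebesgue_integral_def j_def by simp
    also have "\<dots> = to_L2 (j t v) \<bullet> G"
      unfolding inner_L2_def G_def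
      using t by (intro integral_cong_AE, measurable)
        (use fn_L2_to_L2[OF sq[OF t, of v]] fn_L2_to_L2[OF square_integrable_grad[OF \<phi>]] in eventually_elim, simp)
    finally show ?thesis by (simp add: divergence_def)
  qed
  \<comment> \<open>From \<open>norm_L2_le_of_bound\<close> with c = |t - s|: the root of the
    measure of D belongs to the time difference, the summand 2 to the two components of the
    state.\<close>
  define K where "K = 2 * L * (?m + 2) * norm G"
  have lip: "\<bar>divergence D (at_state J t v) \<phi> - divergence D (at_state J s w) \<phi>\<bar> \<le> K * (\<bar>t - s\<bar> + norm (v - w))"
    if ts: "t \<in> {0..T}" "s \<in> {0..T}" for t s v w
  proof -
    let ?d = "\<bar>t - s\<bar> + norm (v - w)"
    have "norm (to_L2 (\<lambda>x. j t v x - j s w x)) \<le> 2 * L * (\<bar>t - s\<bar> * ?m + norm (fst v - fst w) + norm (snd v - snd w))"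
    proof (rule norm_L2_le_of_bound(2))
      show "AE x in lebesgue. norm (j t v x - j s w x)
        \<le> L * (\<bar>t - s\<bar> * indicator D x + norm (fn_L2 (fst v - fst w) x) + norm (fn_L2 (snd v - snd w) x))"
        using fn_L2_diff[of "fst v" "fst w"] fn_L2_diff[of "snd v" "snd w"]
      proof eventually_elim
        case (elim x)
        then show ?case using at_state_diff_bound[OF J ts, of x v w] L by (cases "x \<in> D") (auto simp: j_def)
      qed
    qed (use ts L D_lmeasurable in auto)
    also have "to_L2 (\<lambda>x. j t v x - j s w x) = to_L2 (j t v) - to_L2 (j s w)"
      unfolding L2_eq_iff
      using fn_L2_to_L2[OF square_integrable_diff[OF sq[OF ts(1)] sq[OF ts(2)], of v w]] fn_L2_diff[of "to_L2 (j t v)" "to_L2 (j s w)"]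
        fn_L2_to_L2[OF sq[OF ts(1), of v]] fn_L2_to_L2[OF sq[OF ts(2), of w]]
      by eventually_elim simp
    also have "2 * L * (\<bar>t - s\<bar> * ?m + norm (fst v - fst w) + norm (snd v - snd w))
      \<le> 2 * L * ((?m + 2) * ?d)"
    proof (rule mult_left_mono)
      have "norm (fst v - fst w) \<le> norm (v - w)" "norm (snd v - snd w) \<le> norm (v - w)"
        using norm_state_ge[of "v - w"] by simp_all
      moreover have "0 \<le> ?m * norm (v - w)" by simp
      ultimately have "norm (fst v - fst w) + norm (snd v - snd w) \<le> 2 * norm (v - w) + ?m * norm (v - w)"
        by linarith
      from add_increasing[OF _ this, of "2 * \<bar>t - s\<bar>"]
      have "norm (fst v - fst w) + norm (snd v - snd w) \<le> 2 * \<bar>t - s\<bar> + (2 * norm (v - w) + ?m * norm (v - w))"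
        by simp
      then show "\<bar>t - s\<bar> * ?m + norm (fst v - fst w) + norm (snd v - snd w)
        \<le> (?m + 2) * ?d"
        by (simp add: algebra_simps)
    qed (use L in simp)
    finally have "norm (to_L2 (j t v) - to_L2 (j s w)) * norm G \<le> 2 * L * ((?m + 2) * ?d) * norm G"
      by (rule mult_right_mono) simp
    moreover have "\<bar>(to_L2 (j t v) - to_L2 (j s w)) \<bullet> G\<bar> \<le> norm (to_L2 (j t v) - to_L2 (j s w)) * norm G"
      by (rule Cauchy_Schwarz_ineq2)
    moreover have "\<bar>divergence D (at_state J t v) \<phi> - divergence D (at_state J s w) \<phi>\<bar> = \<bar>(to_L2 (j t v) - to_L2 (j s w)) \<bullet> G\<bar>"
      unfolding div[OF ts(1)] div[OF ts(2)] inner_diff_left by simp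
    moreover have "2 * L * ((?m + 2) * ?d) * norm G = K * ?d"
      by (simp only: K_def mult_ac)
    ultimately show ?thesis by (simp only: order_trans)
  qed
  show ?thesis
    unfolding continuous_on_sequentially comp_def split_beta
  proof (intro allI impI ballI, elim conjE)
    fix x :: "nat \<Rightarrow> real \<times> state" and a :: "real \<times> state" assume a: "a \<in> {0..T} \<times> UNIV" and x: "\<forall>n. x n \<in> {0..T} \<times> UNIV" "x \<longlonglongrightarrow> a"
    show "(\<lambda>n. divergence D (at_state J (fst (x n)) (snd (x n))) \<phi>) \<longlonglongrightarrow> divergence D (at_state J (fst a) (snd a)) \<phi>"
    proof (rule LIM_zero_cancel, rule Lim_null_comparison)
      show "\<forall>\<^sub>F n in sequentially. norm (divergence D (at_state J (fst (x n)) (snd (x n))) \<phi> - divergence D (at_state J (fst a) (snd a)) \<phi>)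
        \<le> K * (\<bar>fst (x n) - fst a\<bar> + norm (snd (x n) - snd a))"
        using lip a x(1) by (intro always_eventually) (auto simp: mem_Times_iff)
      have "(\<lambda>n. K * (\<bar>fst (x n) - fst a\<bar> + norm (snd (x n) - snd a))) \<longlonglongrightarrow> K * (\<bar>fst a - fst a\<bar> + norm (snd a - snd a))"
        by (intro tendsto_intros tendsto_fst[OF x(2)] tendsto_snd[OF x(2)])
      then show "(\<lambda>n. K * (\<bar>fst (x n) - fst a\<bar> + norm (snd (x n) - snd a))) \<longlonglongrightarrow> 0" by simp
    qed
  qed
qed

text \<open>The factor 1 / a in the drift cancels against the weight a in the divergence and leaves
  the bare current; the lower bound \<delta> of a controls the norm.\<close>

lemma drift_component:
  assumes a: "bounded_coefficient D \<delta> a" and J: "lipschitz_current D T L J" and L: "0 < L"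
    and t: "t \<in> {0..T}" and \<phi>: "\<phi> \<in> test_fun D"
  defines "f \<equiv> \<lambda>v x. if x \<in> D then - (1 / a x) *\<^sub>R at_state J t v x else 0"
  shows "to_L2 (f v) \<in> L2_on D"
    and "norm (to_L2 (f v)) \<le> 2 * (L / \<delta>) * (sqrt (measure lebesgue D) + norm (fst v) + norm (snd v))" (is ?C2)
    and "divergence D (\<lambda>x. a x *\<^sub>R fn_L2 (to_L2 (f v)) x) \<phi> = - divergence D (at_state J t v) \<phi>" (is ?C3)
proof -
  obtain C where am: "(\<lambda>x. indicator D x * a x) \<in> borel_measurable lebesgue"
    and bnd: "AE x in lebesgue. x \<in> D \<longrightarrow> \<delta> \<le> a x \<and> a x \<le> C"
    using a by (auto simp: bounded_coefficient_def set_borel_measurable_def)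
  define aD where "aD x = indicator D x * a x" for x
  have [measurable]: "aD \<in> borel_measurable lebesgue" using am by (simp add: aD_def[abs_def])
  define j where "j x = indicator D x *\<^sub>R at_state J t v x" for x
  have [measurable]: "j \<in> borel_measurable lebesgue"
    using at_state_measurable[OF J t] by (simp add: j_def[abs_def])
  note [measurable] = grad_measurable[OF test_fun_smooth[OF \<phi>]]
  \<comment> \<open>Outside D both \<open>aD\<close> and \<open>j\<close> are 0, and inverse 0 = 0,
    so one measurable formula covers the case distinction.\<close>
  have f_eq: "f v = (\<lambda>x. - inverse (aD x) *\<^sub>R j x)"
    by (auto simp: f_def aD_def j_def fun_eq_iff indicator_def inverse_eq_divide)
  have m: "f v \<in> borel_measurable lebesgue" unfolding f_eq by measurable
  have b: "AE x in lebesgue. norm (f v x) \<le> (L / \<delta>) * (1 * indicator D x + norm (fn_L2 (fst v) x) + norm (fn_L2 (snd v) x))"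
    using bnd
  proof eventually_elim
    case (elim x)
    show ?case
    proof (cases "x \<in> D")
      case True
      have "norm (f v x) = norm (at_state J t v x) / \<bar>a x\<bar>" using True by (simp add: f_def divide_inverse mult.commute)
      also have "\<dots> \<le> (L * (1 + norm (fn_L2 (fst v) x) + norm (fn_L2 (snd v) x))) / \<delta>"
        using elim True \<delta> L by (intro frac_le at_state_bound[OF J t]) auto
      finally show ?thesis using True by simp
    qed (use L \<delta> in \<open>simp add: f_def\<close>)
  qed
  have L\<delta>: "0 \<le> L / \<delta>" using L \<delta> by simp
  note est = norm_L2_le_of_bound[OF m D_lmeasurable b L\<delta>]
  show ?C2
    using est(2) by simp
  have sq: "square_integrable (f v)" using est(1) by simp
  show "to_L2 (f v) \<in> L2_on D" by (rule to_L2_in_L2_on[OF sq]) (simp add: f_def)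
  have "(LINT x:D|lebesgue. (a x *\<^sub>R fn_L2 (to_L2 (f v)) x) \<bullet> grad \<phi> x) = (LINT x|lebesgue. aD x * (fn_L2 (to_L2 (f v)) x \<bullet> grad \<phi> x))"
    unfolding set_lebesgue_integral_def aD_def by (simp add: mult.assoc)
  also have "\<dots> = (LINT x|lebesgue. - (j x \<bullet> grad \<phi> x))"
  proof (intro integral_cong_AE, measurable)
    show "AE x in lebesgue. aD x * (fn_L2 (to_L2 (f v)) x \<bullet> grad \<phi> x) = - (j x \<bullet> grad \<phi> x)"
      using fn_L2_to_L2[OF sq] bnd
      by eventually_elim (use \<delta> in \<open>auto simp: f_def aD_def j_def indicator_def\<close>)
  qed
  also have "\<dots> = - (LINT x:D|lebesgue. at_state J t v x \<bullet> grad \<phi> x)"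
    unfolding set_lebesgue_integral_def j_def by simp
  finally show ?C3
    by (simp add: divergence_def)
qed

text \<open>Supplies a test function to \<open>drift_component\<close> where its membership and norm
  claims are wanted.\<close>

lemma zero_test_fun: "(\<lambda>_. 0) \<in> test_fun D"
proof -
  have p: "partial i (\<lambda>_. 0) = (\<lambda>_. 0)" for i by (simp add: partial_def fun_eq_iff)
  have "C_k k (\<lambda>_. 0)" for k by (induction k) (simp_all add: p)
  then show ?thesis by (simp add: test_fun_def smooth_def)
qed

lemma drift_bounds:
  assumes Je: "lipschitz_current D T L Je" and Jm: "lipschitz_current D T L Jm" and L: "0 < L"
  shows "\<exists>C\<ge>0. \<forall>t\<in>{0..T}. \<forall>v. drift D \<epsilon> \<mu> Je Jm t v \<in> state_space D \<and> norm (drift D \<epsilon> \<mu> Je Jm t v) \<le> C * (1 + norm v)"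
proof -
  let ?F = "drift D \<epsilon> \<mu> Je Jm"
  let ?m = "sqrt (measure lebesgue D)"
  let ?C = "4 * (L / \<delta>) * (?m + 2)"
  have "?F t v \<in> state_space D \<and> norm (?F t v) \<le> ?C * (1 + norm v)" if t: "t \<in> {0..T}" for t v
  proof
    note e = drift_component[OF \<epsilon> Je L t zero_test_fun, of v] and m = drift_component[OF \<mu> Jm L t zero_test_fun, of v]
    show "?F t v \<in> state_space D"
      using e(1) m(1) by (simp add: drift_def state_space_def)
    have "norm (?F t v) \<le> 2 * (2 * (L / \<delta>) * (?m + norm (fst v) + norm (snd v)))"
      using norm_state_le[of "?F t v"] e(2) m(2) unfolding drift_def fst_conv snd_conv by linarith
    also have "\<dots> = 4 * (L / \<delta>) * (?m + norm (fst v) + norm (snd v))" by simp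
    also have "\<dots> \<le> 4 * (L / \<delta>) * ((?m + 2) * (1 + norm v))"
    proof (rule mult_left_mono)
      have "0 \<le> ?m * norm v" by simp
      then have "norm (fst v) + norm (snd v) \<le> 2 + (2 * norm v + ?m * norm v)"
        using norm_state_ge[of v] by linarith
      then show "?m + norm (fst v) + norm (snd v) \<le> (?m + 2) * (1 + norm v)"
        by (simp add: algebra_simps)
    qed (use L \<delta> in simp)
    finally show "norm (?F t v) \<le> ?C * (1 + norm v)" by (simp add: mult.assoc)
  qed
  then show ?thesis using L \<delta> by (intro exI[of _ ?C]) auto
qed

lemma diffusion_component:
  assumes a: "bounded_coefficient D \<delta> a" and J: "bounded_current D T J"
  shows "\<exists>C\<ge>0. \<forall>t\<in>{0..T}. \<forall>v. to_L2 (\<lambda>x. if x \<in> D then - (fn_L2 v x / a x) *\<^sub>R J t x else 0) \<in> L2_on D \<and>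
    norm (to_L2 (\<lambda>x. if x \<in> D then - (fn_L2 v x / a x) *\<^sub>R J t x else 0)) \<le> C * norm v"
proof -
  let ?F = "\<lambda>t v. to_L2 (\<lambda>x. if x \<in> D then - (fn_L2 v x / a x) *\<^sub>R J t x else 0)"
  obtain C where am: "(\<lambda>x. indicator D x * a x) \<in> borel_measurable lebesgue"
    and bnd: "AE x in lebesgue. x \<in> D \<longrightarrow> \<delta> \<le> a x \<and> a x \<le> C"
    using a by (auto simp: bounded_coefficient_def set_borel_measurable_def)
  define aD where "aD x = indicator D x * a x" for x
  have [measurable]: "aD \<in> borel_measurable lebesgue" using am by (simp add: aD_def[abs_def])
  obtain B where B: "\<And>t x. t \<in> {0..T} \<Longrightarrow> x \<in> D \<Longrightarrow> norm (J t x) \<le> B"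
    using J by (force simp: bounded_current_def bounded_iff)
  define B' where "B' = max B 0"
  have B': "0 \<le> B'" "\<And>t x. t \<in> {0..T} \<Longrightarrow> x \<in> D \<Longrightarrow> norm (J t x) \<le> B'"
    using B by (auto simp: B'_def le_max_iff_disj)
  have "?F t v \<in> L2_on D \<and>
    norm (?F t v) \<le> 2 * (B' / \<delta>) * norm v" if t: "t \<in> {0..T}" for t v
  proof -
    let ?f = "\<lambda>x. if x \<in> D then - (fn_L2 v x / a x) *\<^sub>R J t x else 0"
    have "continuous_on ({0..T} \<times> D) (\<lambda>(t, x). J t x)" using J by (simp add: bounded_current_def)
    then have "continuous_on D (\<lambda>x. (\<lambda>(t, x). J t x) (t, x))"
      by (rule continuous_on_compose2) (use t in \<open>auto intro!: continuous_intros\<close>)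
    then have "continuous_on D (J t)" by simp
    then have "(\<lambda>x. indicator D x *\<^sub>R J t x) \<in> borel_measurable borel"
      using open_D by (intro borel_measurable_continuous_on_indicator) auto
    then have jm: "(\<lambda>x. indicator D x *\<^sub>R J t x) \<in> borel_measurable lebesgue"
      by (intro measurable_completion) simp
    define j where "j x = indicator D x *\<^sub>R J t x" for x
    have [measurable]: "j \<in> borel_measurable lebesgue" using jm by (simp add: j_def[abs_def])
    have "?f = (\<lambda>x. - (fn_L2 v x * inverse (aD x)) *\<^sub>R j x)"
      by (auto simp: aD_def j_def fun_eq_iff indicator_def divide_inverse)
    then have m: "?f \<in> borel_measurable lebesgue" by simp
    have b: "AE x in lebesgue. norm (?f x) \<le> (B' / \<delta>) * (0 * indicator D x + norm (fn_L2 v x) + norm (fn_L2 (0 :: (r3, real) L2) x))"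
      using bnd fn_L2_zero[where 'a = r3 and 'b = real]
    proof eventually_elim
      case (elim x)
      show ?case
      proof (cases "x \<in> D")
        case True
        have "norm (?f x) = (norm (J t x) * norm (fn_L2 v x)) / \<bar>a x\<bar>" using True by (simp add: mult.commute)
        also have "\<dots> \<le> (B' * norm (fn_L2 v x)) / \<delta>"
          using elim True \<delta> B' t by (intro frac_le mult_right_mono) auto
        finally show ?thesis using elim by simp
      qed (use B' \<delta> elim in simp)
    qed
    have B\<delta>: "0 \<le> B' / \<delta>" using B' \<delta> by simp
    note est = norm_L2_le_of_bound[OF m D_lmeasurable b B\<delta>]
    have sq: "square_integrable ?f" using est(1) by simp
    have "to_L2 ?f \<in> L2_on D" by (rule to_L2_in_L2_on[OF sq]) simp
    moreover have "norm (to_L2 ?f) \<le> 2 * (B' / \<delta>) * norm v" using est(2) by simp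
    ultimately show ?thesis by simp
  qed
  then show ?thesis using B' \<delta> by (intro exI[of _ "2 * (B' / \<delta>)"]) auto
qed

lemma diffusion_bounds:
  assumes "bounded_current D T Jer" "bounded_current D T Jmr"
  shows "\<exists>C\<ge>0. \<forall>t\<in>{0..T}. \<forall>v. diffusion D \<epsilon> \<mu> Jer Jmr t v \<in> state_space D \<and> norm (diffusion D \<epsilon> \<mu> Jer Jmr t v) \<le> C * norm v"
proof -
  let ?B = "diffusion D \<epsilon> \<mu> Jer Jmr"
  let ?E = "\<lambda>t v. to_L2 (\<lambda>x. if x \<in> D then - (fn_L2 v x / \<epsilon> x) *\<^sub>R Jer t x else 0)"
  let ?M = "\<lambda>t v. to_L2 (\<lambda>x. if x \<in> D then - (fn_L2 v x / \<mu> x) *\<^sub>R Jmr t x else 0)"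
  obtain C1 where C1: "0 \<le> C1" "\<And>t v. t \<in> {0..T} \<Longrightarrow> ?E t v \<in> L2_on D \<and>
    norm (?E t v) \<le> C1 * norm v"
    using diffusion_component[OF \<epsilon> assms(1)] by blast
  obtain C2 where C2: "0 \<le> C2" "\<And>t v. t \<in> {0..T} \<Longrightarrow> ?M t v \<in> L2_on D \<and>
    norm (?M t v) \<le> C2 * norm v"
    using diffusion_component[OF \<mu> assms(2)] by blast
  have "?B t v \<in> state_space D \<and> norm (?B t v) \<le> (C1 + C2) * norm v" if t: "t \<in> {0..T}" for t v
    using C1(2)[OF t, of v] C2(2)[OF t, of v] norm_state_le[of "?B t v"]
    unfolding diffusion_def state_space_def distrib_right by auto
  then show ?thesis using C1(1) C2(1) by (intro exI[of _ "C1 + C2"]) auto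
qed

end

section \<open>A first moment bound\<close>

lemma nn_integral_exp_tail_le:
  assumes c: "0 < c"
  shows "(\<integral>\<^sup>+t. ennreal (exp (- c * t)) * indicator {s..T} t \<partial>lborel) \<le> ennreal (exp (- c * s) / c)"
proof -
  have "(\<integral>\<^sup>+t. ennreal (exp (- c * t)) * indicator {s..T} t \<partial>lborel) \<le> (\<integral>\<^sup>+t. ennreal (exp (- c * t)) * indicator {s..} t \<partial>lborel)"
    by (intro nn_integral_mono) (auto simp: indicator_def)
  also have "\<dots> = ennreal (0 - (- exp (- c * s) / c))"
  proof (rule nn_integral_FTC_atLeast)
    show "DERIV (\<lambda>t. - exp (- c * t) / c) x :> exp (- c * x)" for x
      using c by (auto intro!: derivative_eq_intros simp: field_simps)
    show "((\<lambda>t. - exp (- c * t) / c) \<longlongrightarrow> 0) at_top"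
      using c by real_asymp
  qed auto
  finally show ?thesis by simp
qed

text \<open>A weighted norm with weight \<open>exp (- c t)\<close>, \<open>c\<close> large, makes the integral operator a contraction by
  the factor \<open>1 / 2\<close>; this needs no continuity of \<open>f\<close>.\<close>

lemma gronwall_nn_integral:
  fixes f z :: "real \<Rightarrow> ennreal"
  assumes [measurable]: "f \<in> borel_measurable borel" "z \<in> borel_measurable borel"
    and T: "0 \<le> T" and C: "0 \<le> C"
    and le: "\<And>t. t \<in> {0..T} \<Longrightarrow> f t \<le> a + ennreal C * (\<integral>\<^sup>+s\<in>{0..t}. (1 + f s) \<partial>lborel) + z t"
    and fin: "(\<integral>\<^sup>+s\<in>{0..T}. f s \<partial>lborel) < \<infinity>"
  shows "(\<integral>\<^sup>+s\<in>{0..T}. f s \<partial>lborel) \<le> ennreal (2 * exp ((2 * C + 1) * T)) * ((a + ennreal (C * T)) * ennreal T + (\<integral>\<^sup>+s\<in>{0..T}. z s \<partial>lborel))"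
proof -
  let ?I = "\<lambda>t. \<integral>\<^sup>+s\<in>{0..t}. f s \<partial>lborel"
  let ?k = "\<lambda>s t. if 0 \<le> s \<and> s \<le> t \<and> t \<le> T then 1 else 0 :: ennreal"
  \<comment> \<open>The contraction needs C / c \<le> 1 / 2; the summand 1 keeps c positive when C =
    0.\<close>
  define c where "c = 2 * C + 1"
  have c: "0 < c" "C / c \<le> 1 / 2" using C by (auto simp: c_def field_simps)
  define w where "w t = ennreal (exp (- c * t))" for t
  have [measurable]: "w \<in> borel_measurable borel" unfolding w_def by measurable
  have w1: "w t \<le> 1" if "0 \<le> t" for t using that c by (simp add: w_def)
  define N where "N = (\<integral>\<^sup>+t\<in>{0..T}. w t * f t \<partial>lborel)"
  define A where "A = (a + ennreal (C * T)) * ennreal T + (\<integral>\<^sup>+s\<in>{0..T}. z s \<partial>lborel)"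
  let ?WI = "\<integral>\<^sup>+t\<in>{0..T}. w t * ?I t \<partial>lborel"
  let ?r = "\<lambda>t. a + ennreal (C * T) + z t + ennreal C * ?I t"
  have "N \<le> (\<integral>\<^sup>+t\<in>{0..T}. w t * ?r t \<partial>lborel)"
    unfolding N_def
  proof (intro nn_integral_mono)
    fix t
    show "w t * f t * indicator {0..T} t \<le> w t * ?r t * indicator {0..T} t"
    proof (cases "t \<in> {0..T}")
      case True
      have "(\<integral>\<^sup>+s\<in>{0..t}. (1 + f s) \<partial>lborel) = ennreal t + ?I t"
        using True by (simp add: distrib_right nn_integral_add)
      then have "f t \<le> a + (ennreal C * ennreal t + ennreal C * ?I t) + z t"
        using le[OF True] by (simp add: distrib_left)
      also have "\<dots> \<le> a + (ennreal (C * T) + ennreal C * ?I t) + z t"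
        using True C by (intro add_mono order_refl) (auto simp: ennreal_mult[symmetric] intro!: ennreal_leI mult_left_mono)
      finally show ?thesis using True by (auto intro!: mult_left_mono simp: add_ac)
    qed simp
  qed
  also have "\<dots> = (\<integral>\<^sup>+t\<in>{0..T}. w t * (a + ennreal (C * T) + z t) \<partial>lborel) + ennreal C * ?WI"
  proof -
    \<comment> \<open>Writing the moving domain as a condition on (s, t) makes the integrand jointly
      measurable, hence the integral measurable in t.\<close>
    have "(\<lambda>t. \<integral>\<^sup>+s. f s * (if 0 \<le> s \<and> s \<le> t then 1 else 0) \<partial>lborel) \<in> borel_measurable borel" by measurable
    also have "(\<lambda>t. \<integral>\<^sup>+s. f s * (if 0 \<le> s \<and> s \<le> t then 1 else 0) \<partial>lborel) = (\<lambda>t. \<integral>\<^sup>+s\<in>{0..t}. f s \<partial>lborel)"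
      by (intro ext nn_integral_cong) (auto simp: indicator_def)
    finally have [measurable]: "(\<lambda>t. \<integral>\<^sup>+s\<in>{0..t}. f s \<partial>lborel) \<in> borel_measurable borel" .
    have "(\<integral>\<^sup>+t\<in>{0..T}. w t * ?r t \<partial>lborel)
      = (\<integral>\<^sup>+t. w t * (a + ennreal (C * T) + z t) * indicator {0..T} t
          + ennreal C * (w t * ?I t * indicator {0..T} t) \<partial>lborel)"
      by (intro nn_integral_cong) (simp add: distrib_left distrib_right mult_ac)
    then show ?thesis by (simp add: nn_integral_add nn_integral_cmult)
  qed
  also have "(\<integral>\<^sup>+t\<in>{0..T}. w t * (a + ennreal (C * T) + z t) \<partial>lborel) \<le> (\<integral>\<^sup>+t. (a + ennreal (C * T)) * indicator {0..T} t + z t * indicator {0..T} t \<partial>lborel)"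
  proof (intro nn_integral_mono)
    fix t
    show "w t * (a + ennreal (C * T) + z t) * indicator {0..T} t \<le> (a + ennreal (C * T)) * indicator {0..T} t + z t * indicator {0..T} t"
      using mult_right_mono[OF w1[of t], of "a + ennreal (C * T) + z t"] by (cases "t \<in> {0..T}") auto
  qed
  also have "\<dots> = A"
    unfolding A_def using T by (simp add: nn_integral_add nn_integral_cmult_indicator)
  \<comment> \<open>Exchange the order of integration: the tail of the weight beyond s integrates to
    at most w s / c, the source of the factor 1 / c.\<close>
  also have "?WI \<le> ennreal (1 / c) * N"
  proof -
    have "?WI = (\<integral>\<^sup>+t. (\<integral>\<^sup>+s. w t * f s * ?k s t \<partial>lborel) \<partial>lborel)"
    proof (intro nn_integral_cong)
      fix t
      have "w t * ?I t * indicator {0..T} t = (\<integral>\<^sup>+s. (w t * indicator {0..T} t) * (f s * indicator {0..t} s) \<partial>lborel)"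
        by (subst nn_integral_cmult) (auto simp: mult_ac)
      also have "\<dots> = (\<integral>\<^sup>+s. w t * f s * ?k s t \<partial>lborel)"
        by (intro nn_integral_cong) (auto simp: indicator_def)
      finally show "w t * ?I t * indicator {0..T} t = (\<integral>\<^sup>+s. w t * f s * ?k s t \<partial>lborel)" .
    qed
    also have "\<dots> = (\<integral>\<^sup>+s. (\<integral>\<^sup>+t. w t * f s * ?k s t \<partial>lborel) \<partial>lborel)"
      by (rule lborel_pair.Fubini') measurable
    also have "\<dots> \<le> (\<integral>\<^sup>+s. ennreal (1 / c) * (w s * f s * indicator {0..T} s) \<partial>lborel)"
    proof (intro nn_integral_mono)
      fix s
      show "(\<integral>\<^sup>+t. w t * f s * ?k s t \<partial>lborel) \<le> ennreal (1 / c) * (w s * f s * indicator {0..T} s)"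
      proof (cases "s \<in> {0..T}")
        case True
        have "(\<integral>\<^sup>+t. w t * f s * ?k s t \<partial>lborel) = (\<integral>\<^sup>+t. f s * (w t * indicator {s..T} t) \<partial>lborel)"
          using True by (intro nn_integral_cong) (auto simp: indicator_def mult_ac)
        also have "\<dots> = f s * (\<integral>\<^sup>+t. w t * indicator {s..T} t \<partial>lborel)"
          by (rule nn_integral_cmult) measurable
        also have "\<dots> \<le> f s * ennreal (exp (- c * s) / c)"
          unfolding w_def by (intro mult_left_mono nn_integral_exp_tail_le c) simp
        also have "ennreal (exp (- c * s) / c) = ennreal (1 / c) * w s"
          using c by (simp add: w_def ennreal_mult[symmetric])
        finally show ?thesis using True by (simp add: mult_ac)
      next
        case False
        then have "?k s t = 0" for t by auto
        then show ?thesis by simp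
      qed
    qed
    also have "\<dots> = ennreal (1 / c) * N" unfolding N_def by (rule nn_integral_cmult) measurable
    finally show ?thesis .
  qed
  finally have N1: "N \<le> A + ennreal C * (ennreal (1 / c) * N)" by (simp add: add_left_mono mult_left_mono)
  have "ennreal C * (ennreal (1 / c) * N) = ennreal (C / c) * N"
    using C c by (simp add: ennreal_mult[symmetric] mult.assoc[symmetric])
  also have "\<dots> \<le> ennreal (1 / 2) * N" using c(2) by (intro mult_right_mono ennreal_leI) auto
  finally have N2: "N \<le> A + ennreal (1 / 2) * N" using N1 by (meson add_left_mono order_trans)
  have "N \<le> ?I T"
    unfolding N_def using mult_right_mono[OF w1] by (intro nn_integral_mono) (auto simp: indicator_def)
  \<comment> \<open>Half of N can be absorbed on the left only if N is finite; this is where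
    \<open>fin\<close> enters.\<close>
  then have "N < \<infinity>" using fin by (rule le_less_trans)
  then obtain r where r: "N = ennreal r" "0 \<le> r" by (cases N) auto
  have N3: "N \<le> 2 * A"
  proof (cases A)
    case (real a')
    have "ennreal r \<le> ennreal a' + ennreal (1 / 2) * ennreal r" using N2 unfolding r(1) real(2) .
    also have "\<dots> = ennreal (a' + 1 / 2 * r)" using real r by (simp only: ennreal_plus ennreal_mult)
    finally have "ennreal r \<le> ennreal (a' + 1 / 2 * r)" .
    then have "r \<le> a' + 1 / 2 * r" using real r by (subst (asm) ennreal_le_iff) auto
    then have "ennreal r \<le> ennreal (2 * a')" by (intro ennreal_leI) simp
    then show ?thesis using real r by (simp add: ennreal_mult)
  qed simp
  \<comment> \<open>Remove the weight again: exp (c T) times w s is at least 1 on [0, T].\<close>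
  have "?I T \<le> (\<integral>\<^sup>+s. ennreal (exp (c * T)) * (w s * f s * indicator {0..T} s) \<partial>lborel)"
  proof (intro nn_integral_mono)
    fix s
    show "f s * indicator {0..T} s \<le> ennreal (exp (c * T)) * (w s * f s * indicator {0..T} s)"
    proof (cases "s \<in> {0..T}")
      case True
      then have "0 \<le> c * T - c * s" using c by (simp add: mult_left_mono)
      then have "1 \<le> ennreal (exp (c * T)) * w s"
        by (simp add: w_def ennreal_mult[symmetric] exp_add[symmetric])
      from mult_right_mono[OF this, of "f s"] show ?thesis using True by (simp add: mult_ac)
    qed simp
  qed
  also have "\<dots> = ennreal (exp (c * T)) * N" unfolding N_def by (rule nn_integral_cmult) measurable
  also have "\<dots> \<le> ennreal (exp (c * T)) * (2 * A)" using N3 by (rule mult_left_mono) simp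
  also have "\<dots> = ennreal (2 * exp ((2 * C + 1) * T)) * A" by (simp add: c_def ennreal_mult mult_ac)
  finally show ?thesis unfolding A_def .
qed


text \<open>The bound at each t holds off a null set depending on t, so it is no inequality along a
  path. The remedy is the excess z of f over the right-hand side r: it is jointly measurable, f
  \<le> r + z holds at every point, and for fixed t it is almost everywhere below x, so that its
  mean is at most K. Gronwall then runs along almost every path, and Fubini bounds the mean of the
  time integral of z.\<close>

lemma moment_of_gronwall_bound:
  fixes u :: "real \<Rightarrow> 'w \<Rightarrow> 'b::{banach, second_countable_topology}" and a :: "'w \<Rightarrow> ennreal"
  assumes P: "prob_space P" and T: "0 \<le> T" and C: "0 \<le> C"
    and u: "(\<lambda>(s, \<omega>). indicator {0..T} s *\<^sub>R u s \<omega>) \<in> borel_measurable (lborel \<Otimes>\<^sub>M P)"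
    and a: "a \<in> borel_measurable P" "(\<integral>\<^sup>+\<omega>. a \<omega> \<partial>P) < \<infinity>"
    and fin: "AE \<omega> in P. (\<integral>\<^sup>+s\<in>{0..T}. ennreal (norm (u s \<omega>)) \<partial>lborel) < \<infinity>"
    and le: "\<And>t. t \<in> {0..T} \<Longrightarrow> \<exists>x. (AE \<omega> in P. ennreal (norm (u t \<omega>)) \<le>
        a \<omega> + ennreal C * (\<integral>\<^sup>+s\<in>{0..t}. (1 + ennreal (norm (u s \<omega>))) \<partial>lborel) + x \<omega>) \<and> (\<integral>\<^sup>+\<omega>. x \<omega> \<partial>P) \<le> ennreal K"
  shows "(\<integral>\<^sup>+\<omega>. (\<integral>\<^sup>+s\<in>{0..T}. ennreal (norm (u s \<omega>)) \<partial>lborel) \<partial>P) < \<infinity>"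
proof -
  let ?L = "lborel \<Otimes>\<^sub>M P"
  interpret P: prob_space P by fact
  interpret pair_sigma_finite lborel P by standard
  note [measurable] = a(1)
  define f where "f s \<omega> = ennreal (norm (indicator {0..T} s *\<^sub>R u s \<omega>))" for s \<omega>
  have f_meas: "(\<lambda>(s, \<omega>). f s \<omega>) \<in> borel_measurable ?L"
    using u unfolding f_def split_beta by measurable
  have f_eq: "f s \<omega> = ennreal (norm (u s \<omega>))" if "s \<in> {0..T}" for s \<omega> using that by (simp add: f_def)
  have [measurable]: "(\<lambda>x. f (h x) (k x)) \<in> borel_measurable M" if "h \<in> borel_measurable M" "k \<in> measurable M P" for h k M
    using measurable_compose[OF measurable_Pair[of h M lborel k P] f_meas] that by simp
  define r where "r t \<omega> = a \<omega> + ennreal C * (\<integral>\<^sup>+s\<in>{0..t}. (1 + f s \<omega>) \<partial>lborel)" for t \<omega>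
  let ?r = "\<lambda>t \<omega>. \<integral>\<^sup>+s. (1 + f s \<omega>) * (if 0 \<le> s \<and> s \<le> t then 1 else 0) \<partial>lborel"
  have "(\<lambda>(t, \<omega>). a \<omega> + ennreal C * ?r t \<omega>) \<in> borel_measurable ?L"
    by measurable
  also have "(\<lambda>(t, \<omega>). a \<omega> + ennreal C * ?r t \<omega>) = (\<lambda>(t, \<omega>). r t \<omega>)"
  proof -
    have "?r t \<omega> = (\<integral>\<^sup>+s\<in>{0..t}. (1 + f s \<omega>) \<partial>lborel)" for t \<omega>
      by (intro nn_integral_cong) (auto simp: indicator_def)
    then show ?thesis unfolding r_def by simp
  qed
  finally have r_meas: "(\<lambda>(t, \<omega>). r t \<omega>) \<in> borel_measurable ?L" .
  \<comment> \<open>Subtraction in \<open>ennreal\<close> is truncated, so this is the positive part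
    of the difference.\<close>
  define z where "z t \<omega> = f t \<omega> - r t \<omega>" for t \<omega>
  have z_meas: "(\<lambda>(t, \<omega>). z t \<omega>) \<in> borel_measurable ?L"
    using f_meas r_meas unfolding z_def split_beta by measurable
  have [measurable]: "(\<lambda>x. z (h x) (k x)) \<in> borel_measurable M" if "h \<in> borel_measurable M" "k \<in> measurable M P" for h k M
    using measurable_compose[OF measurable_Pair[of h M lborel k P] z_meas] that by simp
  have f_le: "f t \<omega> \<le> r t \<omega> + z t \<omega>" for t \<omega>
    unfolding z_def by (metis add.commute diff_add_self_ennreal ennreal_minus_eq_0 le_cases zero_le add_0 le_iff_add)
  have z_bound: "(\<integral>\<^sup>+\<omega>. z t \<omega> \<partial>P) \<le> ennreal K" if t: "t \<in> {0..T}" for t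
  proof -
    obtain x where x: "AE \<omega> in P. ennreal (norm (u t \<omega>)) \<le>
        a \<omega> + ennreal C * (\<integral>\<^sup>+s\<in>{0..t}. (1 + ennreal (norm (u s \<omega>))) \<partial>lborel) + x \<omega>" "(\<integral>\<^sup>+\<omega>. x \<omega> \<partial>P) \<le> ennreal K"
      using le[OF t] by blast
    have "(\<integral>\<^sup>+s\<in>{0..t}. (1 + ennreal (norm (u s \<omega>))) \<partial>lborel) = (\<integral>\<^sup>+s\<in>{0..t}. (1 + f s \<omega>) \<partial>lborel)" for \<omega>
      using t by (intro nn_integral_cong) (auto simp: indicator_def f_def)
    then have "AE \<omega> in P. f t \<omega> \<le> r t \<omega> + x \<omega>" using x(1) by (simp add: f_eq[OF t] r_def)
    then have "AE \<omega> in P. z t \<omega> \<le> x \<omega>"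
      by eventually_elim (simp add: z_def ennreal_minus_le_iff f_def)
    then have "(\<integral>\<^sup>+\<omega>. z t \<omega> \<partial>P) \<le> (\<integral>\<^sup>+\<omega>. x \<omega> \<partial>P)" by (rule nn_integral_mono_AE)
    then show ?thesis using x(2) by (rule order_trans)
  qed
  let ?I = "\<lambda>f \<omega>. \<integral>\<^sup>+s\<in>{0..T}. f s \<omega> \<partial>lborel"
  define E where "E = ennreal (2 * exp ((2 * C + 1) * T))"
  have cong: "(\<integral>\<^sup>+s\<in>{0..T}. ennreal (norm (u s \<omega>)) \<partial>lborel) = ?I f \<omega>" for \<omega>
    by (intro nn_integral_cong) (auto simp: indicator_def f_def)
  have "AE \<omega> in P. ?I f \<omega> \<le> E * ((a \<omega> + ennreal (C * T)) * ennreal T + ?I z \<omega>)"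
    using fin AE_space
  proof eventually_elim
    case (elim \<omega>)
    show ?case
      unfolding E_def
    proof (rule gronwall_nn_integral[OF _ _ T C])
      show "(\<lambda>s. f s \<omega>) \<in> borel_measurable borel" "(\<lambda>s. z s \<omega>) \<in> borel_measurable borel"
        using elim(2) by measurable
      show "f t \<omega> \<le> a \<omega> + ennreal C * (\<integral>\<^sup>+s\<in>{0..t}. (1 + f s \<omega>) \<partial>lborel) + z t \<omega>" for t
        using f_le[of t \<omega>] by (simp add: r_def)
      show "?I f \<omega> < \<infinity>" using elim(1) by (simp add: cong)
    qed
  qed
  then have "(\<integral>\<^sup>+\<omega>. ?I f \<omega> \<partial>P)
      \<le> (\<integral>\<^sup>+\<omega>. E * ((a \<omega> + ennreal (C * T)) * ennreal T + ?I z \<omega>) \<partial>P)"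
    by (rule nn_integral_mono_AE)
  also have "\<dots> = E * (((\<integral>\<^sup>+\<omega>. a \<omega> \<partial>P) + ennreal (C * T)) * ennreal T + (\<integral>\<^sup>+\<omega>. ?I z \<omega> \<partial>P))"
    by (simp add: nn_integral_cmult nn_integral_add nn_integral_multc P.emeasure_space_1)
  also have "(\<integral>\<^sup>+\<omega>. ?I z \<omega> \<partial>P) = (\<integral>\<^sup>+s. (\<integral>\<^sup>+\<omega>. z s \<omega> * indicator {0..T} s \<partial>P) \<partial>lborel)"
    by (rule Fubini') measurable
  also have "\<dots> \<le> (\<integral>\<^sup>+s. ennreal K * indicator {0..T} s \<partial>lborel)"
    using z_bound by (intro nn_integral_mono) (auto simp: indicator_def)
  also have "\<dots> = ennreal K * ennreal T" using T by (simp add: nn_integral_cmult_indicator)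
  finally have "(\<integral>\<^sup>+\<omega>. ?I f \<omega> \<partial>P) \<le> E * (((\<integral>\<^sup>+\<omega>. a \<omega> \<partial>P) + ennreal (C * T)) * ennreal T + ennreal K * ennreal T)"
    by (simp add: add_left_mono mult_left_mono)
  also have "\<dots> < \<infinity>"
    using a(2) by (simp add: E_def ennreal_mult_less_top)
  finally show ?thesis by (simp add: cong)
qed

lemma le_one_plus_square: "(x :: real) \<le> 1 + x\<^sup>2"
  using zero_le_power2[of "x - 1 / 2"] by (simp add: power2_eq_square algebra_simps)

lemma ennreal_norm_le_one_plus_square: "ennreal (norm x) \<le> 1 + ennreal ((norm x)\<^sup>2)"
  using ennreal_leI[OF le_one_plus_square[of "norm x"]] by (subst (asm) ennreal_plus) auto

section \<open>Averages of invariant functionals\<close>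

text \<open>The Maxwell problem enters only through three constants: the bound \<kappa> of the
  group, the linear growth \<gamma> of the drift and the bound \<beta> of the diffusion
  operators.\<close>

locale mild_solution_setting = wiener_basis U e P F T Q R W
  for U :: "'a::{real_inner, second_countable_topology} set" and e and P :: "'w measure"
    and F T Q R and W :: "real \<Rightarrow> 'w \<Rightarrow> 'a" +
  fixes H :: "'b::{real_inner, banach, second_countable_topology} set"
    and S :: "real \<Rightarrow> 'b \<Rightarrow> 'b" and G :: "real \<Rightarrow> 'b \<Rightarrow> 'b" and B :: "real \<Rightarrow> 'a \<Rightarrow> 'b"
    and u0 :: "'w \<Rightarrow> 'b" and u :: "real \<Rightarrow> 'w \<Rightarrow> 'b" and \<kappa> \<gamma> \<beta> :: real
  assumes T_nonneg: "0 \<le> T"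
    and mild: "mild_solution P F T U e R H W S G B u0 u"
    and S_bound: "0 \<le> \<kappa>" "\<And>t v. v \<in> H \<Longrightarrow> norm (S t v) \<le> \<kappa> * norm v"
    and G_bound: "0 \<le> \<gamma>" "\<And>t v. t \<in> {0..T} \<Longrightarrow> v \<in> H \<Longrightarrow> G t v \<in> H \<and> norm (G t v) \<le> \<gamma> * (1 + norm v)"
    and B_bound: "0 \<le> \<beta>" "\<And>t v. t \<in> {0..T} \<Longrightarrow> v \<in> U \<Longrightarrow> B t v \<in> H \<and> norm (B t v) \<le> \<beta> * norm v"
    and u0_measurable: "u0 \<in> borel_measurable P" and u0_in_H: "\<And>\<omega>. \<omega> \<in> space P \<Longrightarrow> u0 \<omega> \<in> H"
    and u0_integrable: "integrable P (\<lambda>\<omega>. norm (u0 \<omega>))"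
begin

abbreviation drift_term :: "real \<Rightarrow> 'w \<Rightarrow> real \<Rightarrow> 'b"
  where "drift_term t \<omega> s \<equiv> S (t - s) (G s (u s \<omega>))"

lemma u_in_H: "t \<in> {0..T} \<Longrightarrow> \<omega> \<in> space P \<Longrightarrow> u t \<omega> \<in> H"
  using mild by (simp add: mild_solution_def)

text \<open>\<open>mild_solution\<close> says nothing about u outside [0, T]. Extension by zero
  gives a process that is jointly measurable on the whole time axis.\<close>

definition u_ext :: "real \<Rightarrow> 'w \<Rightarrow> 'b"
  where "u_ext s \<omega> = indicator {0..T} s *\<^sub>R u s \<omega>"

lemma u_ext_eq: "s \<in> {0..T} \<Longrightarrow> u_ext s \<omega> = u s \<omega>"
  by (simp add: u_ext_def)

lemma u_ext_joint_measurable: "(\<lambda>(s, \<omega>). u_ext s \<omega>) \<in> borel_measurable (lborel \<Otimes>\<^sub>M P)"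
  using predictable_measurable[OF basis T_nonneg order_refl, of "\<lambda>(s, \<omega>). u s \<omega>"] mild
  by (simp add: mild_solution_def split_beta u_ext_def)

lemma u_ext_measurable [measurable]:
  assumes "h \<in> borel_measurable M" "k \<in> measurable M P"
  shows "(\<lambda>x. u_ext (h x) (k x)) \<in> borel_measurable M"
  using measurable_compose[OF measurable_Pair[of h M lborel k P] u_ext_joint_measurable] assms by simp

lemma u_measurable:
  assumes "t \<in> {0..T}"
  shows "u t \<in> borel_measurable P"
proof -
  have "(\<lambda>\<omega>. u_ext t \<omega>) \<in> borel_measurable P" by measurable
  moreover have "u_ext t = u t" using assms by (simp add: u_ext_eq fun_eq_iff)
  ultimately show ?thesis by simp
qed

lemma nn_integral_u_ext:
  "r \<le> T \<Longrightarrow> (\<integral>\<^sup>+s\<in>{0..r}. f (u s \<omega>) \<partial>lborel) = (\<integral>\<^sup>+s\<in>{0..r}. f (u_ext s \<omega>) \<partial>lborel)"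
  by (intro nn_integral_cong) (auto simp: indicator_def u_ext_eq)

text \<open>Equal to (\<kappa> \<beta>)^2 times the trace of Q. It dominates the squared
  Hilbert-Schmidt norm of the integrand of the stochastic convolution, uniformly in both
  times.\<close>

definition noise_bound :: real
  where "noise_bound = (\<Sum>k. (\<kappa> * (\<beta> * norm (R (e k))))\<^sup>2)"

lemma noise_bound:
  assumes "t \<in> {0..T}" "s \<in> {0..t}"
  shows "(\<Sum>k. ennreal ((norm (S (t - s) (B s (R (e k)))))\<^sup>2)) \<le> ennreal noise_bound"
proof -
  have sum: "summable (\<lambda>k. (\<kappa> * (\<beta> * norm (R (e k))))\<^sup>2)"
    using sqrt_summable by (simp add: power_mult_distrib mult.assoc summable_mult)
  have s: "s \<in> {0..T}" using assms by auto
  have "norm (S (t - s) (B s (R (e k)))) \<le> \<kappa> * (\<beta> * norm (R (e k)))" for k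
    using S_bound(2)[of "B s (R (e k))" "t - s"] B_bound(2)[OF s sqrt_in_U[OF e_in_U[of k]]] S_bound(1)
    by (auto intro: order_trans mult_left_mono)
  then have "(\<Sum>k. ennreal ((norm (S (t - s) (B s (R (e k)))))\<^sup>2)) \<le> (\<Sum>k. ennreal ((\<kappa> * (\<beta> * norm (R (e k))))\<^sup>2))"
    by (intro suminf_le allI ennreal_leI power_mono) auto
  also have "\<dots> = ennreal noise_bound"
    unfolding noise_bound_def by (rule suminf_ennreal2[OF _ sum]) simp
  finally show ?thesis .
qed

lemma noise_bound_nonneg: "0 \<le> noise_bound"
proof -
  have "summable (\<lambda>k. (\<kappa> * (\<beta> * norm (R (e k))))\<^sup>2)"
    using sqrt_summable by (simp add: power_mult_distrib mult.assoc summable_mult)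
  then show ?thesis unfolding noise_bound_def by (rule suminf_nonneg) simp
qed

lemma mild_solution_at:
  assumes t: "t \<in> {0..T}"
  shows "\<exists>X. X \<in> borel_measurable P \<and>
    (AE \<omega> in P. set_integrable lborel {0..t} (drift_term t \<omega>) \<and>
        u t \<omega> = S t (u0 \<omega>) + (LINT s:{0..t}|lborel. drift_term t \<omega> s) + X \<omega>) \<and>
    (\<integral>\<^sup>+\<omega>. ennreal ((norm (X \<omega>))\<^sup>2) \<partial>P) \<le> ennreal (6 + 4 * noise_bound * T) \<and>
    (\<forall>l :: 'b \<Rightarrow> real. bounded_linear l \<longrightarrow> integrable P (\<lambda>\<omega>. l (X \<omega>)) \<and> (LINT \<omega>|P. l (X \<omega>)) = 0)"
proof -
  obtain X where X: "has_ito_integral P F U e R H W (\<lambda>s \<omega> v. S (t - s) (B s v)) t X"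
    and eq: "AE \<omega> in P. set_integrable lborel {0..t} (drift_term t \<omega>) \<and>
        u t \<omega> = S t (u0 \<omega>) + (LINT s:{0..t}|lborel. drift_term t \<omega> s) + X \<omega>"
    using mild t unfolding mild_solution_def by blast
  have tT: "0 \<le> t" "t \<le> T" using t by auto
  note ito = ito_integral_mean_square_bound[OF X tT noise_bound[OF t] noise_bound_nonneg]
  show ?thesis
  proof (intro exI[of _ X] conjI allI impI eq)
    show "X \<in> borel_measurable P" using X by (simp add: has_ito_integral_def)
    have "ennreal (6 + 4 * noise_bound * t) \<le> ennreal (6 + 4 * noise_bound * T)"
      using tT noise_bound_nonneg by (intro ennreal_leI add_left_mono mult_left_mono) auto
    then show "(\<integral>\<^sup>+\<omega>. ennreal ((norm (X \<omega>))\<^sup>2) \<partial>P) \<le> ennreal (6 + 4 * noise_bound * T)"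
      using ito(1) by (rule order_trans[rotated])
    fix l :: "'b \<Rightarrow> real" assume "bounded_linear l"
    then show "integrable P (\<lambda>\<omega>. l (X \<omega>))" "(LINT \<omega>|P. l (X \<omega>)) = 0"
      using ito(2,3) by auto
  qed
qed

text \<open>Gronwall with rate \<kappa> \<gamma>, where the stochastic convolution plays the part of
  x: its second moment is bounded uniformly in t, and |x| \<le> 1 + |x|^2 passes to the first
  moment, whence 7 = 1 + 6. The square integrability of paths in \<open>mild_solution\<close>
  supplies the finiteness that Gronwall presupposes.\<close>

lemma first_moment_finite:
  "(\<integral>\<^sup>+\<omega>. (\<integral>\<^sup>+s\<in>{0..T}. ennreal (norm (u s \<omega>)) \<partial>lborel) \<partial>P) < \<infinity>"
proof (rule moment_of_gronwall_bound[OF prob T_nonneg _ u_ext_joint_measurable[unfolded u_ext_def]])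
  let ?a = "\<lambda>\<omega>. ennreal (\<kappa> * norm (u0 \<omega>))"
  show "0 \<le> \<kappa> * \<gamma>" using S_bound G_bound by simp
  show "?a \<in> borel_measurable P" using u0_measurable by measurable
  show "(\<integral>\<^sup>+\<omega>. ?a \<omega> \<partial>P) < \<infinity>"
    using u0_integrable S_bound(1) by (subst nn_integral_eq_integral) auto
  have "AE \<omega> in P. (\<integral>\<^sup>+s\<in>{0..T}. ennreal ((norm (u s \<omega>))\<^sup>2) \<partial>lborel) < \<infinity>"
    using mild by (simp add: mild_solution_def)
  then show "AE \<omega> in P. (\<integral>\<^sup>+s\<in>{0..T}. ennreal (norm (u s \<omega>)) \<partial>lborel) < \<infinity>"
    using AE_space
  proof eventually_elim
    case (elim \<omega>)
    note [measurable] = elim(2)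
    have "(\<integral>\<^sup>+s\<in>{0..T}. ennreal (norm (u_ext s \<omega>)) \<partial>lborel) \<le>
      (\<integral>\<^sup>+s. indicator {0..T} s + ennreal ((norm (u_ext s \<omega>))\<^sup>2) * indicator {0..T} s \<partial>lborel)"
      using ennreal_norm_le_one_plus_square by (intro nn_integral_mono) (auto simp: indicator_def)
    also have "\<dots> = ennreal T + (\<integral>\<^sup>+s\<in>{0..T}. ennreal ((norm (u_ext s \<omega>))\<^sup>2) \<partial>lborel)"
      using T_nonneg by (subst nn_integral_add) auto
    also have "\<dots> < \<infinity>"
      using elim(1) nn_integral_u_ext[of T "\<lambda>v. ennreal ((norm v)\<^sup>2)" \<omega>] by simp
    finally show ?case using nn_integral_u_ext[of T "\<lambda>v. ennreal (norm v)" \<omega>] by simp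
  qed
  fix t assume t: "t \<in> {0..T}"
  let ?b = "\<lambda>\<omega>. \<integral>\<^sup>+s\<in>{0..t}. (1 + ennreal (norm (u s \<omega>))) \<partial>lborel"
  obtain X where Xm [measurable]: "X \<in> borel_measurable P"
    and eq: "AE \<omega> in P. set_integrable lborel {0..t} (drift_term t \<omega>) \<and>
        u t \<omega> = S t (u0 \<omega>) + (LINT s:{0..t}|lborel. drift_term t \<omega> s) + X \<omega>"
    and X2: "(\<integral>\<^sup>+\<omega>. ennreal ((norm (X \<omega>))\<^sup>2) \<partial>P) \<le> ennreal (6 + 4 * noise_bound * T)"
    and "\<forall>l :: 'b \<Rightarrow> real. bounded_linear l \<longrightarrow> integrable P (\<lambda>\<omega>. l (X \<omega>)) \<and> (LINT \<omega>|P. l (X \<omega>)) = 0"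
    using mild_solution_at[OF t] by (elim exE conjE) (rule that; assumption)
  have X1: "(\<integral>\<^sup>+\<omega>. ennreal (norm (X \<omega>)) \<partial>P) \<le> ennreal (7 + 4 * noise_bound * T)"
  proof -
    have "(\<integral>\<^sup>+\<omega>. ennreal (norm (X \<omega>)) \<partial>P) \<le> (\<integral>\<^sup>+\<omega>. 1 + ennreal ((norm (X \<omega>))\<^sup>2) \<partial>P)"
      by (intro nn_integral_mono ennreal_norm_le_one_plus_square)
    also have "\<dots> = 1 + (\<integral>\<^sup>+\<omega>. ennreal ((norm (X \<omega>))\<^sup>2) \<partial>P)"
      by (subst nn_integral_add) (auto simp: emeasure_space_1)
    also have "\<dots> \<le> 1 + ennreal (6 + 4 * noise_bound * T)" using X2 by (rule add_left_mono)
    also have "\<dots> = ennreal (7 + 4 * noise_bound * T)"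
      using noise_bound_nonneg T_nonneg by (subst ennreal_1[symmetric], subst ennreal_plus[symmetric]) auto
    finally show ?thesis .
  qed
  have "AE \<omega> in P. ennreal (norm (u t \<omega>)) \<le> ?a \<omega> +
      ennreal (\<kappa> * \<gamma>) * ?b \<omega> + ennreal (norm (X \<omega>))"
    using eq AE_space
  proof eventually_elim
    case (elim \<omega>)
    let ?I = "LINT s:{0..t}|lborel. drift_term t \<omega> s"
    have "ennreal (norm ?I) \<le> (\<integral>\<^sup>+s. ennreal (norm (indicator {0..t} s *\<^sub>R S (t - s) (G s (u s \<omega>)))) \<partial>lborel)"
      using elim(1) unfolding set_lebesgue_integral_def set_integrable_def by (intro integral_norm_bound_ennreal) simp
    also have "\<dots> \<le> (\<integral>\<^sup>+s. ennreal (\<kappa> * \<gamma>) * ((1 + ennreal (norm (u s \<omega>))) * indicator {0..t} s) \<partial>lborel)"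
    proof (intro nn_integral_mono)
      fix s
      show "ennreal (norm (indicator {0..t} s *\<^sub>R S (t - s) (G s (u s \<omega>)))) \<le> ennreal (\<kappa> * \<gamma>) * ((1 + ennreal (norm (u s \<omega>))) * indicator {0..t} s)"
      proof (cases "s \<in> {0..t}")
        case True
        then have s: "s \<in> {0..T}" using t by auto
        note g = G_bound(2)[OF s u_in_H[OF s elim(2)]]
        have "norm (S (t - s) (G s (u s \<omega>))) \<le> \<kappa> * (\<gamma> * (1 + norm (u s \<omega>)))"
          using S_bound(2)[of "G s (u s \<omega>)" "t - s"] g S_bound(1) by (auto intro: order_trans mult_left_mono)
        then have "ennreal (norm (S (t - s) (G s (u s \<omega>)))) \<le> ennreal (\<kappa> * \<gamma> * (1 + norm (u s \<omega>)))"
          by (intro ennreal_leI) (simp add: mult.assoc)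
        also have "\<dots> = ennreal (\<kappa> * \<gamma>) * (1 + ennreal (norm (u s \<omega>)))"
          using S_bound(1) G_bound(1) by (simp add: ennreal_mult)
        finally show ?thesis using True by simp
      qed simp
    qed
    also have "\<dots> = ennreal (\<kappa> * \<gamma>) * ?b \<omega>"
    proof (rule nn_integral_cmult)
      note [measurable] = elim(2)
      have "(\<lambda>s. (1 + ennreal (norm (u_ext s \<omega>))) * indicator {0..t} s) \<in> borel_measurable lborel"
        by measurable
      also have "(\<lambda>s. (1 + ennreal (norm (u_ext s \<omega>))) * indicator {0..t} s)
        = (\<lambda>s. (1 + ennreal (norm (u s \<omega>))) * indicator {0..t} s)"
        using t by (auto simp: fun_eq_iff indicator_def u_ext_eq)
      finally show "(\<lambda>s. (1 + ennreal (norm (u s \<omega>))) * indicator {0..t} s) \<in> borel_measurable lborel" .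
    qed
    finally have I: "ennreal (norm ?I) \<le> ennreal (\<kappa> * \<gamma>) * ?b \<omega>" .
    have "norm (u t \<omega>) \<le> norm (S t (u0 \<omega>)) + norm ?I + norm (X \<omega>)"
      using elim(1) norm_triangle_ineq[of "S t (u0 \<omega>) + ?I" "X \<omega>"] norm_triangle_ineq[of "S t (u0 \<omega>)" ?I] by simp
    also have "\<dots> \<le> \<kappa> * norm (u0 \<omega>) + norm ?I + norm (X \<omega>)"
      using S_bound(2)[OF u0_in_H[OF elim(2)]] by simp
    finally have "ennreal (norm (u t \<omega>)) \<le> ?a \<omega> + ennreal (norm ?I) + ennreal (norm (X \<omega>))"
      using S_bound(1) by (simp add: ennreal_plus[symmetric] del: ennreal_plus)
    also have "\<dots> \<le> ?a \<omega> + ennreal (\<kappa> * \<gamma>) * ?b \<omega> + ennreal (norm (X \<omega>))"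
      using I by (intro add_mono order_refl)
    finally show ?case .
  qed
  then show "\<exists>x. (AE \<omega> in P. ennreal (norm (u t \<omega>)) \<le> ?a \<omega> +
      ennreal (\<kappa> * \<gamma>) * ?b \<omega> + x \<omega>) \<and> (\<integral>\<^sup>+\<omega>. x \<omega> \<partial>P) \<le> ennreal (7 + 4 * noise_bound * T)"
    using X1 by (intro exI[of _ "\<lambda>\<omega>. ennreal (norm (X \<omega>))"] conjI)
qed

text \<open>A bounded functional commutes with the Bochner integral, and invariance under the group
  removes S (t - s) at each s. Integrability of the scalar path is inherited from the drift
  term.\<close>

lemma path_functional:
  fixes l :: "'b \<Rightarrow> real" and g :: "real \<Rightarrow> 'b \<Rightarrow> real"
  assumes l: "bounded_linear l" and l_S: "\<And>t v. v \<in> H \<Longrightarrow> l (S t v) = l v"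
    and l_G: "\<And>t v. t \<in> {0..T} \<Longrightarrow> v \<in> H \<Longrightarrow> l (G t v) = - g t v"
    and t: "t \<in> {0..T}" and \<omega>: "\<omega> \<in> space P"
    and int: "set_integrable lborel {0..t} (drift_term t \<omega>)"
  shows "set_integrable lborel {0..t} (\<lambda>s. g s (u s \<omega>))" (is ?C1)
    and "l (LINT s:{0..t}|lborel. drift_term t \<omega> s) = - (LINT s:{0..t}|lborel. g s (u s \<omega>))" (is ?C2)
proof -
  interpret l: bounded_linear l by fact
  have lG: "indicator {0..t} s *\<^sub>R l (S (t - s) (G s (u s \<omega>))) = - (indicator {0..t} s *\<^sub>R g s (u s \<omega>))" for s
  proof (cases "s \<in> {0..t}")
    case True
    then have s: "s \<in> {0..T}" using t by auto
    note v = u_in_H[OF s \<omega>]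
    show ?thesis using l_S[of "G s (u s \<omega>)" "t - s"] G_bound(2)[OF s v] l_G[OF s v] by simp
  qed simp
  note i = int[unfolded set_integrable_def]
  have e: "(\<lambda>s. l (indicator {0..t} s *\<^sub>R S (t - s) (G s (u s \<omega>)))) = (\<lambda>s. - (indicator {0..t} s *\<^sub>R g s (u s \<omega>)))"
    unfolding l.scaleR lG ..
  show ?C1
    using integrable_bounded_linear[OF l i] unfolding e set_integrable_def by simp
  show ?C2
    using integral_bounded_linear[OF l i] unfolding e set_lebesgue_integral_def by simp
qed

lemma drift_path_integrable:
  assumes "t \<in> {0..T}"
  shows "AE \<omega> in P. set_integrable lborel {0..t} (drift_term t \<omega>)"
proof -
  obtain X where "AE \<omega> in P. set_integrable lborel {0..t} (drift_term t \<omega>) \<and>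
        u t \<omega> = S t (u0 \<omega>) + (LINT s:{0..t}|lborel. drift_term t \<omega> s) + X \<omega>"
    using mild assms unfolding mild_solution_def by blast
  then show ?thesis by eventually_elim simp
qed

lemma invariant_functional_average:
  fixes l :: "'b \<Rightarrow> real" and g :: "real \<Rightarrow> 'b \<Rightarrow> real"
  assumes l: "bounded_linear l" and l_S: "\<And>t v. v \<in> H \<Longrightarrow> l (S t v) = l v"
    and g: "continuous_on ({0..T} \<times> UNIV) (\<lambda>(t, v). g t v)"
    and l_G: "\<And>t v. t \<in> {0..T} \<Longrightarrow> v \<in> H \<Longrightarrow> l (G t v) = - g t v"
    and t: "t \<in> {0..T}"
  shows "integrable P (\<lambda>\<omega>. l (u t \<omega>))" (is ?C1) "integrable P (\<lambda>\<omega>. l (u0 \<omega>))" (is ?C2)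
    "integrable P (\<lambda>\<omega>. LINT s:{0..t}|lborel. g s (u s \<omega>))" (is ?C3)
    "(LINT \<omega>|P. l (u t \<omega>)) = (LINT \<omega>|P. l (u0 \<omega>)) - (LINT \<omega>|P. (LINT s:{0..t}|lborel. g s (u s \<omega>)))" (is ?C4)
proof -
  let ?g = "\<lambda>\<omega>. LINT s:{0..t}|lborel. g s (u s \<omega>)"
  let ?n = "\<lambda>\<omega>. \<integral>\<^sup>+s\<in>{0..T}. ennreal (norm (u_ext s \<omega>)) \<partial>lborel"
  interpret l: bounded_linear l by fact
  obtain C where C: "\<And>x. norm (l x) \<le> norm x * C" "0 < C" using l.pos_bounded by auto
  have [measurable]: "l \<in> borel_measurable borel"
    by (intro borel_measurable_continuous_onI linear_continuous_on l)
  note [measurable] = u0_measurable u_measurable[OF t]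
  show l0: ?C2
    by (rule Bochner_Integration.integrable_bound[OF integrable_mult_left[OF u0_integrable, of C]])
       (use C order_trans[OF C(1) abs_ge_self] in auto)
  obtain X where Xm [measurable]: "X \<in> borel_measurable P"
    and eq: "AE \<omega> in P. set_integrable lborel {0..t} (drift_term t \<omega>) \<and>
        u t \<omega> = S t (u0 \<omega>) + (LINT s:{0..t}|lborel. drift_term t \<omega> s) + X \<omega>"
    and "(\<integral>\<^sup>+\<omega>. ennreal ((norm (X \<omega>))\<^sup>2) \<partial>P) \<le> ennreal (6 + 4 * noise_bound * T)"
    and X_mean: "\<forall>l :: 'b \<Rightarrow> real. bounded_linear l \<longrightarrow> integrable P (\<lambda>\<omega>. l (X \<omega>)) \<and> (LINT \<omega>|P. l (X \<omega>)) = 0"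
    using mild_solution_at[OF t] by (elim exE conjE) (rule that; assumption)
  have lX: "integrable P (\<lambda>\<omega>. l (X \<omega>))" "(LINT \<omega>|P. l (X \<omega>)) = 0"
    using X_mean l by blast+
  have pathwise: "AE \<omega> in P. l (u t \<omega>) = l (u0 \<omega>) - ?g \<omega> + l (X \<omega>)"
    using eq AE_space
  proof eventually_elim
    case (elim \<omega>)
    then show ?case
      using path_functional(2)[OF l l_S l_G t elim(2)] l_S[OF u0_in_H[OF elim(2)]] by (simp add: l.add)
  qed
  define h where "h s \<omega> = indicator {0..t} s *\<^sub>R g s (u s \<omega>)" for s \<omega>
  \<comment> \<open>A continuous function on a closed set, extended by zero, is Borel. Composition
    with \<open>u_ext\<close> yields joint measurability, and the time integral is then measurable
    in \<omega>.\<close>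
  define g' where "g' p = indicator ({0..T} \<times> UNIV) p *\<^sub>R (case p of (t, v) \<Rightarrow> g t v)" for p
  have "closed ({0..T} \<times> (UNIV :: 'b set))" by (intro closed_Times) auto
  then have g'_meas: "g' \<in> borel_measurable borel"
    unfolding g'_def by (intro borel_measurable_continuous_on_indicator g) auto
  have h_eq: "h s \<omega> = indicator {0..t} s * g' (s, u_ext s \<omega>)" for s \<omega>
    using t by (auto simp: h_def g'_def indicator_def u_ext_eq)
  have h_meas: "(\<lambda>(\<omega>, s). h s \<omega>) \<in> borel_measurable (P \<Otimes>\<^sub>M lborel)"
  proof -
    have "(\<lambda>p. (snd p, u_ext (snd p) (fst p))) \<in> borel_measurable (P \<Otimes>\<^sub>M lborel)"
      by (intro borel_measurable_Pair) measurable
    note [measurable] = measurable_compose[OF this g'_meas]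
    show ?thesis unfolding h_eq split_beta by measurable
  qed
  show int: ?C3
  proof (rule integrableI_bounded)
    have "(\<lambda>\<omega>. LINT s|lborel. h s \<omega>) \<in> borel_measurable P"
      by (rule lborel.borel_measurable_lebesgue_integral[OF h_meas])
    then show "(\<lambda>\<omega>. LINT s:{0..t}|lborel. g s (u s \<omega>)) \<in> borel_measurable P"
      by (simp add: set_lebesgue_integral_def h_def)
    have "(\<integral>\<^sup>+\<omega>. ennreal (norm (?g \<omega>)) \<partial>P) \<le>
      (\<integral>\<^sup>+\<omega>. ennreal (\<gamma> * C) * (ennreal T + ?n \<omega>) \<partial>P)"
    proof (rule nn_integral_mono)
      fix \<omega> assume \<omega>: "\<omega> \<in> space P"
      note [measurable] = \<omega>
      have "ennreal (norm (LINT s|lborel. h s \<omega>)) \<le> (\<integral>\<^sup>+s. ennreal (norm (h s \<omega>)) \<partial>lborel)"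
      proof (cases "integrable lborel (\<lambda>s. h s \<omega>)")
        \<comment> \<open>The Bochner integral of a nonintegrable function is 0 by convention, so
          the estimate holds at every \<omega>, with no null set to exclude.\<close>
        case False
        then show ?thesis by (simp add: not_integrable_integral_eq)
      qed (rule integral_norm_bound_ennreal)
      also have "\<dots> \<le> (\<integral>\<^sup>+s. ennreal (\<gamma> * C) * (indicator {0..T} s + ennreal (norm (u_ext s \<omega>)) * indicator {0..T} s) \<partial>lborel)"
      proof (intro nn_integral_mono)
        fix s
        show "ennreal (norm (h s \<omega>)) \<le> ennreal (\<gamma> * C) * (indicator {0..T} s + ennreal (norm (u_ext s \<omega>)) * indicator {0..T} s)"
        proof (cases "s \<in> {0..t}")
          case True
          then have s: "s \<in> {0..T}" using t by auto
          note v = u_in_H[OF s \<omega>]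
          have "norm (h s \<omega>) = norm (l (G s (u s \<omega>)))" using True l_G[OF s v] by (simp add: h_def)
          also have "\<dots> \<le> norm (G s (u s \<omega>)) * C" by (rule C(1))
          also have "\<dots> \<le> (\<gamma> * (1 + norm (u s \<omega>))) * C"
            using G_bound(2)[OF s v] C(2) by (intro mult_right_mono) auto
          finally have "ennreal (norm (h s \<omega>)) \<le> ennreal ((\<gamma> * C) * (1 + norm (u s \<omega>)))"
            by (intro ennreal_leI) (simp add: mult_ac)
          also have "\<dots> = ennreal (\<gamma> * C) * (1 + ennreal (norm (u s \<omega>)))"
            using G_bound(1) C(2) by (simp add: ennreal_mult)
          finally show ?thesis using s by (simp add: u_ext_eq)
        qed (simp add: h_def)
      qed
      also have "\<dots> = ennreal (\<gamma> * C) * (\<integral>\<^sup>+s. indicator {0..T} s + ennreal (norm (u_ext s \<omega>)) * indicator {0..T} s \<partial>lborel)"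
        by (rule nn_integral_cmult) measurable
      also have "\<dots> = ennreal (\<gamma> * C) * (ennreal T + ?n \<omega>)"
        using T_nonneg by (subst nn_integral_add) auto
      finally show "ennreal (norm (?g \<omega>)) \<le> ennreal (\<gamma> * C) * (ennreal T + ?n \<omega>)"
        by (simp add: set_lebesgue_integral_def h_def)
    qed
    also have "\<dots> = ennreal (\<gamma> * C) * (ennreal T + (\<integral>\<^sup>+\<omega>. ?n \<omega> \<partial>P))"
      by (simp add: nn_integral_cmult nn_integral_add emeasure_space_1)
    also have "\<dots> < \<infinity>"
      using first_moment_finite unfolding nn_integral_u_ext[of T "\<lambda>v. ennreal (norm v)", OF order_refl]
      by (simp add: ennreal_mult_less_top)
    finally show "(\<integral>\<^sup>+\<omega>. ennreal (norm (?g \<omega>)) \<partial>P) < \<infinity>" .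
  qed
  let ?r = "\<lambda>\<omega>. l (u0 \<omega>) - ?g \<omega> + l (X \<omega>)"
  have r: "integrable P ?r" using l0 int lX by simp
  have ae: "AE \<omega> in P. ?r \<omega> = l (u t \<omega>)" using pathwise by eventually_elim simp
  show ?C1
    by (rule integrable_cong_AE_imp[OF r _ ae]) measurable
  have "(LINT \<omega>|P. l (u t \<omega>)) = integral\<^sup>L P ?r"
    by (rule integral_cong_AE) (use r ae in \<open>auto elim: eventually_mono\<close>)
  also have "\<dots> = (LINT \<omega>|P. l (u0 \<omega>)) - (LINT \<omega>|P. ?g \<omega>)"
    using l0 int lX by simp
  finally show ?C4 .
qed

end


section \<open>Initial moments, and the Maxwell system as an instance of the abstract
  setting\<close>

lemma integrable_of_powr:
  fixes f :: "'a \<Rightarrow> real"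
  assumes P: "prob_space P" and f [measurable]: "f \<in> borel_measurable P" and nonneg: "\<And>x. 0 \<le> f x" and p: "1 \<le> p"
    and fin: "(\<integral>\<^sup>+x. ennreal (f x powr p) \<partial>P) < \<infinity>"
  shows "integrable P f"
proof (rule Bochner_Integration.integrable_bound)
  interpret prob_space P by fact
  have "integrable P (\<lambda>x. f x powr p)"
    by (rule integrableI_nonneg) (use fin in auto)
  then show "integrable P (\<lambda>x. 1 + f x powr p)" by simp
  show "AE x in P. norm (f x) \<le> norm (1 + f x powr p)"
  proof (rule AE_I2)
    fix x
    have "f x \<le> 1 + f x powr p"
    proof (cases "f x \<le> 1")
      case False
      then have "f x powr 1 \<le> f x powr p" using p by (intro powr_mono) auto
      then show ?thesis using False by simp
    qed (auto intro: order_trans)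
    then show "norm (f x) \<le> norm (1 + f x powr p)" using nonneg[of x] by simp
  qed
qed measurable

theorem proposition2p5:
  fixes D :: "r3 set" and T \<delta> L p :: real
    and \<epsilon> \<mu> :: "r3 \<Rightarrow> real"
    and Je Jm :: "real \<Rightarrow> r3 \<Rightarrow> r3 \<Rightarrow> r3 \<Rightarrow> r3"
    and Jer Jmr :: "real \<Rightarrow> r3 \<Rightarrow> r3"
    and S :: "real \<Rightarrow> state \<Rightarrow> state"
    and P :: "'w measure" and Filt :: "real \<Rightarrow> 'w measure"
    and e :: "nat \<Rightarrow> (r3, real) L2"
    and Q Q_half :: "(r3, real) L2 \<Rightarrow> (r3, real) L2"
    and W :: "real \<Rightarrow> 'w \<Rightarrow> (r3, real) L2"
    and u0 :: "'w \<Rightarrow> state" and u :: "real \<Rightarrow> 'w \<Rightarrow> state"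
  defines "U \<equiv> L2_on D :: (r3, real) L2 set"
    and "H \<equiv> state_space D"
    and "F \<equiv> drift D \<epsilon> \<mu> Je Jm"
    and "B \<equiv> diffusion D \<epsilon> \<mu> Jer Jmr"
  assumes domain: "open D" "connected D" "bounded D" "D \<noteq> {}"
    and T: "0 < T"
    and coefficients: "0 < \<delta>" "bounded_coefficient D \<delta> \<epsilon>" "bounded_coefficient D \<delta> \<mu>"
    and currents: "0 < L" "lipschitz_current D T L Je" "lipschitz_current D T L Jm"
    and noise_currents: "bounded_current D T Jer" "bounded_current D T Jmr"
    and group: "unitary_group_on H (state_inner D \<epsilon> \<mu>) S" "generator H S = maxwell D \<epsilon> \<mu>"
    and stochastic_basis: "filtered_prob_space P Filt T"
    and Q: "orthonormal_basis U e" "covariance_operator U e Q" "positive_sqrt U Q Q_half"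
    and W: "wiener_process P Filt T U Q W"
    and F_C2: "\<forall>t\<in>{0..T}. C2_bounded_on (maxwell_domain D) (graph_norm D \<epsilon> \<mu>) (F t)"
    and B_HS: "\<forall>t\<in>{0..T}. hilbert_schmidt_on U e Q_half (maxwell_domain D) (graph_norm D \<epsilon> \<mu>) (B t)"
    and p: "2 \<le> p"
    and u0: "u0 \<in> borel_measurable (Filt 0)" "\<forall>\<omega>\<in>space P. u0 \<omega> \<in> H"
      "AE \<omega> in P. u0 \<omega> \<in> maxwell_domain D"
      "(\<integral>\<^sup>+\<omega>. ennreal (graph_norm D \<epsilon> \<mu> (u0 \<omega>) powr p) \<partial>P) < \<infinity>"
    and u: "mild_solution P Filt T U e Q_half H W S F B u0 u"
  defines "div_E \<equiv> \<lambda>v. divergence D (\<lambda>x. \<epsilon> x *\<^sub>R fn_L2 (fst v) x)"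
    and "div_H \<equiv> \<lambda>v. divergence D (\<lambda>x. \<mu> x *\<^sub>R fn_L2 (snd v) x)"
    and "div_Je \<equiv> \<lambda>\<omega> s. divergence D (at_state Je s (u s \<omega>))"
    and "div_Jm \<equiv> \<lambda>\<omega> s. divergence D (at_state Jm s (u s \<omega>))"
  shows "\<forall>t\<in>{0..T}.
    distr_integrable D P (\<lambda>\<omega>. div_E (u t \<omega>)) \<and>
    distr_integrable D P (\<lambda>\<omega>. div_E (u0 \<omega>)) \<and>
    (AE \<omega> in P. distr_time_integrable D t (div_Je \<omega>)) \<and>
    distr_integrable D P (\<lambda>\<omega>. distr_time_integral t (div_Je \<omega>)) \<and>
    (\<forall>\<phi>\<in>test_fun D.
      distr_expectation P (\<lambda>\<omega>. div_E (u t \<omega>)) \<phi> =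
        distr_expectation P (\<lambda>\<omega>. div_E (u0 \<omega>)) \<phi> -
        distr_expectation P (\<lambda>\<omega>. distr_time_integral t (div_Je \<omega>)) \<phi>) \<and>
    distr_integrable D P (\<lambda>\<omega>. div_H (u t \<omega>)) \<and>
    distr_integrable D P (\<lambda>\<omega>. div_H (u0 \<omega>)) \<and>
    (AE \<omega> in P. distr_time_integrable D t (div_Jm \<omega>)) \<and>
    distr_integrable D P (\<lambda>\<omega>. distr_time_integral t (div_Jm \<omega>)) \<and>
    (\<forall>\<phi>\<in>test_fun D.
      distr_expectation P (\<lambda>\<omega>. div_H (u t \<omega>)) \<phi> =
        distr_expectation P (\<lambda>\<omega>. div_H (u0 \<omega>)) \<phi> -
        distr_expectation P (\<lambda>\<omega>. distr_time_integral t (div_Jm \<omega>)) \<phi>)"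
proof -
  interpret M: maxwell_coefficients D \<delta> \<epsilon> \<mu>
    using domain coefficients by unfold_locales
  interpret wiener_basis U e P Filt T Q Q_half W
    using stochastic_basis Q W by unfold_locales
  obtain \<kappa> where \<kappa>: "0 \<le> \<kappa>" "\<And>t v. v \<in> H \<Longrightarrow> norm (S t v) \<le> \<kappa> * norm v"
    using M.unitary_group_bounded[OF group(1)[unfolded H_def]] unfolding H_def by blast
  obtain \<gamma> where \<gamma>: "0 \<le> \<gamma>" "\<And>t v. t \<in> {0..T} \<Longrightarrow> F t v \<in> H \<and> norm (F t v) \<le> \<gamma> * (1 + norm v)"
    using M.drift_bounds[OF currents(2,3,1)] unfolding F_def H_def by blast
  obtain \<beta> where \<beta>: "0 \<le> \<beta>" "\<And>t v. t \<in> {0..T} \<Longrightarrow> B t v \<in> H \<and> norm (B t v) \<le> \<beta> * norm v"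
    using M.diffusion_bounds[OF noise_currents] unfolding B_def H_def by blast
  have T0: "0 \<le> T" using T by simp
  have u0P [measurable]: "u0 \<in> borel_measurable P" by (rule measurable_F_P[OF order_refl T0 u0(1)])
  have u0_int: "integrable P (\<lambda>\<omega>. norm (u0 \<omega>))"
  proof -
    \<comment> \<open>The graph norm dominates sqrt \<delta> times the norm of the type on the state
      space, so the moment of order p of the initial datum yields the first moment required by the
      abstract setting.\<close>
    have "integrable P (\<lambda>\<omega>. sqrt \<delta> * norm (u0 \<omega>))"
    proof (rule integrable_of_powr[OF prob])
      have "(\<integral>\<^sup>+\<omega>. ennreal ((sqrt \<delta> * norm (u0 \<omega>)) powr p) \<partial>P) \<le> (\<integral>\<^sup>+\<omega>. ennreal (graph_norm D \<epsilon> \<mu> (u0 \<omega>) powr p) \<partial>P)"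
        using M.graph_norm_ge u0(2) p coefficients(1) unfolding H_def
        by (intro nn_integral_mono ennreal_leI powr_mono2) auto
      then show "(\<integral>\<^sup>+\<omega>. ennreal ((sqrt \<delta> * norm (u0 \<omega>)) powr p) \<partial>P) < \<infinity>"
        using u0(4) by (rule le_less_trans)
    qed (use p coefficients(1) in auto)
    then show ?thesis using coefficients(1) by simp
  qed
  interpret mild_solution_setting U e P Filt T Q Q_half W H S F B u0 u \<kappa> \<gamma> \<beta>
    by unfold_locales (use T0 u \<kappa> \<gamma> \<beta> u0P u0(2) u0_int in auto)
  have E: "bounded_linear (\<lambda>v. div_E v \<phi>)" "\<And>t v. v \<in> H \<Longrightarrow> div_E (S t v) \<phi> = div_E v \<phi>"
      "\<And>t v. t \<in> {0..T} \<Longrightarrow> v \<in> H \<Longrightarrow> div_E (F t v) \<phi> = - divergence D (at_state Je t v) \<phi>"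
    and H: "bounded_linear (\<lambda>v. div_H v \<phi>)" "\<And>t v. v \<in> H \<Longrightarrow> div_H (S t v) \<phi> = div_H v \<phi>"
      "\<And>t v. t \<in> {0..T} \<Longrightarrow> v \<in> H \<Longrightarrow> div_H (F t v) \<phi> = - divergence D (at_state Jm t v) \<phi>"
    if \<phi>: "\<phi> \<in> test_fun D" for \<phi>
  proof -
    obtain g where g: "\<And>w. divergence D (\<lambda>x. \<epsilon> x *\<^sub>R fn_L2 w x) \<phi> = w \<bullet> g"
      using M.weighted_divergence_inner[OF coefficients(2) \<phi>] by blast
    show "bounded_linear (\<lambda>v. div_E v \<phi>)"
      unfolding div_E_def g by (intro bounded_linear_inner_left_comp bounded_linear_fst)
    obtain h where h: "\<And>w. divergence D (\<lambda>x. \<mu> x *\<^sub>R fn_L2 w x) \<phi> = w \<bullet> h"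
      using M.weighted_divergence_inner[OF coefficients(3) \<phi>] by blast
    show "bounded_linear (\<lambda>v. div_H v \<phi>)"
      unfolding div_H_def h by (intro bounded_linear_inner_left_comp bounded_linear_snd)
    show "div_E (S t v) \<phi> = div_E v \<phi>" "div_H (S t v) \<phi> = div_H v \<phi>" if "v \<in> H" for t v
      unfolding div_E_def div_H_def
      by (rule M.divergence_group_invariant[OF group[unfolded H_def] \<phi> that[unfolded H_def]])+
    show "div_E (F t v) \<phi> = - divergence D (at_state Je t v) \<phi>" if "t \<in> {0..T}" for t v
      unfolding div_E_def F_def drift_def fst_conv
      by (rule M.drift_component(3)[OF coefficients(2) currents(2,1) that \<phi>])
    show "div_H (F t v) \<phi> = - divergence D (at_state Jm t v) \<phi>" if "t \<in> {0..T}" for t v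
      unfolding div_H_def F_def drift_def snd_conv
      by (rule M.drift_component(3)[OF coefficients(3) currents(3,1) that \<phi>])
  qed
  note avg_E = invariant_functional_average[OF E(1,2) M.current_divergence_continuous[OF currents(2,1)] E(3)]
  note avg_H = invariant_functional_average[OF H(1,2) M.current_divergence_continuous[OF currents(3,1)] H(3)]
  \<comment> \<open>One null set serves all test functions: it comes from the integrability of the
    state-valued drift term, before any \<phi> is chosen.\<close>
  have "AE \<omega> in P. distr_time_integrable D t (div_Je \<omega>) \<and> distr_time_integrable D t (div_Jm \<omega>)" if t: "t \<in> {0..T}" for t
    using drift_path_integrable[OF t] AE_space
  proof eventually_elim
    case (elim \<omega>)
    show ?case
      unfolding distr_time_integrable_def div_Je_def div_Jm_def
      using path_functional(1)[OF E(1,2) E(3) t elim(2,1)] path_functional(1)[OF H(1,2) H(3) t elim(2,1)] by blast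
  qed
  then have "(AE \<omega> in P. distr_time_integrable D t (div_Je \<omega>)) \<and> (AE \<omega> in P. distr_time_integrable D t (div_Jm \<omega>))"
    if "t \<in> {0..T}" for t
    using that by (simp add: AE_conj_iff)
  then show ?thesis
    unfolding distr_integrable_def distr_expectation_def distr_time_integral_def div_Je_def div_Jm_def
    using avg_E avg_H by blast
qed

end
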